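(* Let $a>0$, $\omega>0$, let $\kappa$ be either $\sin$ or $\cos$, let $N=\lfloor\omega a/\pi\rfloor+1$, and let $\ell\ge1$ and $r$ be integers with $1\le r\le 2\ell$. For $f\in C^0([-a,a])$, $y\in[-a,a]$ and $m\ge1$ let $$\mathcal{I}^\omega(f,y)=\int_{-a}^a\kappa(\omega(y-x))f(x)\,dx,$$ $$\widetilde{\mathcal{I}}^\omega_{m,\ell}(f,y)=\frac{a}{N}\sum_{j=0}^m f(t_j)\sum_{i=0}^m c^{(m,\ell)}_{i,j}\left(\sum_{h=1}^N\sum_{k=1}^m\lambda_k\,\bar p_{m,i}\big(\gamma_h^{-1}(z_k)\big)\,\kappa\big(\omega(y-\gamma_h^{-1}(z_k))\big)\right).$$ Then there exist $m_0$ and a constant $\mathcal{C}>0$, both not depending on $m$ and $f$, such that for every $f\in W_r$, every $y\in[-a,a]$ and every $m>m_0$, $$|\mathcal{I}^\omega(f,y)-\widetilde{\mathcal{I}}^\omega_{m,\ell}(f,y)|\le\mathcal{C}\,\|f\|_{W_r}\left[\frac{a^{r+1}}{(\sqrt m)^r}+m^{\frac32}\,\|C_{m,\ell}\|_\infty\left(\frac{a}{N}\cdot\frac{m+\omega}{2m-1}\right)^m\right].$$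
   Context: $C^0([-a,a])$ is the space of continuous functions on $[-a,a]$ with norm $\|f\|=\max_{x\in[-a,a]}|f(x)|$. For $m\ge1$: $t_j=-a+j\frac{2a}{m}$ ($0\le j\le m$) are equispaced nodes, and $\bar p_{m,i}(x)=\binom{m}{i}\left(\frac{a+x}{2a}\right)^i\left(\frac{a-x}{2a}\right)^{m-i}$ ($0\le i\le m$) are the Bernstein basis polynomials on $[-a,a]$. The matrix $C_{m,\ell}=(c^{(m,\ell)}_{i,j})_{0\le i,j\le m}$ is $C_{m,\ell}=\mathbf{I}+(\mathbf{I}-\mathbf{A})+\dots+(\mathbf{I}-\mathbf{A})^{\ell-1}$, with $\mathbf{I}$ the identity of order $m+1$ and $\mathbf{A}_{i,j}=\bar p_{m,j}(t_i)$; $\|\cdot\|_\infty$ is the matrix infinity norm (maximum absolute row sum). The interval $[-a,a]$ is split into $N$ subintervals $[x_{h-1},x_h]$, with $x_h=-a+h\eta$, $\eta=2a/N$; $\gamma_h^{-1}(z)=x_{h-1}+\frac{\eta}{2}(z+1)$ is the affine bijection $[-1,1]\to[x_{h-1},x_h]$. $z_1,\dots,z_m$ are the zeros of the $m$-th Legendre polynomial and $\lambda_1,\dots,\lambda_m$ the corresponding Gauss–Legendre weights on $[-1,1]$. Sobolev-type space: for an integer $r\ge1$, with $\phi(x)=\sqrt{a^2-x^2}$, $W_r$ is the set of $f\in C^0([-a,a])$ such that $f^{(r-1)}$ is locally absolutely continuous (i.e. absolutely continuous on every closed subinterval of $(-a,a)$) and $\|f^{(r)}\phi^r\|<\infty$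 (essential supremum over $(-a,a)$, since $f^{(r)}$ exists almost everywhere), with norm $\|f\|_{W_r}=\|f\|+\|f^{(r)}\phi^r\|$. Constants may depend on quantities other than $m$ and $f$ (such as $a,\omega,\ell,r$). *)

theory Defs
  imports
    "HOL-Analysis.Analysis"
    "HOL-Computational_Algebra.Polynomial"
    "HOL-Probability.Essential_Supremum"
    "Jordan_Normal_Form.Matrix"
begin

definition equi_node :: "real \<Rightarrow> nat \<Rightarrow> nat \<Rightarrow> real" where
  "equi_node a m j = - a + real j * (2 * a / real m)"

definition bern :: "real \<Rightarrow> nat \<Rightarrow> nat \<Rightarrow> real \<Rightarrow> real" where
  "bern a m i x = real (m choose i) * ((a + x) / (2 * a)) ^ i * ((a - x) / (2 * a)) ^ (m - i)"

definition bern_mat :: "real \<Rightarrow> nat \<Rightarrow> real mat" where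
  "bern_mat a m = mat (m + 1) (m + 1) (\<lambda>(i, j). bern a m j (equi_node a m i))"

(* I + (I - A) + ... + (I - A)^(l - 1), written entrywise because the type of matrices, whose
   dimensions vary, has no zero for an indexed sum. *)
definition C_mat :: "real \<Rightarrow> nat \<Rightarrow> nat \<Rightarrow> real mat" where
  "C_mat a m l = mat (m + 1) (m + 1)
     (\<lambda>(i, j). \<Sum>k<l. ((1\<^sub>m (m + 1) - bern_mat a m) ^\<^sub>m k) $$ (i, j))"

definition mat_inf_norm :: "real mat \<Rightarrow> real" where
  "mat_inf_norm M = Max ((\<lambda>i. \<Sum>j<dim_col M. \<bar>M $$ (i, j)\<bar>) ` {..<dim_row M})"

(* Rodrigues' formula. *)
definition legendre_poly :: "nat \<Rightarrow> real poly" where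
  "legendre_poly m = Polynomial.smult (1 / (2 ^ m * fact m)) ((pderiv ^^ m) ([:-1, 0, 1:] ^ m))"

definition legendre_zeros :: "nat \<Rightarrow> real set" where
  "legendre_zeros m = {z. poly (legendre_poly m) z = 0}"

(* The weight belonging to the zero z: the integral of the fundamental Lagrange polynomial of z. *)
definition gauss_weight :: "nat \<Rightarrow> real \<Rightarrow> real" where
  "gauss_weight m z =
     integral {-1..1} (\<lambda>x. \<Prod>w\<in>legendre_zeros m - {z}. (x - w) / (z - w))"

definition mesh_point :: "real \<Rightarrow> nat \<Rightarrow> nat \<Rightarrow> real" where
  "mesh_point a N h = - a + real h * (2 * a / real N)"

definition gamma_inv :: "real \<Rightarrow> nat \<Rightarrow> nat \<Rightarrow> real \<Rightarrow> real" where
  "gamma_inv a N h z = mesh_point a N (h - 1) + (2 * a / real N) / 2 * (z + 1)"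

definition osc_integral :: "(real \<Rightarrow> real) \<Rightarrow> real \<Rightarrow> real \<Rightarrow> (real \<Rightarrow> real) \<Rightarrow> real \<Rightarrow> real" where
  "osc_integral \<kappa> \<omega> a f y = integral {-a..a} (\<lambda>x. \<kappa> (\<omega> * (y - x)) * f x)"

(* The sum over the quadrature index k = 1, ..., m is the sum over the set of zeros z. *)
definition osc_quad ::
  "(real \<Rightarrow> real) \<Rightarrow> real \<Rightarrow> real \<Rightarrow> nat \<Rightarrow> nat \<Rightarrow> nat \<Rightarrow> (real \<Rightarrow> real) \<Rightarrow> real \<Rightarrow> real" where
  "osc_quad \<kappa> \<omega> a N m l f y =
     a / real N * (\<Sum>j\<le>m. f (equi_node a m j) *
       (\<Sum>i\<le>m. C_mat a m l $$ (i, j) *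
         (\<Sum>h=1..N. \<Sum>z\<in>legendre_zeros m.
            gauss_weight m z * bern a m i (gamma_inv a N h z) *
              \<kappa> (\<omega> * (y - gamma_inv a N h z)))))"

(* Absolute continuity of a function on the compact interval [c, d]; the library has this
   notion for measures only. *)
definition abs_cont_on :: "real \<Rightarrow> real \<Rightarrow> (real \<Rightarrow> real) \<Rightarrow> bool" where
  "abs_cont_on c d g \<longleftrightarrow>
     (\<forall>\<epsilon>>0. \<exists>\<delta>>0. \<forall>S :: (real \<times> real) set.
        finite S \<and> (\<forall>(u, v)\<in>S. c \<le> u \<and> u < v \<and> v \<le> d) \<and>
        disjoint_family_on (\<lambda>(u, v). {u<..<v}) S \<and> (\<Sum>(u, v)\<in>S. v - u) < \<delta>
        \<longrightarrow> (\<Sum>(u, v)\<in>S. \<bar>g v - g u\<bar>) < \<epsilon>)"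

definition sup_norm :: "real \<Rightarrow> (real \<Rightarrow> real) \<Rightarrow> real" where
  "sup_norm a f = (SUP x\<in>{-a..a}. \<bar>f x\<bar>)"

(* The r-th derivative only exists almost everywhere. Where it does not exist, deriv returns an
   unspecified value, which does not affect the essential supremum. *)
definition weighted_esssup :: "real \<Rightarrow> nat \<Rightarrow> (real \<Rightarrow> real) \<Rightarrow> ereal" where
  "weighted_esssup a r f =
     esssup (lebesgue_on {-a<..<a}) (\<lambda>x. ereal \<bar>(deriv ^^ r) f x * sqrt (a\<^sup>2 - x\<^sup>2) ^ r\<bar>)"

(* For r >= 1. Elements are total functions; only their values on [-a, a] matter. deriv being
   total, the existence of the derivatives of order below r has to be required explicitly. *)
definition sobolev_W :: "real \<Rightarrow> nat \<Rightarrow> (real \<Rightarrow> real) set" where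
  "sobolev_W a r = {f. continuous_on {-a..a} f \<and>
     (\<forall>k<r - 1. \<forall>x\<in>{-a<..<a}. (deriv ^^ k) f differentiable (at x)) \<and>
     (\<forall>c d. -a < c \<and> c \<le> d \<and> d < a \<longrightarrow> abs_cont_on c d ((deriv ^^ (r - 1)) f)) \<and>
     weighted_esssup a r f < \<infinity>}"

definition sobolev_norm :: "real \<Rightarrow> nat \<Rightarrow> (real \<Rightarrow> real) \<Rightarrow> real" where
  "sobolev_norm a r f = sup_norm a f + real_of_ereal (weighted_esssup a r f)"

end

theory Submission
  imports Defs
begin

text \<open>
  Write $B$ for the Bernstein operator transported to $[0,1]$ and $f$ for the transported function.
  The quadrature rule integrates $P = f - (I-B)^\ell f$ against the kernel, so its error is the
  integral of $\kappa\,(I-B)^\ell f$ plus the Gauss--Legendre error for $\kappa P$.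

  For the Gauss--Legendre error, replacing $\kappa$ on each subinterval by its Taylor polynomial of degree below $m$
  at the midpoint makes the integrand a polynomial of degree below $2m$, which the rule integrates
  exactly. The error is at most a constant times
  $(\omega a/N)^m/m! \le e^{2\omega}(a/(2N))^m$, and the rows of $C_{m,\ell}$ sum to $1$, so that
  $\|C_{m,\ell}\|_\infty \ge 1$.

  For the approximation error, take $n = m$ and $w(x) = 1/(x+1/n) + 1/(1-x+1/n)$, which is comparable to
  $\min(n, 1/\phi^2)$. Then $f$ is within $O(n^{-r/2})$ of some $g$ whose derivative of
  order $r-1$ has local Lipschitz constant $w^{r/2}$ (freeze $f^{(r-1)}$ on the two end intervals
  of length $1/n$). The mean value theorem for finite differences and weighted second moments of
  the Bernstein basis show that $g - Bg$ satisfies the same condition with $r-2$ in place of $r$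
  and an additional factor $O(1/n)$; iterating gives $(I-B)^\ell g = O(n^{-r/2})$.

  The hypothesis on $f^{(r)}$ holds only almost everywhere. An absolutely continuous function that
  fails to be differentiable on a set of positive measure would have, for some $p < q$, arbitrarily
  short intervals of slope below $p$ and of slope above $q$ around each point of such a set (or
  unbounded slopes); two nested Vitali coverings contradict absolute continuity.
\<close>

section \<open>Bernstein sums and their derivatives\<close>

text \<open>The weight 1/\<phi>^r is not integrable at the endpoints once r \<ge> 2. The shift by
  1/n in w keeps every weight finite and leaves all constants independent of n. Derivatives of order
  s of a Bernstein polynomial are combinations of s-th differences over degree n - s; by the mean
  value theorem they are, up to a factor 1 + O(1/n), averages of values of g^(s) at points near the
  nodes. One Taylor step for g^(s) needs a Lipschitz condition on g^(s+1), so two orders of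
  smoothness are spent for each factor 1/n. This is where r \<le> 2l enters:
  \<lfloor>(r-1)/2\<rfloor> + 1 applications of I - B use up all the smoothness, and any further
  application costs only a factor 2 in the maximum norm. A Lipschitz condition replaces a bound on
  the last derivative because f^(r) exists only almost everywhere and because freezing f^(r-1)
  creates corners. In the quadrature only the kernel is approximated: P itself is a polynomial of
  degree at most m, so no derivative of P has to be estimated.\<close>

definition bern_sum :: "nat \<Rightarrow> (nat \<Rightarrow> real) \<Rightarrow> real \<Rightarrow> real" where
  "bern_sum n c x = (\<Sum>k\<le>n. c k * Bernstein n k x)"

definition fdiff :: "(nat \<Rightarrow> real) \<Rightarrow> nat \<Rightarrow> real" where
  "fdiff c k = c (Suc k) - c k"

text \<open>Closed form of the s-th derivative of \<open>bern_sum n c\<close> for s \<le> n; the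
  quotient of factorials is the falling factorial n (n-1) ... (n-s+1).\<close>

definition bern_deriv :: "nat \<Rightarrow> (nat \<Rightarrow> real) \<Rightarrow> nat \<Rightarrow> real \<Rightarrow> real" where
  "bern_deriv n c s x = fact n / fact (n - s) * bern_sum (n - s) ((fdiff ^^ s) c) x"

lemma Bernstein_eq_0: "n < k \<Longrightarrow> Bernstein n k x = 0"
  by (simp add: Bernstein_def)

lemma DERIV_Bernstein_0:
  "(Bernstein (Suc n) 0 has_real_derivative - (real (Suc n) * Bernstein n 0 x)) (at x within S)"
proof -
  have "Bernstein (Suc n) 0 = (\<lambda>x. (1 - x) ^ Suc n)"
    by (simp add: Bernstein_def fun_eq_iff)
  moreover have "((\<lambda>x. (1 - x) ^ Suc n) has_real_derivative - (real (Suc n) * Bernstein n 0 x)) (at x within S)"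
    unfolding Bernstein_def
    by (rule derivative_eq_intros refl | simp add: algebra_simps del: power_Suc)+
  ultimately show ?thesis by simp
qed

lemma DERIV_Bernstein_Suc:
  "(Bernstein (Suc n) (Suc j) has_real_derivative
     real (Suc n) * (Bernstein n j x - Bernstein n (Suc j) x)) (at x within S)"
proof (cases "j \<le> n")
  case False
  then have "Bernstein (Suc n) (Suc j) = (\<lambda>_. 0)" "Bernstein n j = (\<lambda>_. 0)" "Bernstein n (Suc j) = (\<lambda>_. 0)"
    by (simp_all add: Bernstein_def fun_eq_iff binomial_eq_0)
  then show ?thesis by simp
next
  case True
  have 1: "real (Suc n choose Suc j) * real (Suc j) = real (Suc n) * real (n choose j)"
    by (metis Suc_times_binomial_eq of_nat_mult)
  have 2: "real (Suc n choose Suc j) * real (n - j) = real (Suc n) * real (n choose Suc j)"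
  proof -
    have "(Suc n - Suc j) * (Suc n choose Suc j) = Suc n * (n choose Suc j)"
      using binomial_absorb_comp[of "Suc n" "Suc j"] by simp
    then show ?thesis by (metis diff_Suc_Suc mult.commute of_nat_mult)
  qed
  have "(Bernstein (Suc n) (Suc j) has_real_derivative
     real (Suc n choose Suc j) * real (Suc j) * (x ^ j * (1 - x) ^ (n - j))
     - real (Suc n choose Suc j) * real (n - j) * (x ^ Suc j * (1 - x) ^ (n - Suc j))) (at x within S)"
    unfolding Bernstein_def
    by (rule derivative_eq_intros refl | simp add: algebra_simps)+
  then show ?thesis
    unfolding 1 2 by (simp add: Bernstein_def algebra_simps)
qed

text \<open>The derivative of p_{n+1,k} is (n+1)(p_{n,k-1} - p_{n,k}); summation by parts moves the
  difference from the basis to the coefficients.\<close>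

lemma DERIV_bern_sum:
  "(bern_sum (Suc n) c has_real_derivative real (Suc n) * bern_sum n (fdiff c) x) (at x within S)"
proof -
  \<comment> \<open>On natural numbers 0 - 1 = 0, so the absent basis polynomial of index -1 has to
    be set to zero explicitly.\<close>
  define D where "D k = real (Suc n) * ((if k = 0 then 0 else Bernstein n (k - 1) x) - Bernstein n k x)" for k
  have D: "(Bernstein (Suc n) k has_real_derivative D k) (at x within S)" for k
    using DERIV_Bernstein_0[of n x S] DERIV_Bernstein_Suc[of n "k-1" x S] unfolding D_def
    by (cases k) (auto)
  have "(bern_sum (Suc n) c has_real_derivative (\<Sum>k\<le>Suc n. c k * D k)) (at x within S)"
    unfolding bern_sum_def by (intro DERIV_sum DERIV_cmult D)
  also have "(\<Sum>k\<le>Suc n. c k * D k) = real (Suc n) * ((\<Sum>k\<le>Suc n. c k * (if k = 0 then 0 else Bernstein n (k - 1) x)) -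
      (\<Sum>k\<le>Suc n. c k * Bernstein n k x))"
    unfolding D_def by (simp add: sum_subtractf[symmetric] sum_distrib_left algebra_simps del: sum.atMost_Suc)
  also have "(\<Sum>k\<le>Suc n. c k * (if k = 0 then 0 else Bernstein n (k - 1) x)) = (\<Sum>k\<le>n. c (Suc k) * Bernstein n k x)"
    by (subst sum.atMost_Suc_shift) simp
  also have "(\<Sum>k\<le>Suc n. c k * Bernstein n k x) = (\<Sum>k\<le>n. c k * Bernstein n k x)"
    by (simp add: Bernstein_eq_0)
  also have "(\<Sum>k\<le>n. c (Suc k) * Bernstein n k x) - (\<Sum>k\<le>n. c k * Bernstein n k x) = bern_sum n (fdiff c) x"
    unfolding bern_sum_def fdiff_def by (simp add: sum_subtractf algebra_simps)
  finally show ?thesis .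
qed

lemma MVT_within:
  fixes f :: "real \<Rightarrow> real"
  assumes "a < b" and "\<And>t. t \<in> {a..b} \<Longrightarrow> (f has_real_derivative f' t) (at t within {a..b})"
  shows "\<exists>z\<in>{a<..<b}. f b - f a = (b - a) * f' z"
  using mvt_simple[OF assms(1), of f "\<lambda>t. (*) (f' t)"] assms(2)
  by (auto simp: has_field_derivative_def mult.commute)

lemma bern_deriv_0 [simp]: "bern_deriv n c 0 = bern_sum n c"
  by (auto simp: bern_deriv_def)

lemma DERIV_bern_deriv:
  assumes "s < n"
  shows "(bern_deriv n c s has_real_derivative bern_deriv n c (Suc s) x) (at x within S)"
proof -
  obtain m where m: "n - s = Suc m" "n - Suc s = m"
    using assms by (metis Suc_diff_Suc)
  have "(bern_deriv n c s has_real_derivative fact n / fact (n - s) * (real (Suc m) * bern_sum m (fdiff ((fdiff ^^ s) c)) x)) (at x within S)"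
    unfolding bern_deriv_def m by (intro DERIV_cmult DERIV_bern_sum)
  also have "fact n / fact (n - s) * (real (Suc m) * bern_sum m (fdiff ((fdiff ^^ s) c)) x) = bern_deriv n c (Suc s) x"
    unfolding bern_deriv_def m by (simp add: divide_simps del: of_nat_Suc)
  finally show ?thesis .
qed

lemma fdiff_funpow_shift: "(fdiff ^^ s) (\<lambda>k. c (k + j)) k = (fdiff ^^ s) c (k + j)"
  by (induction s arbitrary: k) (auto simp: fdiff_def)

text \<open>Induction with G generalized: the differences H of G with step h are again successive
  derivatives, and the s-th difference of \<open>H 0\<close> is the next difference of
  \<open>G 0\<close>. The induction hypothesis produces H_s(\<xi>) = G_s(\<xi> + h) - G_s(\<xi>),
  and one ordinary mean value step finishes.\<close>

lemma fdiff_mean_value: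
  fixes G :: "nat \<Rightarrow> real \<Rightarrow> real" and h x :: real
  assumes "h > 0"
    and "\<And>j t. j < s \<Longrightarrow> t \<in> {x..x + s * h} \<Longrightarrow> (G j has_real_derivative G (Suc j) t) (at t within {x..x + s * h})"
  shows "\<exists>\<xi>\<in>{x..x + s * h}. (fdiff ^^ s) (\<lambda>k. G 0 (x + k * h)) 0 = h ^ s * G s \<xi>"
  using assms(2)
proof (induction s arbitrary: G)
  case 0
  then show ?case by auto
next
  case (Suc s)
  define H where "H j t = G j (t + h) - G j t" for j t
  have "\<exists>\<xi>\<in>{x..x + s * h}. (fdiff ^^ s) (\<lambda>k. H 0 (x + k * h)) 0 = h ^ s * H s \<xi>"
  proof (rule Suc.IH)
    fix j t assume j: "j < s" and t: "t \<in> {x..x + s * h}"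
    have t1: "t \<in> {x..x + Suc s * h}" and t2: "t + h \<in> {x..x + Suc s * h}"
      using t \<open>h > 0\<close> by (auto simp: algebra_simps)
    have "((\<lambda>t. G j (t + h)) has_real_derivative G (Suc j) (t + h) * 1) (at t within {x..x + s * h})"
    proof (rule DERIV_image_chain[where g = "\<lambda>t. t + h", unfolded o_def])
      show "((\<lambda>t. t + h) has_real_derivative 1) (at t within {x..x + s * h})"
        by (auto intro!: derivative_eq_intros)
      show "(G j has_real_derivative G (Suc j) (t + h)) (at (t + h) within (\<lambda>t. t + h) ` {x..x + s * h})"
        by (rule DERIV_subset[OF Suc.prems[OF _ t2]]) (use j \<open>h>0\<close> in \<open>auto simp: algebra_simps\<close>)
    qed
    moreover have "(G j has_real_derivative G (Suc j) t) (at t within {x..x + s * h})"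
      by (rule DERIV_subset[OF Suc.prems[OF _ t1]]) (use j \<open>h>0\<close> in \<open>auto simp: algebra_simps\<close>)
    ultimately show "(H j has_real_derivative H (Suc j) t) (at t within {x..x + s * h})"
      unfolding H_def by (auto intro!: derivative_eq_intros)
  qed
  then obtain \<xi> where \<xi>: "\<xi> \<in> {x..x + s * h}" "(fdiff ^^ s) (\<lambda>k. H 0 (x + k * h)) 0 = h ^ s * H s \<xi>"
    by blast
  have "\<exists>z\<in>{\<xi><..<\<xi> + h}. G s (\<xi> + h) - G s \<xi> = (\<xi> + h - \<xi>) * G (Suc s) z"
  proof (rule MVT_within)
    fix t assume t: "t \<in> {\<xi>..\<xi> + h}"
    show "(G s has_real_derivative G (Suc s) t) (at t within {\<xi>..\<xi>+h})"
      by (rule DERIV_subset[OF Suc.prems]) (use t \<xi> \<open>h > 0\<close> in \<open>auto simp: algebra_simps\<close>)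
  qed (use \<open>h > 0\<close> in simp)
  then obtain z where z: "z > \<xi>" "z < \<xi> + h" "H s \<xi> = h * G (Suc s) z"
    unfolding H_def by auto
  have "(fdiff ^^ Suc s) (\<lambda>k. G 0 (x + k * h)) 0 = (fdiff ^^ s) (\<lambda>k. H 0 (x + k * h)) 0"
    unfolding funpow_Suc_right o_def fdiff_def H_def by (simp add: algebra_simps fdiff_def[abs_def])
  then show ?case using \<xi> z \<open>h > 0\<close>
    by (intro bexI[of _ z]) (auto simp: algebra_simps)
qed

section \<open>Weighted moments of the Bernstein basis\<close>

definition bern_weight :: "nat \<Rightarrow> real \<Rightarrow> real" where
  "bern_weight n x = 1 / (x + 1 / real n) + 1 / (1 - x + 1 / real n)"

text \<open>This is the variance of k/N for the binomial distribution with parameters N and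
  x.\<close>

lemma Bernstein_second_moment:
  assumes "N \<ge> 1"
  shows "(\<Sum>k\<le>N. Bernstein N k x * (real k / real N - x)\<^sup>2) = x * (1 - x) / real N"
proof -
  have "(\<Sum>k\<le>N. Bernstein N k x * (real k / real N - x)\<^sup>2)
      = (\<Sum>k\<le>N. (real k * (real k - 1) * Bernstein N k x) / (real N)\<^sup>2
          + (1 / (real N)\<^sup>2 - 2 * x / real N) * (real k * Bernstein N k x) + x\<^sup>2 * Bernstein N k x)"
    using assms by (intro sum.cong) (auto simp: field_simps power2_eq_square)
  also have "\<dots> = (\<Sum>k\<le>N. real k * (real k - 1) * Bernstein N k x) / (real N)\<^sup>2
          + (1 / (real N)\<^sup>2 - 2 * x / real N) * (\<Sum>k\<le>N. real k * Bernstein N k x) + x\<^sup>2 * (\<Sum>k\<le>N. Bernstein N k x)"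
    by (simp only: sum.distrib sum_distrib_left sum_divide_distrib)
  also have "\<dots> = x * (1 - x) / real N"
    unfolding sum_k_Bernstein sum_kk_Bernstein sum_Bernstein using assms by (simp add: field_simps power2_eq_square)
  finally show ?thesis .
qed

lemma power_max_le:
  fixes a b :: real assumes "a \<ge> 0" "b \<ge> 0" shows "max a b ^ k \<le> a ^ k + b ^ k"
  using assms by (auto simp: max_def)

lemma power2_diff_le: "((a::real) - c)\<^sup>2 \<le> 2 * (a - b)\<^sup>2 + 2 * (b - c)\<^sup>2"
  using zero_le_power2[of "(a - b) - (b - c)"] by (simp add: power2_eq_square algebra_simps)

text \<open>Each new factor satisfies k + i + 1 \<le> (i+1)(k+1). Hence 1/(k+1)^i is at most i!
  times the reciprocal of (k+1) ... (k+i), the form that \<open>Bernstein_shift\<close>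
  absorbs.\<close>

lemma fact_add_le: "(fact (k + i) :: real) \<le> fact i * real (k + 1) ^ i * fact k"
proof (induction i)
  case (Suc i)
  have "(fact (k + Suc i) :: real) = real (k + i + 1) * fact (k + i)"
    by (simp add: algebra_simps)
  also have "\<dots> \<le> (real (i + 1) * real (k + 1)) * (fact i * real (k + 1) ^ i * fact k)"
    by (intro mult_mono Suc) (auto simp: algebra_simps)
  also have "\<dots> = fact (Suc i) * real (k + 1) ^ Suc i * fact k"
    by (simp add: algebra_simps)
  finally show ?case .
qed auto

lemma fact_add_ge: "(fact N * real N ^ i :: real) \<le> fact (N + i)"
proof (induction i)
  case (Suc i)
  have "fact N * real N ^ Suc i = real N * (fact N * real N ^ i)" by simp
  also have "\<dots> \<le> real (N + i + 1) * fact (N + i)"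
    by (intro mult_mono Suc) auto
  finally show ?case by (simp add: algebra_simps)
qed auto

lemma Bernstein_shift:
  assumes "k \<le> N"
  shows "Bernstein N k x * x ^ i * (fact k / fact (k + i)) = fact N / fact (N + i) * Bernstein (N + i) (k + i) x"
proof -
  have "real (N choose k) * (fact k / fact (k + i)) = fact N / fact (N + i) * real ((N + i) choose (k + i))"
    using assms by (simp add: binomial_fact)
  moreover have "Bernstein N k x * x ^ i * (fact k / fact (k + i)) =
      real (N choose k) * (fact k / fact (k + i)) * (x ^ (k + i) * (1 - x) ^ (N - k))"
    by (simp add: Bernstein_def power_add)
  ultimately show ?thesis
    by (simp add: Bernstein_def)
qed

text \<open>
  Negative powers of the nodes are absorbed by raising the degree: up to a factor,
  $x^i p_{N,k}(x) / ((k+1) \cdots (k+i))$ is $p_{N+i,k+i}(x)$.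
\<close>

lemma Bernstein_moment_left:
  assumes n: "n = N + s" "s \<le> N" "N \<ge> 1" and x: "0 \<le> x" "x \<le> 1"
    and \<xi>: "\<And>k. k \<le> N \<Longrightarrow> real k / real n \<le> \<xi> k \<and> \<xi> k \<le> real (k + s) / real n"
  shows "x ^ i * (\<Sum>k\<le>N. Bernstein N k x * (\<xi> k - x)\<^sup>2 * (real n / real (k + 1)) ^ i)
     \<le> 2 ^ i * fact i * (4 + 2 * real (s + 2 * i) ^ 2) * (x + 1 / real n) / real n"
proof -
  have n0: "real n > 0" "real N > 0" using n by auto
  \<comment> \<open>Bounds n times the distance from \<xi>_k to (k+i)/(N+i): both \<xi>_k and k/N
    lie in an interval of length s/n, and passing from k/N to the node of the raised degree costs at
    most i/N \<le> 2i/n.\<close>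
  define c where "c = real (s + 2 * i)"
  define f where "f j = Bernstein (N + i) j x * (2 * (real j / real (N + i) - x)\<^sup>2 + 2 * (c / n)\<^sup>2)" for j
  have f0: "f j \<ge> 0" for j
    unfolding f_def using x by (intro mult_nonneg_nonneg Bernstein_nonneg) auto
  have K: "(real n / real (k + 1)) ^ i * x ^ i * Bernstein N k x \<le> 2 ^ i * fact i * Bernstein (N + i) (k + i) x"
    if k: "k \<le> N" for k
  proof -
    have "fact (k + i) / (fact k * real (k + 1) ^ i) \<le> (fact i :: real)"
      using fact_add_le[of k i] by (simp add: divide_simps mult_ac)
    then have "(1 / real (k + 1)) ^ i \<le> fact i * (fact k / fact (k + i))"
      by (simp add: divide_simps mult_ac power_divide)
    then have "(real n / real (k + 1)) ^ i \<le> real n ^ i * (fact i * (fact k / fact (k + i)))"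
      using n0 by (simp add: power_divide mult_left_mono divide_simps mult_ac)
    then have "(real n / real (k + 1)) ^ i * (x ^ i * Bernstein N k x)
        \<le> real n ^ i * (fact i * (fact k / fact (k + i))) * (x ^ i * Bernstein N k x)"
      using x by (intro mult_right_mono) (auto intro!: mult_nonneg_nonneg Bernstein_nonneg)
    also have "\<dots> = real n ^ i * fact i * (Bernstein N k x * x ^ i * (fact k / fact (k + i)))"
      by (simp add: mult_ac)
    also have "\<dots> = (real n ^ i * (fact N / fact (N + i))) * (fact i * Bernstein (N + i) (k + i) x)"
      unfolding Bernstein_shift[OF k] by (simp add: mult_ac)
    also have "\<dots> \<le> 2 ^ i * (fact i * Bernstein (N + i) (k + i) x)"
    proof (intro mult_right_mono)
      have "real n ^ i \<le> (2 * real N) ^ i" using n by (intro power_mono) auto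
      also have "\<dots> = 2 ^ i * real N ^ i" by (simp add: power_mult_distrib)
      finally have "real n ^ i * fact N \<le> 2 ^ i * real N ^ i * fact N" by simp
      also have "\<dots> \<le> 2 ^ i * fact (N + i)" using fact_add_ge[of N i] by (simp add: mult_ac)
      finally show "real n ^ i * (fact N / fact (N + i)) \<le> 2 ^ i" by (simp add: divide_simps)
    qed (use x in \<open>auto intro!: Bernstein_nonneg mult_nonneg_nonneg\<close>)
    finally show ?thesis by (simp add: mult_ac)
  qed
  have D: "(\<xi> k - x)\<^sup>2 \<le> 2 * (real (k + i) / real (N + i) - x)\<^sup>2 + 2 * (c / n)\<^sup>2" if k: "k \<le> N" for k
  proof -
    have 1: "real k / n \<le> real k / N" using n n0 by (auto simp: frac_le)
    have 2: "real k / N \<le> real (k + s) / n"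
      using k n n0 by (simp add: divide_simps) (simp add: algebra_simps mult_right_mono)
    have 3: "real k / N \<le> real (k + i) / real (N + i)"
    proof -
      have "real i * real k \<le> real i * real N" using k by (intro mult_left_mono) auto
      then show ?thesis using n0 by (simp add: divide_simps) (simp add: algebra_simps)
    qed
    have 4: "real (k + i) / real (N + i) \<le> real k / N + 2 * i / n"
    proof -
      have "real (k + i) / real (N + i) \<le> real (k + i) / real N" using n0 by (intro divide_left_mono) auto
      also have "\<dots> = real k / N + real i / N" by (simp add: add_divide_distrib)
      also have "real i / N \<le> 2 * i / n"
      proof -
        have "real i * real n \<le> real i * (2 * real N)" using n by (intro mult_left_mono) auto
        then show ?thesis using n0 by (simp add: divide_simps mult_ac)
      qed
      finally show ?thesis by simp
    qed
    have 5: "c / n = s / n + 2 * i / n" "real (k + s) / n = k / n + s / n"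
      unfolding c_def by (simp_all add: add_divide_distrib)
    have s0: "real s / n \<ge> 0" "2 * real i / n \<ge> 0" by auto
    have "\<bar>\<xi> k - real (k + i) / real (N + i)\<bar> \<le> c / n"
      using 1 2 3 4 5 s0 \<xi>[OF k] by linarith
    then have "(\<xi> k - real (k + i) / real (N + i))\<^sup>2 \<le> (c / n)\<^sup>2"
      by (metis abs_le_square_iff abs_of_nonneg order_trans abs_ge_zero)
    moreover have "(\<xi> k - x)\<^sup>2 \<le> 2 * (\<xi> k - real (k + i) / real (N + i))\<^sup>2 + 2 * (real (k + i) / real (N + i) - x)\<^sup>2" by (rule power2_diff_le)
    ultimately show ?thesis by linarith
  qed
  have "x ^ i * (\<Sum>k\<le>N. Bernstein N k x * (\<xi> k - x)\<^sup>2 * (real n / real (k + 1)) ^ i)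
     = (\<Sum>k\<le>N. ((real n / real (k + 1)) ^ i * x ^ i * Bernstein N k x) * (\<xi> k - x)\<^sup>2)"
    by (simp add: sum_distrib_left mult_ac)
  also have "\<dots> \<le> (\<Sum>k\<le>N. (2 ^ i * fact i * Bernstein (N + i) (k + i) x) * (2 * (real (k + i) / real (N + i) - x)\<^sup>2 + 2 * (c / n)\<^sup>2))"
    using x by (intro sum_mono mult_mono K D) (auto intro!: Bernstein_nonneg mult_nonneg_nonneg)
  also have "\<dots> = 2 ^ i * fact i * (\<Sum>k\<le>N. f (k + i))"
    unfolding f_def by (simp add: sum_distrib_left mult_ac)
  also have "(\<Sum>k\<le>N. f (k + i)) = (\<Sum>j\<in>(\<lambda>k. k + i) ` {..N}. f j)"
    by (subst sum.reindex) auto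
  also have "2 ^ i * fact i * \<dots> \<le> 2 ^ i * fact i * (\<Sum>j\<le>N + i. f j)"
    by (intro mult_left_mono sum_mono2) (auto simp: f0)
  also have "(\<Sum>j\<le>N + i. f j) = 2 * (\<Sum>j\<le>N + i. Bernstein (N + i) j x * (real j / real (N + i) - x)\<^sup>2) + 2 * (c / n)\<^sup>2 * (\<Sum>j\<le>N + i. Bernstein (N + i) j x)"
    unfolding f_def by (simp only: sum_distrib_left sum.distrib algebra_simps)
  also have "\<dots> = 2 * (x * (1 - x) / real (N + i)) + 2 * (c / n)\<^sup>2"
    using n by (subst Bernstein_second_moment) auto
  also have "\<dots> \<le> (4 + 2 * c ^ 2) * (x + 1 / real n) / real n"
  proof -
    have "x * (1 - x) / real (N + i) \<le> x / real (N + i)"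
      using x by (intro divide_right_mono) (auto simp: mult_left_le)
    also have "\<dots> \<le> x * (2 / n)"
    proof -
      have "1 / real (N + i) \<le> 2 / n" using n n0 by (simp add: divide_simps)
      then show ?thesis using x mult_left_mono by fastforce
    qed
    finally have "2 * (x * (1 - x) / real (N + i)) \<le> 4 * x / n" by simp
    also have "4 * x / n + 2 * (c / n)\<^sup>2 \<le> (4 + 2 * c ^ 2) * (x + 1 / real n) / real n"
    proof -
      have "(4 + 2 * c ^ 2) * (x + 1 / real n) / real n = 4 * x / n + 2 * (c / n)\<^sup>2 + (4 * (1 / n) + 2 * c^2 * x) / n"
        using n0 by (simp add: field_simps power2_eq_square)
      moreover have "(4 * (1 / n) + 2 * c^2 * x) / n \<ge> 0"
        using x by auto
      ultimately show ?thesis by linarith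
    qed
    finally show ?thesis by simp
  qed
  finally show ?thesis unfolding c_def by (simp add: mult_left_mono mult_ac)
qed

text \<open>For x \<ge> 1/n, x is at least half of x + 1/n and \<open>Bernstein_moment_left\<close>
  may be divided by x^(j+1). For smaller x the crude bound n/(k+1) \<le> n suffices, as n is then at
  most 2/(x + 1/n). The exponent drops from j+1 to j because the second moment contributes (x +
  1/n)/n.\<close>

lemma Bernstein_moment_left':
  assumes n: "n = N + s" "s \<le> N" "N \<ge> 1" and x: "0 \<le> x" "x \<le> 1"
    and \<xi>: "\<And>k. k \<le> N \<Longrightarrow> real k / real n \<le> \<xi> k \<and> \<xi> k \<le> real (k + s) / real n"
  shows "(\<Sum>k\<le>N. Bernstein N k x * (\<xi> k - x)\<^sup>2 * (real n / real (k + 1)) ^ Suc j)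
     \<le> 4 ^ Suc j * fact (Suc j) * (4 + 2 * real (s + 2 * Suc j) ^ 2) / real n * (1 / (x + 1 / real n)) ^ j"
    (is "?S \<le> ?C / real n * _")
proof -
  have n0: "real n > 0" using n by auto
  define e where "e = x + 1 / real n"
  have e0: "e > 0" unfolding e_def using x n0 by (simp add: add_nonneg_pos)
  define c where "c = (4 + 2 * real (s + 2 * Suc j) ^ 2)"
  have c: "4 + 2 * real s ^ 2 \<le> c" "c > 0" unfolding c_def by (auto simp: power_mono add_pos_nonneg)
  show ?thesis
  proof (cases "x \<ge> 1 / real n")
    case True
    have S0: "?S \<ge> 0" using x by (intro sum_nonneg mult_nonneg_nonneg Bernstein_nonneg) auto
    have "(e / 2) ^ Suc j * ?S \<le> x ^ Suc j * ?S"
      using True e0 S0 by (intro mult_right_mono power_mono) (auto simp: e_def)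
    also have "\<dots> \<le> 2 ^ Suc j * fact (Suc j) * c * e / real n"
      unfolding c_def e_def by (rule Bernstein_moment_left[OF n x \<xi>])
    finally have "(e / 2) ^ Suc j * ?S \<le> 2 ^ Suc j * fact (Suc j) * c * e / real n" .
    then have "?S \<le> 2 ^ Suc j * fact (Suc j) * c * e / real n / (e / 2) ^ Suc j"
      using e0 by (subst pos_le_divide_eq) (simp_all add: mult.commute del: power_Suc fact_Suc)
    also have "\<dots> = (2 ^ Suc j * 2 ^ Suc j) * fact (Suc j) * c / real n * (1 / e) ^ j"
      using e0 by (simp add: power_divide)
    also have "(2::real) ^ Suc j * 2 ^ Suc j = 4 ^ Suc j"
      by (simp only: power_mult_distrib[symmetric]) simp
    finally show ?thesis by (simp add: c_def e_def)
  next
    case False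
    have "?S \<le> (\<Sum>k\<le>N. Bernstein N k x * (\<xi> k - x)\<^sup>2 * real n ^ Suc j)"
      using x n0 by (intro sum_mono mult_left_mono power_mono mult_nonneg_nonneg Bernstein_nonneg) (auto simp: divide_simps)
    also have "\<dots> = real n ^ Suc j * (x ^ 0 * (\<Sum>k\<le>N. Bernstein N k x * (\<xi> k - x)\<^sup>2 * (real n / real (k + 1)) ^ 0))"
      by (simp add: sum_distrib_left mult_ac)
    also have "\<dots> \<le> real n ^ Suc j * (2 ^ 0 * fact 0 * (4 + 2 * real (s + 2 * 0) ^ 2) * (x + 1 / real n) / real n)"
      by (intro mult_left_mono Bernstein_moment_left[OF n x \<xi>]) auto
    also have "\<dots> \<le> real n ^ Suc j * (c * (2 / real n) / real n)"
      using c False e0 by (intro mult_left_mono divide_right_mono mult_mono) (auto simp: e_def)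
    also have "\<dots> = 2 * c / real n * real n ^ j"
      using n0 by (simp add: field_simps)
    also have "\<dots> \<le> 2 * c / real n * (2 * (1 / e)) ^ j"
    proof -
      have "real n * e \<le> 2" using False n0 by (auto simp: e_def field_simps)
      then have "real n \<le> 2 * (1 / e)" using e0 by (simp add: divide_simps)
      then show ?thesis using c n0 by (intro mult_left_mono power_mono) auto
    qed
    also have "\<dots> = (2 ^ Suc j) * c / real n * (1 / e) ^ j"
      by (simp add: power_divide)
    also have "\<dots> \<le> (4 ^ Suc j * fact (Suc j)) * c / real n * (1 / e) ^ j"
    proof -
      have "(2::real) ^ Suc j * 1 \<le> 4 ^ Suc j * fact (Suc j)"
        by (intro mult_mono power_mono) (auto simp: fact_ge_1 simp del: fact_Suc)
      then show ?thesis using c e0 by (intro mult_right_mono divide_right_mono) auto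
    qed
    finally show ?thesis by (simp add: c_def e_def)
  qed
qed

lemma bern_weight_ge_1:
  assumes n: "n \<ge> 2" and x: "0 \<le> x" "x \<le> 1"
  shows "bern_weight n x \<ge> 1"
proof -
  define e where "e = 1 / real n"
  have e: "e > 0" "e \<le> 1 / 2" using n by (auto simp: e_def)
  show ?thesis
  proof (cases "x \<le> 1/2")
    case True
    then have "1 / (x + e) \<ge> 1" "1 / (1 - x + e) \<ge> 0" using x e by (simp_all add: le_divide_eq)
    then show ?thesis unfolding bern_weight_def e_def[symmetric] by linarith
  next
    case False
    then have "1 / (1 - x + e) \<ge> 1" "1 / (x + e) \<ge> 0" using x e by (simp_all add: le_divide_eq)
    then show ?thesis unfolding bern_weight_def e_def[symmetric] by linarith
  qed
qed

lemma Bernstein_reflect: "k \<le> N \<Longrightarrow> Bernstein N (N - k) (1 - x) = Bernstein N k x"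
  by (simp add: Bernstein_def binomial_symmetric[symmetric])

text \<open>At \<xi>_k the weight is at most n/(k+1) + n/(N-k+1). Each summand gives a one-sided
  moment, the second one after the reflection of k to N - k and of x to 1 - x. The factor 2^(j+1)
  comes from (u+v)^(j+1) \<le> (2 max(u,v))^(j+1).\<close>

lemma Bernstein_moment_weight_power:
  assumes n: "n = N + s" "s \<le> N" "N \<ge> 1" and x: "0 \<le> x" "x \<le> 1"
    and \<xi>: "\<And>k. k \<le> N \<Longrightarrow> real k / real n \<le> \<xi> k \<and> \<xi> k \<le> real (k + s) / real n"
  shows "(\<Sum>k\<le>N. Bernstein N k x * (\<xi> k - x)\<^sup>2 * bern_weight n (\<xi> k) ^ Suc j)
     \<le> 2 ^ Suc j * 2 * (4 ^ Suc j * fact (Suc j) * (4 + 2 * real (s + 2 * Suc j) ^ 2)) / real n * bern_weight n x ^ j"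
proof -
  have n0: "real n > 0" using n by auto
  define C where "C = (4 ^ Suc j * fact (Suc j) * (4 + 2 * real (s + 2 * Suc j) ^ 2) :: real)"
  have C0: "C \<ge> 0" unfolding C_def by auto
  define A where "A k = real n / real (k + 1)" for k
  have A0: "A k > 0" for k unfolding A_def using n0 by auto
  have W: "bern_weight n (\<xi> k) ^ Suc j \<le> 2 ^ Suc j * (A k ^ Suc j + A (N - k) ^ Suc j)" "bern_weight n (\<xi> k) \<ge> 0" if k: "k \<le> N" for k
  proof -
    have 1: "\<xi> k + 1 / real n \<ge> real (k + 1) / real n"
      using \<xi>[OF k] by (simp add: add_divide_distrib)
    have "1 - \<xi> k + 1 / real n \<ge> 1 - real (k + s) / n + 1 / n" using \<xi>[OF k] by linarith
    also have "1 - real (k + s) / n + 1 / n = real (N - k + 1) / n"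
      using n k n0 by (simp add: field_simps)
    finally have 2: "1 - \<xi> k + 1 / real n \<ge> real (N - k + 1) / n" .
    have p: "real (k + 1) / real n > 0" "real (N - k + 1) / real n > 0" using n0 by auto
    have "1 / (\<xi> k + 1 / real n) \<le> 1 / (real (k + 1) / real n)"
      by (intro divide_left_mono mult_pos_pos less_le_trans[OF p(1) 1] 1 p) auto
    moreover have "1 / (1 - \<xi> k + 1 / real n) \<le> 1 / (real (N - k + 1) / real n)"
      by (intro divide_left_mono mult_pos_pos less_le_trans[OF p(2) 2] 2 p) auto
    ultimately have "bern_weight n (\<xi> k) \<le> A k + A (N - k)"
      unfolding bern_weight_def A_def by simp
    also have "\<dots> \<le> 2 * max (A k) (A (N - k))" by simp
    finally have le: "bern_weight n (\<xi> k) \<le> 2 * max (A k) (A (N - k))" .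
    have "real (k + 1) / real n > 0" "real (N - k + 1) / n > 0" using n0 by auto
    then show ge: "bern_weight n (\<xi> k) \<ge> 0" unfolding bern_weight_def using 1 2 by (intro add_nonneg_nonneg) auto
    have "bern_weight n (\<xi> k) ^ Suc j \<le> (2 * max (A k) (A (N - k))) ^ Suc j"
      using le ge by (intro power_mono)
    also have "\<dots> = 2 ^ Suc j * max (A k) (A (N - k)) ^ Suc j" by (simp add: power_mult_distrib)
    also have "\<dots> \<le> 2 ^ Suc j * (A k ^ Suc j + A (N - k) ^ Suc j)"
      using A0[of k] A0[of "N - k"] by (intro mult_left_mono) (auto simp: max_def)
    finally show "bern_weight n (\<xi> k) ^ Suc j \<le> 2 ^ Suc j * (A k ^ Suc j + A (N - k) ^ Suc j)" .
  qed
  have u: "x + 1 / real n > 0" "1 - x + 1 / real n > 0" using x n0 by (auto simp: add_nonneg_pos)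
  have L: "(\<Sum>k\<le>N. Bernstein N k x * (\<xi> k - x)\<^sup>2 * A k ^ Suc j) \<le> C / real n * bern_weight n x ^ j"
  proof -
    have "(\<Sum>k\<le>N. Bernstein N k x * (\<xi> k - x)\<^sup>2 * A k ^ Suc j) \<le> C / real n * (1 / (x + 1 / real n)) ^ j"
      unfolding A_def C_def by (rule Bernstein_moment_left'[OF n x \<xi>])
    also have "\<dots> \<le> C / real n * bern_weight n x ^ j"
      using u C0 by (intro mult_left_mono power_mono) (auto simp: bern_weight_def)
    finally show ?thesis .
  qed
  have R: "(\<Sum>k\<le>N. Bernstein N k x * (\<xi> k - x)\<^sup>2 * A (N - k) ^ Suc j) \<le> C / real n * bern_weight n x ^ j"
  proof -
    have "(\<Sum>k\<le>N. Bernstein N k x * (\<xi> k - x)\<^sup>2 * A (N - k) ^ Suc j)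
       = (\<Sum>k\<le>N. Bernstein N k (1 - x) * ((1 - \<xi> (N - k)) - (1 - x))\<^sup>2 * A k ^ Suc j)"
    proof (rule sum.reindex_bij_witness[of _ "\<lambda>k. N - k" "\<lambda>k. N - k"], goal_cases)
      case (5 k)
      have "((1 - \<xi> k) - (1 - x))\<^sup>2 = (\<xi> k - x)\<^sup>2" by (simp add: power2_commute)
      then show ?case using 5 Bernstein_reflect[of k N x] by simp
    qed auto
    also have "\<dots> \<le> C / real n * (1 / (1 - x + 1 / real n)) ^ j"
      unfolding A_def C_def
    proof (rule Bernstein_moment_left'[OF n])
      fix k assume k: "k \<le> N"
      have "real (N - k) / real n \<le> \<xi> (N - k)" "\<xi> (N - k) \<le> real (N - k + s) / real n" using \<xi>[of "N - k"] by auto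
      moreover have "1 - real (N - k) / real n = real (k + s) / real n" "1 - real (N - k + s) / real n = real k / real n"
        using k n n0 by (auto simp: field_simps)
      ultimately show "real k / real n \<le> 1 - \<xi> (N - k) \<and> 1 - \<xi> (N - k) \<le> real (k + s) / real n" by linarith
    qed (use x in auto)
    also have "\<dots> \<le> C / real n * bern_weight n x ^ j"
      using u C0 by (intro mult_left_mono power_mono) (auto simp: bern_weight_def)
    finally show ?thesis .
  qed
  have "(\<Sum>k\<le>N. Bernstein N k x * (\<xi> k - x)\<^sup>2 * bern_weight n (\<xi> k) ^ Suc j)
     \<le> (\<Sum>k\<le>N. Bernstein N k x * (\<xi> k - x)\<^sup>2 * (2 ^ Suc j * (A k ^ Suc j + A (N - k) ^ Suc j)))"
    using x by (intro sum_mono mult_left_mono W mult_nonneg_nonneg Bernstein_nonneg) auto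
  also have "\<dots> = 2 ^ Suc j * ((\<Sum>k\<le>N. Bernstein N k x * (\<xi> k - x)\<^sup>2 * A k ^ Suc j) + (\<Sum>k\<le>N. Bernstein N k x * (\<xi> k - x)\<^sup>2 * A (N - k) ^ Suc j))"
    by (simp only: sum.distrib[symmetric] sum_distrib_left algebra_simps)
  also have "\<dots> \<le> 2 ^ Suc j * (C / real n * bern_weight n x ^ j + C / real n * bern_weight n x ^ j)"
    by (intro mult_left_mono add_mono L R) auto
  finally show ?thesis unfolding C_def[symmetric] by simp
qed

text \<open>The natural scale of the problem is 1/\<phi>, not 1/\<phi>^2: with the root, the powers
  w^(r/2) for odd r are ordinary powers as well.\<close>

definition bern_root_weight :: "nat \<Rightarrow> real \<Rightarrow> real" where
  "bern_root_weight n x = sqrt (bern_weight n x)"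

lemma bern_root_weight_ge_1: "n \<ge> 2 \<Longrightarrow> 0 \<le> x \<Longrightarrow> x \<le> 1 \<Longrightarrow> bern_root_weight n x \<ge> 1"
  using bern_weight_ge_1 by (simp add: bern_root_weight_def)

lemma bern_root_weight_even_power:
  "n \<ge> 2 \<Longrightarrow> 0 \<le> x \<Longrightarrow> x \<le> 1 \<Longrightarrow> bern_root_weight n x ^ (2 * j) = bern_weight n x ^ j"
  using bern_weight_ge_1[of n x] by (simp add: bern_root_weight_def power_mult)

text \<open>The remainder of a first-order Taylor expansion is quadratic in \<xi>_k - x and carries
  the larger of the weights at x and \<xi>_k. Averaged over the basis it gains 1/n and loses two
  powers of the root weight. The maximum is split into a part with the weight at \<xi>_k, reduced to
  \<open>Bernstein_moment_weight_power\<close>, and a part with the weight at x, where the plain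
  second moment is enough.\<close>

lemma Bernstein_moment_root_weight:
  "\<exists>C\<ge>0. \<forall>n N x \<xi>. n = N + s \<longrightarrow> s \<le> N \<longrightarrow> N \<ge> 1 \<longrightarrow> n \<ge> 2 \<longrightarrow> 0 \<le> x \<longrightarrow> x \<le> 1 \<longrightarrow>
     (\<forall>k\<le>N. real k / real n \<le> \<xi> k \<and> \<xi> k \<le> real (k + s) / real n) \<longrightarrow>
     (\<Sum>k\<le>N. Bernstein N k x * (\<xi> k - x)\<^sup>2 * max (bern_root_weight n x) (bern_root_weight n (\<xi> k)) ^ (q + 2))
       \<le> C / real n * bern_root_weight n x ^ q"
proof -
  define A :: "nat \<Rightarrow> real" where "A j = 2 ^ Suc j * 2 * (4 ^ Suc j * fact (Suc j) * (4 + 2 * real (s + 2 * Suc j) ^ 2))" for j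
  have A0: "A j \<ge> 0" for j unfolding A_def by auto
  define j where "j = q div 2"
  show ?thesis
  proof (intro exI[of _ "A 0 + (A j + A (Suc j))"] conjI allI impI)
    show "0 \<le> A 0 + (A j + A (Suc j))" using A0 by (intro add_nonneg_nonneg) auto
    fix n N :: nat and x :: real and \<xi> :: "nat \<Rightarrow> real"
    assume n: "n = N + s" "s \<le> N" "N \<ge> 1" "n \<ge> 2" and x: "0 \<le> x" "x \<le> 1"
      and \<xi>: "\<forall>k\<le>N. real k / real n \<le> \<xi> k \<and> \<xi> k \<le> real (k + s) / real n"
    define S where "S = bern_root_weight n"
    have n0: "real n > 0" using n by auto
    have \<xi>01: "0 \<le> \<xi> k \<and> \<xi> k \<le> 1" if "k \<le> N" for k
    proof -
      have "real (k + s) / n \<le> 1" using n n0 that by (simp add: divide_simps)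
      moreover have "real k / n \<ge> 0" by simp
      ultimately show ?thesis using \<xi> that by (meson order_trans)
    qed
    have S1: "S x \<ge> 1" "S (\<xi> k) \<ge> 1" if "k \<le> N" for k
      unfolding S_def using bern_root_weight_ge_1 n x \<xi>01[OF that] by auto
    have Sx1: "S x \<ge> 1" using S1[of 0] by auto
    have M: "(\<Sum>k\<le>N. Bernstein N k x * (\<xi> k - x)\<^sup>2 * S (\<xi> k) ^ (2 * Suc j)) \<le> A j / real n * S x ^ (2 * j)" for j
    proof -
      have "(\<Sum>k\<le>N. Bernstein N k x * (\<xi> k - x)\<^sup>2 * S (\<xi> k) ^ (2 * Suc j)) =
        (\<Sum>k\<le>N. Bernstein N k x * (\<xi> k - x)\<^sup>2 * bern_weight n (\<xi> k) ^ Suc j)"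
        by (intro sum.cong refl) (simp only: S_def bern_root_weight_even_power[OF n(4)] \<xi>01 atMost_iff)
      also have "\<dots> \<le> A j / real n * bern_weight n x ^ j"
        unfolding A_def by (rule Bernstein_moment_weight_power[OF n(1-3) x]) (use \<xi> in blast)
      finally show ?thesis unfolding S_def bern_root_weight_even_power[OF n(4) x] .
    qed
    have B: "(\<Sum>k\<le>N. Bernstein N k x * (\<xi> k - x)\<^sup>2 * S (\<xi> k) ^ (q + 2)) \<le> (A j + A (Suc j)) / real n * S x ^ q"
    proof (cases "even q")
      case True
      then have q: "q = 2 * j" unfolding j_def by simp
      have "(\<Sum>k\<le>N. Bernstein N k x * (\<xi> k - x)\<^sup>2 * S (\<xi> k) ^ (q + 2)) \<le> A j / real n * S x ^ q"
        using M[of j] unfolding q by simp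
      also have "\<dots> \<le> (A j + A (Suc j)) / real n * S x ^ q"
        using A0 Sx1 by (intro mult_right_mono divide_right_mono) auto
      finally show ?thesis .
    next
      case False
      then have q: "q = 2 * j + 1" unfolding j_def by simp
      \<comment> \<open>For odd exponents the arithmetic-geometric mean inequality puts S(\<xi>)
        below a combination of even powers, scaled by S(x) so that both terms give S(x)^q after
        summation.\<close>
      have t: "S (\<xi> k) ^ (q + 2) \<le> (1/2) * S x * S (\<xi> k) ^ (2 * Suc j) + (1/2) / S x * S (\<xi> k) ^ (2 * Suc (Suc j))"
        if k: "k \<le> N" for k
      proof -
        have "S (\<xi> k) \<le> (1/2) * S x + (1/2) / S x * S (\<xi> k) ^ 2"
          using S1[OF k] zero_le_power2[of "S (\<xi> k) - S x"]
          by (simp add: field_simps power2_eq_square)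
        then have "S (\<xi> k) ^ (2 * Suc j) * S (\<xi> k) \<le> S (\<xi> k) ^ (2 * Suc j) * ((1/2) * S x + (1/2) / S x * S (\<xi> k) ^ 2)"
          using S1[OF k] by (intro mult_left_mono) auto
        then show ?thesis unfolding q by (simp add: algebra_simps power2_eq_square)
      qed
      have "(\<Sum>k\<le>N. Bernstein N k x * (\<xi> k - x)\<^sup>2 * S (\<xi> k) ^ (q + 2)) \<le>
        (\<Sum>k\<le>N. Bernstein N k x * (\<xi> k - x)\<^sup>2 * ((1/2) * S x * S (\<xi> k) ^ (2 * Suc j) + (1/2) / S x * S (\<xi> k) ^ (2 * Suc (Suc j))))"
        using x by (intro sum_mono mult_left_mono t mult_nonneg_nonneg Bernstein_nonneg) auto
      also have "\<dots> = (1/2) * S x * (\<Sum>k\<le>N. Bernstein N k x * (\<xi> k - x)\<^sup>2 * S (\<xi> k) ^ (2 * Suc j)) +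
           (1/2) / S x * (\<Sum>k\<le>N. Bernstein N k x * (\<xi> k - x)\<^sup>2 * S (\<xi> k) ^ (2 * Suc (Suc j)))"
        unfolding sum_distrib_left sum.distrib[symmetric] by (intro sum.cong refl) (simp only: algebra_simps)
      also have "\<dots> \<le> (1/2) * S x * (A j / real n * S x ^ (2 * j)) + (1/2) / S x * (A (Suc j) / real n * S x ^ (2 * Suc j))"
        using Sx1 by (intro add_mono mult_left_mono M) auto
      also have "\<dots> = (1/2) * ((A j + A (Suc j)) / real n * S x ^ q)"
        unfolding q using Sx1 n0 by (simp add: field_simps)
      also have "\<dots> \<le> (A j + A (Suc j)) / real n * S x ^ q"
      proof -
        have "0 \<le> (A j + A (Suc j)) / real n * S x ^ q"
          using A0 Sx1 by (intro mult_nonneg_nonneg divide_nonneg_nonneg add_nonneg_nonneg) auto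
        then show ?thesis by linarith
      qed
      finally show ?thesis .
    qed
    have A: "(\<Sum>k\<le>N. Bernstein N k x * (\<xi> k - x)\<^sup>2 * S x ^ (q + 2)) \<le> A 0 / real n * S x ^ q"
    proof -
      have D: "(\<xi> k - x)\<^sup>2 \<le> 2 * (real k / real N - x)\<^sup>2 + 2 * (real s / n)\<^sup>2" if k: "k \<le> N" for k
      proof -
        have 1: "real k / n \<le> real k / N" using n n0 by (auto simp: frac_le)
        have 2: "real k / N \<le> real (k + s) / n"
          using k n n0 by (simp add: divide_simps) (simp add: algebra_simps mult_right_mono)
        have "\<bar>\<xi> k - real k / real N\<bar> \<le> real s / n"
          using 1 2 \<xi> k add_divide_distrib[of "real k" "real s" "real n"] unfolding of_nat_add by fastforce
        then have "(\<xi> k - real k / real N)\<^sup>2 \<le> (real s / n)\<^sup>2"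
          by (metis abs_le_square_iff abs_of_nonneg order_trans abs_ge_zero)
        moreover have "(\<xi> k - x)\<^sup>2 \<le> 2 * (\<xi> k - real k / real N)\<^sup>2 + 2 * (real k / real N - x)\<^sup>2" by (rule power2_diff_le)
        ultimately show ?thesis by linarith
      qed
      have "(\<Sum>k\<le>N. Bernstein N k x * (\<xi> k - x)\<^sup>2) \<le> (\<Sum>k\<le>N. Bernstein N k x * (2 * (real k / real N - x)\<^sup>2 + 2 * (real s / n)\<^sup>2))"
        using x by (intro sum_mono mult_left_mono D Bernstein_nonneg) auto
      also have "\<dots> = 2 * (\<Sum>k\<le>N. Bernstein N k x * (real k / real N - x)\<^sup>2) + 2 * (real s / n)\<^sup>2 * (\<Sum>k\<le>N. Bernstein N k x)"
        unfolding sum_distrib_left sum.distrib[symmetric] by (intro sum.cong refl) (simp only: algebra_simps)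
      also have "\<dots> = 2 * (x * (1 - x) / real N) + 2 * (real s / n)\<^sup>2"
        using n by (subst Bernstein_second_moment) auto
      also have "\<dots> \<le> 4 * (x * (1 - x)) / n + 2 * (real s)\<^sup>2 / n * (1 / n)"
      proof -
        have "1 / real N \<le> 2 / n" using n n0 by (simp add: divide_simps)
        then have "x * (1 - x) * (1 / real N) \<le> x * (1 - x) * (2 / n)"
          using x by (intro mult_left_mono) auto
        then show ?thesis by (simp add: power2_eq_square)
      qed
      finally have V: "(\<Sum>k\<le>N. Bernstein N k x * (\<xi> k - x)\<^sup>2) \<le> 4 * (x * (1 - x)) / n + 2 * (real s)\<^sup>2 / n * (1 / n)" .
      define e where "e = 1 / real n"
      have e0: "e > 0" unfolding e_def using n0 by simp
      have u: "x + e > 0" "1 - x + e > 0" using x e0 by (auto simp: add_nonneg_pos)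
      \<comment> \<open>The two parts of the second moment, of sizes x(1-x)/n and 1/n^2, each absorb
        one factor w and leave O(1/n).\<close>
      have W1: "x * (1 - x) * bern_weight n x \<le> 2"
      proof -
        have "x * (1 - x) * (1 / (x + e)) \<le> 1"
          using x e0 u mult_left_le[of "1 - x" x] by (simp add: divide_simps)
        moreover have "x * (1 - x) * (1 / (1 - x + e)) \<le> 1"
          using x e0 u mult_left_le[of x "1 - x"] by (simp add: divide_simps mult.commute)
        ultimately show ?thesis unfolding bern_weight_def e_def[symmetric] by (simp add: algebra_simps)
      qed
      have W2: "e * bern_weight n x \<le> 2"
      proof -
        have "e * (1 / (x + e)) \<le> 1" "e * (1 / (1 - x + e)) \<le> 1"
          using x e0 u by (simp_all add: divide_simps)
        then show ?thesis unfolding bern_weight_def e_def[symmetric] by (simp add: algebra_simps)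
      qed
      have W0: "bern_weight n x \<ge> 0" using bern_weight_ge_1[OF n(4) x] by simp
      have "(\<Sum>k\<le>N. Bernstein N k x * (\<xi> k - x)\<^sup>2) * bern_weight n x
          \<le> (4 * (x * (1 - x)) / n + 2 * (real s)\<^sup>2 / n * (1 / n)) * bern_weight n x"
        by (intro mult_right_mono V W0)
      also have "\<dots> = 4 / n * (x * (1 - x) * bern_weight n x) + 2 * (real s)\<^sup>2 / n * (e * bern_weight n x)"
        unfolding e_def by (simp add: distrib_right)
      also have "\<dots> \<le> 4 / n * 2 + 2 * (real s)\<^sup>2 / n * 2"
        using n0 by (intro add_mono mult_left_mono W1 W2) auto
      also have "\<dots> = (8 + 4 * (real s)\<^sup>2) / n" by (simp add: add_divide_distrib)
      also have "\<dots> \<le> A 0 / n"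
        unfolding A_def by (intro divide_right_mono) (auto simp: power2_eq_square algebra_simps)
      finally have *: "(\<Sum>k\<le>N. Bernstein N k x * (\<xi> k - x)\<^sup>2) * bern_weight n x \<le> A 0 / n" .
      have "(\<Sum>k\<le>N. Bernstein N k x * (\<xi> k - x)\<^sup>2 * S x ^ (q + 2)) =
          (\<Sum>k\<le>N. Bernstein N k x * (\<xi> k - x)\<^sup>2) * bern_weight n x * S x ^ q"
        unfolding sum_distrib_right S_def using bern_root_weight_even_power[OF n(4) x, of 1, unfolded mult_1_right]
        by (intro sum.cong refl) (simp add: power_add power2_eq_square)
      also have "\<dots> \<le> A 0 / n * S x ^ q"
        using Sx1 by (intro mult_right_mono *) auto
      finally show ?thesis .
    qed
    have "(\<Sum>k\<le>N. Bernstein N k x * (\<xi> k - x)\<^sup>2 * max (S x) (S (\<xi> k)) ^ (q + 2)) \<le>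
      (\<Sum>k\<le>N. Bernstein N k x * (\<xi> k - x)\<^sup>2 * S x ^ (q + 2) + Bernstein N k x * (\<xi> k - x)\<^sup>2 * S (\<xi> k) ^ (q + 2))"
      unfolding distrib_left[symmetric]
      using x Sx1 S1 by (intro sum_mono mult_left_mono mult_nonneg_nonneg Bernstein_nonneg power_max_le)
        (auto intro: order_trans[OF zero_le_one])
    also have "\<dots> \<le> A 0 / real n * S x ^ q + (A j + A (Suc j)) / real n * S x ^ q"
      unfolding sum.distrib by (intro add_mono A B)
    finally show "(\<Sum>k\<le>N. Bernstein N k x * (\<xi> k - x)\<^sup>2 * max (bern_root_weight n x) (bern_root_weight n (\<xi> k)) ^ (q + 2))
       \<le> (A 0 + (A j + A (Suc j))) / real n * bern_root_weight n x ^ q"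
      unfolding S_def by (simp add: add_divide_distrib algebra_simps)
  qed
qed

section \<open>Error of the derivatives of Bernstein sums\<close>

text \<open>F need not be differentiable. The bound with an additional \<theta> (v - u) is additive
  over adjacent intervals and, by continuity of \<psi>, holds on all short intervals around a given
  point, so Bolzano's bisection argument extends it to the whole interval.\<close>

lemma increment_le_antiderivative:
  fixes F \<Phi> \<psi> :: "real \<Rightarrow> real"
  assumes "a \<le> b" and \<psi>: "continuous_on {a..b} \<psi>"
    and \<Phi>: "\<And>x. x \<in> {a..b} \<Longrightarrow> (\<Phi> has_real_derivative \<psi> x) (at x within {a..b})"
    and F: "\<And>x y. a \<le> x \<Longrightarrow> x \<le> y \<Longrightarrow> y \<le> b \<Longrightarrow> \<bar>F y - F x\<bar> \<le> (y - x) * max (\<psi> x) (\<psi> y)"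
  shows "\<bar>F b - F a\<bar> \<le> \<Phi> b - \<Phi> a"
proof (rule field_le_epsilon)
  fix e :: real assume e: "e > 0"
  \<comment> \<open>The added 1 keeps the denominator positive when a = b.\<close>
  define \<theta> where "\<theta> = e / (b - a + 1)"
  have \<theta>: "\<theta> > 0" "\<theta> * (b - a) \<le> e" unfolding \<theta>_def using e assms(1) by (auto simp: divide_simps algebra_simps)
  define P where "P u v \<longleftrightarrow> (a \<le> u \<longrightarrow> u \<le> v \<longrightarrow> v \<le> b \<longrightarrow> \<bar>F v - F u\<bar> \<le> \<Phi> v - \<Phi> u + \<theta> * (v - u))" for u v
  have "P a b"
  using assms(1) proof (induction rule: Bolzano)
    case (trans u v w)
    then show ?case unfolding P_def by (auto simp: algebra_simps)
  next
    case (local x)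
    obtain d where d: "d > 0" "\<And>y. y \<in> {a..b} \<Longrightarrow> \<bar>y - x\<bar> < d \<Longrightarrow> \<bar>\<psi> y - \<psi> x\<bar> < \<theta> / 2"
      using \<psi> local \<theta>(1) unfolding continuous_on_iff dist_real_def
      by (metis atLeastAtMost_iff half_gt_zero)
    show ?case
    proof (intro exI[of _ d] conjI allI impI d)
      fix u v assume uv: "u \<le> x \<and> x \<le> v \<and> v - u < d"
      show "P u v" unfolding P_def
      proof (intro impI)
        assume au: "a \<le> u" "u \<le> v" "v \<le> b"
        show "\<bar>F v - F u\<bar> \<le> \<Phi> v - \<Phi> u + \<theta> * (v - u)"
        proof (cases "u = v")
          case False
          then have "u < v" using au by simp
          then obtain z where z: "z \<in> {u<..<v}" "\<Phi> v - \<Phi> u = (v - u) * \<psi> z"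
            using MVT_within[of u v \<Phi> \<psi>] DERIV_subset[OF \<Phi>, of _ "{u..v}"] au by force
          have "\<bar>\<psi> z - \<psi> x\<bar> < \<theta> / 2" "\<bar>\<psi> u - \<psi> x\<bar> < \<theta> / 2" "\<bar>\<psi> v - \<psi> x\<bar> < \<theta> / 2"
            using d(2)[of z] d(2)[of u] d(2)[of v] z uv au by auto
          then have "\<psi> u \<le> \<psi> z + \<theta>" "\<psi> v \<le> \<psi> z + \<theta>" by linarith+
          then have "max (\<psi> u) (\<psi> v) \<le> \<psi> z + \<theta>" by simp
          then have "(v - u) * max (\<psi> u) (\<psi> v) \<le> (v - u) * (\<psi> z + \<theta>)"
            using au by (intro mult_left_mono) auto
          then show ?thesis using F[of u v] au z by (auto simp: algebra_simps)
        qed auto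
      qed
    qed
  qed
  then show "\<bar>F b - F a\<bar> \<le> \<Phi> b - \<Phi> a + e"
    unfolding P_def using assms(1) \<theta> by auto
qed

lemma MVT_between:
  fixes f :: "real \<Rightarrow> real"
  assumes "\<And>t. t \<in> S \<Longrightarrow> (f has_real_derivative f' t) (at t within S)"
    and "{min x y..max x y} \<subseteq> S"
  shows "\<exists>z\<in>{min x y..max x y}. f y - f x = (y - x) * f' z"
proof -
  have *: "\<exists>z\<in>{u..v}. f v - f u = (v - u) * f' z" if uv: "u \<le> v" "{u..v} \<subseteq> S" for u v
  proof (cases "u = v")
    case False
    then have "u < v" using uv by simp
    moreover have "(f has_real_derivative f' t) (at t within {u..v})" if "t \<in> {u..v}" for t
      using uv that by (intro DERIV_subset[OF assms(1)]) auto
    ultimately obtain z where "z \<in> {u<..<v}" "f v - f u = (v - u) * f' z"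
      using MVT_within[of u v f f'] by blast
    then show ?thesis by (intro bexI[of _ z]) auto
  qed auto
  show ?thesis
  proof (cases "x \<le> y")
    case True then show ?thesis using *[of x y] assms(2) by (simp add: max_def min_def)
  next
    case False
    then obtain z where "z \<in> {y..x}" "f x - f y = (x - y) * f' z" using *[of y x] assms(2) by (auto simp: max_def min_def)
    then show ?thesis using False by (intro bexI[of _ z]) (auto simp: algebra_simps)
  qed
qed

lemma bern_weight_alt:
  assumes "n \<ge> 1" "0 \<le> x" "x \<le> 1"
  shows "bern_weight n x = (1 + 2 / real n) / (x * (1 - x) + 1 / real n + (1 / real n)\<^sup>2)"
proof -
  define e where "e = 1 / real n"
  have e: "e > 0" using assms by (simp add: e_def)
  have "x + e > 0" "1 - x + e > 0" using assms e by (auto simp: add_nonneg_pos)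
  then have "1 / (x + e) + 1 / (1 - x + e) = (1 + 2 * e) / ((x + e) * (1 - x + e))"
    by (simp add: divide_simps)
  also have "(x + e) * (1 - x + e) = x * (1 - x) + e + e\<^sup>2"
    by (simp add: algebra_simps power2_eq_square)
  finally show ?thesis unfolding bern_weight_def e_def by simp
qed

text \<open>By \<open>bern_weight_alt\<close> the weight decreases in x(1-x), and on an interval
  this concave function is at least the smaller of its end values.\<close>

lemma bern_root_weight_between:
  assumes "n \<ge> 1" "x \<in> {0..1}" "y \<in> {0..1}" "z \<in> {min x y..max x y}"
  shows "bern_root_weight n z \<le> max (bern_root_weight n x) (bern_root_weight n y)"
proof -
  have *: "z * (1 - z) \<ge> min (x * (1 - x)) (y * (1 - y))" if "x \<le> z" "z \<le> y" for x y z :: real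
  proof (cases "x + z \<le> 1")
    case True
    have "z * (1 - z) - x * (1 - x) = (z - x) * (1 - (x + z))" by (simp add: algebra_simps)
    also have "\<dots> \<ge> 0" using that True by simp
    finally show ?thesis by simp
  next
    case False
    have "z * (1 - z) - y * (1 - y) = (y - z) * ((y + z) - 1)" by (simp add: algebra_simps)
    also have "\<dots> \<ge> 0" using that False by simp
    finally show ?thesis by simp
  qed
  have m: "z * (1 - z) \<ge> min (x * (1 - x)) (y * (1 - y))"
    using *[of "min x y" z "max x y"] assms(4) by (cases "x \<le> y") (auto simp: min_def max_def split: if_splits)
  define e where "e = 1 / real n + (1 / real n)\<^sup>2"
  have e: "e > 0" unfolding e_def using assms by (auto intro!: add_pos_nonneg)
  have W: "bern_weight n t = (1 + 2 / real n) / (t * (1 - t) + e)" if "t \<in> {0..1}" for t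
    using bern_weight_alt[OF assms(1), of t] that unfolding e_def by (simp add: add.assoc)
  have z: "z \<in> {0..1}" using assms by (auto simp: min_def max_def split: if_splits)
  have p: "t * (1 - t) + e > 0" if "t \<in> {0..1}" for t using that e by (auto intro!: add_nonneg_pos)
  have "bern_weight n z \<le> max (bern_weight n x) (bern_weight n y)"
  proof (cases "z * (1 - z) \<ge> x * (1 - x)")
    case True
    then have "bern_weight n z \<le> bern_weight n x"
      unfolding W[OF z] W[OF assms(2)] using p[OF z] p[OF assms(2)] by (intro divide_left_mono) auto
    then show ?thesis by simp
  next
    case False
    then have "z * (1 - z) \<ge> y * (1 - y)" using m by (auto simp: min_def split: if_splits)
    then have "bern_weight n z \<le> bern_weight n y"
      unfolding W[OF z] W[OF assms(3)] using p[OF z] p[OF assms(3)] by (intro divide_left_mono) auto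
    then show ?thesis by simp
  qed
  then show ?thesis unfolding bern_root_weight_def by (auto simp: max_def split: if_splits)
qed

text \<open>For k \<le> N = n - s the points k/n, ..., (k+s)/n stay in [0,1], so the mean value
  theorem for differences applies with step 1/n.\<close>

lemma fdiff_mean_value_bernstein_nodes:
  fixes G :: "nat \<Rightarrow> real \<Rightarrow> real" and n N s k :: nat
  assumes "n = N + s" "N \<ge> 1" "k \<le> N"
    and G: "\<And>j t. j < s \<Longrightarrow> t \<in> {0..1} \<Longrightarrow> (G j has_real_derivative G (Suc j) t) (at t within {0..1})"
  shows "\<exists>\<xi>. real k / n \<le> \<xi> \<and> \<xi> \<le> real (k + s) / n \<and> (fdiff ^^ s) (\<lambda>k. G 0 (real k / n)) k = (1 / n) ^ s * G s \<xi>"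
proof -
  have n0: "real n > 0" using assms by simp
  have e: "real (k + s) / n \<le> 1" "real k / n + s * (1 / n) = real (k + s) / n"
    using assms n0 by (auto simp: divide_simps)
  have sub: "{real k / n..real k / n + s * (1 / n)} \<subseteq> {0..1}"
    unfolding atLeastatMost_subset_iff using e by simp
  have "\<exists>\<xi>\<in>{real k / n..real k / n + s * (1 / n)}. (fdiff ^^ s) (\<lambda>j. G 0 (real k / n + j * (1 / n))) 0 = (1 / n) ^ s * G s \<xi>"
  proof (rule fdiff_mean_value)
    fix j t assume "j < s" "t \<in> {real k / n..real k / n + s * (1 / n)}"
    then show "(G j has_real_derivative G (Suc j) t) (at t within {real k / n..real k / n + s * (1 / n)})"
      using sub by (intro DERIV_subset[OF G]) blast+
  qed (use n0 in simp)
  moreover have "(\<lambda>j::nat. G 0 (real k / n + j * (1 / n))) = (\<lambda>j. G 0 (real (j + k) / n))"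
    by (simp add: add_divide_distrib add.commute)
  ultimately show ?thesis
    using fdiff_funpow_shift[of s "\<lambda>k. G 0 (real k / n)" k 0] e by auto
qed

text \<open>G is a family of successive derivatives up to order s + 1. The two terms without K are
  the price of s > 0: the falling factorial n (n-1) ... (n-s+1) differs from n^s, and the mean value
  points are displaced from x on average by up to s/n.\<close>

definition bern_deriv_error_bound :: "nat \<Rightarrow> real \<Rightarrow> bool" where
  "bern_deriv_error_bound s C \<longleftrightarrow> (\<forall>n K G x. n \<ge> 2 \<longrightarrow> 2 * s \<le> n \<longrightarrow> K \<ge> 0 \<longrightarrow> x \<in> {0..1} \<longrightarrow>
    (\<forall>k\<le>s. \<forall>t\<in>{0..1}. (G k has_real_derivative G (Suc k) t) (at t within {0..1})) \<longrightarrow>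
    (\<forall>t\<in>{0..1}. \<forall>u\<in>{0..1}. \<bar>G (Suc s) t - G (Suc s) u\<bar> \<le> K * \<bar>t - u\<bar> * max (bern_root_weight n t) (bern_root_weight n u) ^ (s + 2)) \<longrightarrow>
    \<bar>G s x - bern_deriv n (\<lambda>k. G 0 (real k / real n)) s x\<bar>
     \<le> (real s)\<^sup>2 / n * \<bar>G s x\<bar> + real s / n * \<bar>G (Suc s) x\<bar> + C * K / n * bern_root_weight n x ^ s)"

text \<open>The s-th derivative of the Bernstein polynomial equals \<gamma> times the average of
  G_s(\<xi>_k) with \<xi>_k in [k/n, (k+s)/n]. Expanding G_s at x to first order leaves three
  errors: 1 - \<gamma>, the mean displacement E, and the remainders R_k, which
  \<open>Bernstein_moment_root_weight\<close> controls.\<close>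

lemma bern_deriv_error: "\<exists>C\<ge>0. bern_deriv_error_bound s C"
proof -
  obtain C where C: "C \<ge> 0" and master: "\<And>n N x \<xi>. n = N + s \<Longrightarrow> s \<le> N \<Longrightarrow> N \<ge> 1 \<Longrightarrow> n \<ge> 2 \<Longrightarrow> 0 \<le> x \<Longrightarrow> x \<le> 1 \<Longrightarrow>
     (\<forall>k\<le>N. real k / real n \<le> \<xi> k \<and> \<xi> k \<le> real (k + s) / real n) \<Longrightarrow>
     (\<Sum>k\<le>N. Bernstein N k x * (\<xi> k - x)\<^sup>2 * max (bern_root_weight n x) (bern_root_weight n (\<xi> k)) ^ (s + 2))
       \<le> C / real n * bern_root_weight n x ^ s"
    using Bernstein_moment_root_weight[of s s] by blast
  show ?thesis
    unfolding bern_deriv_error_bound_def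
  proof (intro exI[of _ C] conjI allI impI C)
    fix n :: nat and K :: real and G x
    assume n: "n \<ge> 2" "2 * s \<le> n" and K: "K \<ge> 0" and x: "x \<in> {0..1::real}"
      and G: "\<forall>k\<le>s. \<forall>t\<in>{0..1}. (G k has_real_derivative G (Suc k) t) (at t within {0..1})"
      and L: "\<forall>t\<in>{0..1}. \<forall>u\<in>{0..1}. \<bar>G (Suc s) t - G (Suc s) u\<bar> \<le> K * \<bar>t - u\<bar> * max (bern_root_weight n t) (bern_root_weight n u) ^ (s + 2)"
    define N where "N = n - s"
    have N: "n = N + s" "s \<le> N" "N \<ge> 1" using n by (auto simp: N_def)
    have n0: "real n > 0" "real N > 0" using N by auto
    have "\<forall>k. \<exists>\<xi>. k \<le> N \<longrightarrow> real k / n \<le> \<xi> \<and> \<xi> \<le> real (k + s) / n \<and> (fdiff ^^ s) (\<lambda>k. G 0 (real k / n)) k = (1 / n) ^ s * G s \<xi>"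
      using fdiff_mean_value_bernstein_nodes[OF N(1,3), of _ G] G by (meson less_imp_le)
    then obtain \<xi> where \<xi>: "\<And>k. k \<le> N \<Longrightarrow> real k / n \<le> \<xi> k \<and> \<xi> k \<le> real (k + s) / n"
      and \<xi>': "\<And>k. k \<le> N \<Longrightarrow> (fdiff ^^ s) (\<lambda>k. G 0 (real k / n)) k = (1 / n) ^ s * G s (\<xi> k)"
      by metis
    have \<xi>01: "\<xi> k \<in> {0..1}" if "k \<le> N" for k
    proof -
      have "real (k + s) / n \<le> 1" using N n0 that by (simp add: divide_simps)
      moreover have "real k / n \<ge> 0" by simp
      ultimately show ?thesis using \<xi>[OF that] by (meson atLeastAtMost_iff order_trans)
    qed
    \<comment> \<open>The falling factorial divided by n^s. It is at least (N/n)^s = (1 - s/n)^s,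
      and Bernoulli's inequality turns this into 1 - s^2/n.\<close>
    define \<gamma> where "\<gamma> = fact n / (fact N * real n ^ s)"
    have \<gamma>1: "\<gamma> \<le> 1"
    proof -
      have "fact N dvd (fact n :: nat)" using N by (intro fact_dvd) simp
      then have e: "fact n = (fact n div fact N) * (fact N :: nat)" by (rule dvd_div_mult_self[symmetric])
      have "fact n div fact N \<le> n ^ s"
        unfolding N_def using N by (intro fact_div_fact_le_pow) simp
      then have "(fact n div fact N) * (fact N :: nat) \<le> n ^ s * fact N" by (rule mult_right_mono) simp
      then have "(fact n :: nat) \<le> n ^ s * fact N" using e by linarith
      then have "real (fact n) \<le> real (n ^ s * fact N)" by (rule of_nat_mono)
      then have "(fact n :: real) \<le> real n ^ s * fact N" by simp
      then show ?thesis unfolding \<gamma>_def using n0 by (simp add: divide_simps mult.commute)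
    qed
    have \<gamma>2: "\<gamma> \<ge> 1 - (real s)\<^sup>2 / n"
    proof -
      have "1 - (real s)\<^sup>2 / n = 1 + real s * (- (s / n))" by (simp add: power2_eq_square)
      also have "\<dots> \<le> (1 + (- (s / n))) ^ s"
        using N n0 by (intro Bernoulli_inequality) (auto simp: divide_simps)
      also have "1 + (- (s / n)) = N / n" using N n0 by (simp add: field_simps)
      also have "(N / n) ^ s \<le> \<gamma>"
        using fact_add_ge[of N s] N n0 by (simp add: \<gamma>_def power_divide divide_simps mult_ac)
      finally show ?thesis .
    qed
    have \<gamma>0: "\<gamma> \<ge> 0" unfolding \<gamma>_def by simp
    have B0: "Bernstein N k x \<ge> 0" for k using x by (auto intro: Bernstein_nonneg)
    have bd: "bern_deriv n (\<lambda>k. G 0 (real k / n)) s x = \<gamma> * (\<Sum>k\<le>N. Bernstein N k x * G s (\<xi> k))"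
    proof -
      have "bern_deriv n (\<lambda>k. G 0 (real k / n)) s x = fact n / fact N * (\<Sum>k\<le>N. (1 / n) ^ s * G s (\<xi> k) * Bernstein N k x)"
        unfolding bern_deriv_def bern_sum_def N_def[symmetric]
        by (intro arg_cong2[where f = "(*)"] sum.cong refl) (simp add: \<xi>')
      also have "\<dots> = \<gamma> * (\<Sum>k\<le>N. Bernstein N k x * G s (\<xi> k))"
        unfolding \<gamma>_def sum_distrib_left by (intro sum.cong refl) (simp add: power_divide)
      finally show ?thesis .
    qed
    define R where "R k = G s (\<xi> k) - G s x - (\<xi> k - x) * G (Suc s) x" for k
    have R: "\<bar>R k\<bar> \<le> K * ((\<xi> k - x)\<^sup>2 * max (bern_root_weight n x) (bern_root_weight n (\<xi> k)) ^ (s + 2))" if k: "k \<le> N" for k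
    proof -
      have "\<exists>z\<in>{min x (\<xi> k)..max x (\<xi> k)}. G s (\<xi> k) - G s x = (\<xi> k - x) * G (Suc s) z"
        by (rule MVT_between[where S = "{0..1}"]) (use G x \<xi>01[OF k] in auto)
      then obtain z where z: "z \<in> {min x (\<xi> k)..max x (\<xi> k)}" "G s (\<xi> k) - G s x = (\<xi> k - x) * G (Suc s) z" by blast
      have z01: "z \<in> {0..1}" using z x \<xi>01[OF k] by (auto simp: min_def max_def split: if_splits)
      have S0: "bern_root_weight n x \<ge> 1" "bern_root_weight n (\<xi> k) \<ge> 1"
        using bern_root_weight_ge_1 n x \<xi>01[OF k] by auto
      have "R k = (\<xi> k - x) * (G (Suc s) z - G (Suc s) x)" unfolding R_def z(2) by (simp add: algebra_simps)
      then have "\<bar>R k\<bar> = \<bar>\<xi> k - x\<bar> * \<bar>G (Suc s) z - G (Suc s) x\<bar>" by (simp add: abs_mult)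
      also have "\<dots> \<le> \<bar>\<xi> k - x\<bar> * (K * \<bar>z - x\<bar> * max (bern_root_weight n z) (bern_root_weight n x) ^ (s + 2))"
        using L x z01 by (intro mult_left_mono) auto
      also have "\<dots> \<le> \<bar>\<xi> k - x\<bar> * (K * \<bar>\<xi> k - x\<bar> * max (bern_root_weight n x) (bern_root_weight n (\<xi> k)) ^ (s + 2))"
      proof (intro mult_left_mono mult_mono power_mono)
        show "\<bar>z - x\<bar> \<le> \<bar>\<xi> k - x\<bar>" using z by (auto simp: min_def max_def split: if_splits)
        show "max (bern_root_weight n z) (bern_root_weight n x) \<le> max (bern_root_weight n x) (bern_root_weight n (\<xi> k))"
          using bern_root_weight_between[of n x "\<xi> k" z] n x \<xi>01[OF k] z by auto
      qed (use K S0 in \<open>auto simp: max_def intro!: mult_nonneg_nonneg zero_le_power\<close>)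
      also have "\<dots> = K * ((\<xi> k - x)\<^sup>2 * max (bern_root_weight n x) (bern_root_weight n (\<xi> k)) ^ (s + 2))"
        unfolding power2_abs[of "\<xi> k - x", symmetric] by (simp only: power2_eq_square mult_ac)
      finally show ?thesis .
    qed
    \<comment> \<open>The nodes k/N have mean exactly x, and \<xi>_k is within s/n of k/N.\<close>
    define E where "E = (\<Sum>k\<le>N. Bernstein N k x * (\<xi> k - x))"
    have E: "\<bar>E\<bar> \<le> s / n"
    proof -
      have "E = (\<Sum>k\<le>N. Bernstein N k x * (\<xi> k - real k / N)) + ((\<Sum>k\<le>N. real k * Bernstein N k x) / N - x * (\<Sum>k\<le>N. Bernstein N k x))"
        unfolding E_def sum_distrib_left sum_divide_distrib sum_subtractf[symmetric] sum.distrib[symmetric]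
        by (intro sum.cong refl) (simp add: algebra_simps)
      also have "(\<Sum>k\<le>N. real k * Bernstein N k x) / N - x * (\<Sum>k\<le>N. Bernstein N k x) = 0"
        unfolding sum_k_Bernstein sum_Bernstein using n0 by simp
      finally have "\<bar>E\<bar> \<le> (\<Sum>k\<le>N. \<bar>Bernstein N k x * (\<xi> k - real k / N)\<bar>)" by (simp add: sum_abs)
      also have "\<dots> \<le> (\<Sum>k\<le>N. Bernstein N k x * (s / n))"
      proof (intro sum_mono)
        fix k assume "k \<in> {..N}" then have k: "k \<le> N" by simp
        have 1: "real k / n \<le> real k / N" using N n0 by (auto simp: frac_le)
        have 2: "real k / N \<le> real (k + s) / n"
          using k N n0 by (simp add: divide_simps) (simp add: algebra_simps mult_right_mono)
        have "\<bar>\<xi> k - real k / real N\<bar> \<le> real s / n"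
          using 1 2 \<xi>[OF k] add_divide_distrib[of "real k" "real s" "real n"] unfolding of_nat_add by argo
        then show "\<bar>Bernstein N k x * (\<xi> k - real k / N)\<bar> \<le> Bernstein N k x * (s / n)"
          using B0 by (simp add: abs_mult mult_left_mono del: times_divide_eq_right)
      qed
      also have "\<dots> = s / n" by (subst sum_distrib_right[symmetric]) simp
      finally show ?thesis .
    qed
    have S: "(\<Sum>k\<le>N. Bernstein N k x * G s (\<xi> k)) = G s x + E * G (Suc s) x + (\<Sum>k\<le>N. Bernstein N k x * R k)"
    proof -
      have "(\<Sum>k\<le>N. Bernstein N k x * G s (\<xi> k)) = (\<Sum>k\<le>N. Bernstein N k x) * G s x + E * G (Suc s) x + (\<Sum>k\<le>N. Bernstein N k x * R k)"
        unfolding E_def R_def sum_distrib_right sum.distrib[symmetric]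
        by (intro sum.cong refl) (simp add: algebra_simps)
      then show ?thesis by simp
    qed
    have RR: "\<bar>\<Sum>k\<le>N. Bernstein N k x * R k\<bar> \<le> C * K / n * bern_root_weight n x ^ s"
    proof -
      have "\<bar>\<Sum>k\<le>N. Bernstein N k x * R k\<bar> \<le> (\<Sum>k\<le>N. \<bar>Bernstein N k x * R k\<bar>)" by (rule sum_abs)
      also have "\<dots> \<le> (\<Sum>k\<le>N. Bernstein N k x * (K * ((\<xi> k - x)\<^sup>2 * max (bern_root_weight n x) (bern_root_weight n (\<xi> k)) ^ (s + 2))))"
        using B0 R by (intro sum_mono) (auto simp: abs_mult intro!: mult_left_mono)
      also have "\<dots> = K * (\<Sum>k\<le>N. Bernstein N k x * (\<xi> k - x)\<^sup>2 * max (bern_root_weight n x) (bern_root_weight n (\<xi> k)) ^ (s + 2))"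
        unfolding sum_distrib_left by (intro sum.cong refl) (simp add: mult_ac)
      also have "\<dots> \<le> K * (C / real n * bern_root_weight n x ^ s)"
        using K x n N \<xi> by (intro mult_left_mono master) auto
      finally show ?thesis by (simp add: mult_ac)
    qed
    have "G s x - bern_deriv n (\<lambda>k. G 0 (real k / n)) s x = (1 - \<gamma>) * G s x - \<gamma> * (E * G (Suc s) x) - \<gamma> * (\<Sum>k\<le>N. Bernstein N k x * R k)"
      unfolding bd S by (simp add: algebra_simps)
    also have "\<bar>\<dots>\<bar> \<le> \<bar>(1 - \<gamma>) * G s x\<bar> + \<bar>\<gamma> * (E * G (Suc s) x)\<bar> + \<bar>\<gamma> * (\<Sum>k\<le>N. Bernstein N k x * R k)\<bar>"
      by linarith
    also have "\<dots> \<le> (real s)\<^sup>2 / n * \<bar>G s x\<bar> + 1 * (s / n * \<bar>G (Suc s) x\<bar>) + 1 * (C * K / n * bern_root_weight n x ^ s)"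
      unfolding abs_mult using \<gamma>0 \<gamma>1 \<gamma>2 E RR
      by (intro add_mono mult_mono) (auto intro!: mult_nonneg_nonneg)
    finally show "\<bar>G s x - bern_deriv n (\<lambda>k. G 0 (real k / n)) s x\<bar> \<le> (real s)\<^sup>2 / n * \<bar>G s x\<bar> + real s / n * \<bar>G (Suc s) x\<bar> + C * K / n * bern_root_weight n x ^ s"
      by simp
  qed
qed

section \<open>Iterates of the Bernstein error operator\<close>

text \<open>
  The functions $G_k$ play the role of the derivatives of $G_0$. The derivative of order $p+1$, which
  need not exist everywhere, is replaced by a local Lipschitz condition on $G_p$.
\<close>

definition bern_class :: "nat \<Rightarrow> nat \<Rightarrow> real \<Rightarrow> (nat \<Rightarrow> real \<Rightarrow> real) \<Rightarrow> bool" where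
  "bern_class n p K G \<longleftrightarrow>
     (\<forall>k<p. \<forall>x\<in>{0..1}. (G k has_real_derivative G (Suc k) x) (at x within {0..1})) \<and>
     (\<forall>x\<in>{0..1}. \<bar>G 0 x\<bar> \<le> K) \<and>
     (\<forall>x\<in>{0..1}. \<forall>y\<in>{0..1}. \<bar>G p x - G p y\<bar> \<le> K * \<bar>x - y\<bar> * max (bern_root_weight n x) (bern_root_weight n y) ^ (p + 1))"

lemma bern_class_nonneg: "bern_class n p K G \<Longrightarrow> K \<ge> 0"
  unfolding bern_class_def by (meson abs_ge_zero atLeastAtMost_iff order_refl order_trans zero_le_one)

lemma abs_fdiff_funpow_le:
  assumes "\<And>k. k \<le> m + s \<Longrightarrow> \<bar>c k\<bar> \<le> (K::real)"
  shows "\<bar>(fdiff ^^ s) c m\<bar> \<le> 2 ^ s * K"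
  using assms
proof (induction s arbitrary: m)
  case (Suc s)
  have "\<bar>(fdiff ^^ s) c (Suc m)\<bar> \<le> 2 ^ s * K" "\<bar>(fdiff ^^ s) c m\<bar> \<le> 2 ^ s * K"
    using Suc by auto
  moreover have "(fdiff ^^ Suc s) c m = (fdiff ^^ s) c (Suc m) - (fdiff ^^ s) c m"
    by (simp add: fdiff_def)
  ultimately show ?case by simp
qed simp

text \<open>A k-th difference of a function bounded by K is at most 2^k K and equals h^k G_k(\<xi>).
  This supplies one point in the middle of the interval from which bounds on higher derivatives can
  be integrated.\<close>

lemma bern_class_deriv_at_point:
  assumes "bern_class n p K G" "k \<le> p"
  shows "\<exists>\<xi>\<in>{1/4..3/4}. \<bar>G k \<xi>\<bar> \<le> (4 * (real k + 1)) ^ k * K"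
proof -
  define h where "h = 1 / (2 * (real k + 1))"
  have h: "h > 0" "k * h \<le> 1 / 2" unfolding h_def by (auto simp: divide_simps)
  have sub: "{1/4..1/4 + k * h} \<subseteq> {0..1}" "{1/4..1/4 + k * h} \<subseteq> {1/4..3/4}"
    unfolding atLeastatMost_subset_iff using h by linarith+
  have "\<exists>\<xi>\<in>{1/4..1/4 + k * h}. (fdiff ^^ k) (\<lambda>j. G 0 (1/4 + j * h)) 0 = h ^ k * G k \<xi>"
  proof (rule fdiff_mean_value[OF h(1)])
    fix j t assume j: "j < k" and t: "t \<in> {1/4..1/4 + k * h}"
    have "(G j has_real_derivative G (Suc j) t) (at t within {0..1})"
      using assms j t sub unfolding bern_class_def by auto
    then show "(G j has_real_derivative G (Suc j) t) (at t within {1/4..1/4 + k * h})"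
      using sub DERIV_subset by blast
  qed
  then obtain \<xi> where \<xi>: "\<xi> \<in> {1/4..1/4 + k * h}" "(fdiff ^^ k) (\<lambda>j. G 0 (1/4 + j * h)) 0 = h ^ k * G k \<xi>" by blast
  have "\<bar>(fdiff ^^ k) (\<lambda>j. G 0 (1/4 + j * h)) 0\<bar> \<le> 2 ^ k * K"
  proof (rule abs_fdiff_funpow_le)
    fix j assume "j \<le> 0 + k"
    then have "real j * h \<le> real k * h" using h by (intro mult_right_mono) auto
    moreover have "real j * h \<ge> 0" using h by simp
    ultimately have "1/4 + j * h \<in> {0..1}" unfolding atLeastAtMost_iff using h by linarith
    then show "\<bar>G 0 (1/4 + j * h)\<bar> \<le> K" using assms unfolding bern_class_def by blast
  qed
  then have "h ^ k * \<bar>G k \<xi>\<bar> \<le> 2 ^ k * K" unfolding \<xi>(2) using h by (simp add: abs_mult)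
  then have "\<bar>G k \<xi>\<bar> \<le> 2 ^ k * K / h ^ k" using h by (simp add: pos_le_divide_eq mult.commute)
  also have "\<dots> = (2 / h) ^ k * K" by (simp add: power_divide)
  also have "2 / h = 4 * (real k + 1)" unfolding h_def by simp
  finally show ?thesis using \<xi>(1) sub by blast
qed

lemma bern_root_weight_mid: "n \<ge> 1 \<Longrightarrow> x \<in> {1/4..3/4} \<Longrightarrow> bern_root_weight n x \<le> 3"
proof -
  assume n: "n \<ge> 1" and x: "x \<in> {1/4..3/4}"
  define e where "e = 1 / real n"
  have e: "e > 0" using n by (simp add: e_def)
  have "1 / (x + e) \<le> 4" "1 / (1 - x + e) \<le> 4" using x e by (simp_all add: divide_simps)
  then have "bern_weight n x \<le> 3\<^sup>2" unfolding bern_weight_def e_def[symmetric] by simp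
  then show ?thesis unfolding bern_root_weight_def by (simp add: real_le_lsqrt)
qed

text \<open>The local Lipschitz constant is of size w^\<alpha> with \<alpha> = (p+1)/2. Its
  antiderivative is of size w^(\<alpha>-1), the power p - 1 of the root weight, if \<alpha> > 1; p =
  1 would give a logarithm. The integration starts at the point found in
  \<open>bern_class_deriv_at_point\<close>.\<close>

lemma bern_class_top_bound:
  assumes p: "p \<ge> 2"
  shows "\<exists>C\<ge>0. \<forall>n K G x. n \<ge> 2 \<longrightarrow> bern_class n p K G \<longrightarrow> x \<in> {0..1} \<longrightarrow>
     \<bar>G p x\<bar> \<le> C * K * bern_root_weight n x ^ (p - 1)"
proof -
  define \<alpha> where "\<alpha> = (real p + 1) / 2"
  have \<alpha>: "\<alpha> > 1" using p by (simp add: \<alpha>_def)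
  \<comment> \<open>2^\<alpha> comes from (u+v)^\<alpha> \<le> 2^\<alpha> (u^\<alpha> + v^\<alpha>),
    the denominator from integrating the power.\<close>
  define A where "A = 2 powr \<alpha> / (\<alpha> - 1)"
  have A: "A \<ge> 0" unfolding A_def using \<alpha> by simp
  show ?thesis
  \<comment> \<open>The three summands bound G_p at the middle point, the antiderivative at x, and
    the antiderivative at the middle point, where the root weight is at most 3.\<close>
  proof (intro exI[of _ "(4 * (real p + 1)) ^ p + A + A * 3 ^ (p - 1)"] conjI allI impI)
    show "0 \<le> (4 * (real p + 1)) ^ p + A + A * 3 ^ (p - 1)" using A by (intro add_nonneg_nonneg) auto
    fix n :: nat and K :: real and G :: "nat \<Rightarrow> real \<Rightarrow> real" and x :: real
    assume n: "n \<ge> 2" and G: "bern_class n p K G" and x: "x \<in> {0..1}"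
    have K: "K \<ge> 0" by (rule bern_class_nonneg[OF G])
    define e where "e = 1 / real n"
    have e: "e > 0" using n by (simp add: e_def)
    define S where "S = bern_root_weight n"
    define \<psi> where "\<psi> t = K * (2 powr \<alpha> * ((t + e) powr (- \<alpha>) + (1 - t + e) powr (- \<alpha>)))" for t
    define \<Phi> where "\<Phi> t = K * (A * ((1 - t + e) powr (1 - \<alpha>) - (t + e) powr (1 - \<alpha>)))" for t
    have pos: "t + e > 0" "1 - t + e > 0" if "t \<in> {0..1}" for t using that e by auto
    have S1: "S t \<ge> 1" if "t \<in> {0..1}" for t using bern_root_weight_ge_1 n that unfolding S_def by auto
    have Wp: "bern_weight n t > 0" if "t \<in> {0..1}" for t
      using bern_weight_ge_1[of n t] n that by auto
    have Spow: "S t ^ k = bern_weight n t powr (real k / 2)" if "t \<in> {0..1}" for t k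
    proof -
      have "S t ^ k = (bern_weight n t powr (1/2)) powr real k"
        unfolding S_def bern_root_weight_def using Wp[OF that] by (simp add: powr_half_sqrt[symmetric] powr_realpow)
      then show ?thesis by (simp add: powr_powr)
    qed
    have K\<psi>: "K * S t ^ (p + 1) \<le> \<psi> t" if t: "t \<in> {0..1}" for t
    proof -
      define a b where "a = 1 / (t + e)" and "b = 1 / (1 - t + e)"
      have ab: "a > 0" "b > 0" using pos[OF t] by (auto simp: a_def b_def)
      have "S t ^ (p + 1) = bern_weight n t powr \<alpha>" unfolding Spow[OF t] \<alpha>_def by (simp add: add.commute)
      also have "bern_weight n t = a + b" by (simp add: bern_weight_def a_def b_def e_def)
      also have "(a + b) powr \<alpha> \<le> (2 * max a b) powr \<alpha>" using ab \<alpha> by (intro powr_mono2) auto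
      also have "\<dots> = 2 powr \<alpha> * max a b powr \<alpha>" using ab by (simp add: powr_mult)
      also have "\<dots> \<le> 2 powr \<alpha> * (a powr \<alpha> + b powr \<alpha>)" by (intro mult_left_mono) (auto simp: max_def)
      also have "\<dots> = 2 powr \<alpha> * ((t + e) powr (- \<alpha>) + (1 - t + e) powr (- \<alpha>))"
        unfolding a_def b_def using pos[OF t] by (simp add: powr_minus powr_divide divide_simps)
      finally show ?thesis unfolding \<psi>_def using K by (intro mult_left_mono)
    qed
    have \<Phi>': "(\<Phi> has_real_derivative \<psi> t) (at t within T)" if t: "t \<in> {0..1}" for t T
    proof -
      have "(\<Phi> has_real_derivative K * (A * ((1 - \<alpha>) * (1 - t + e) powr (1 - \<alpha> - 1) * (-1) - (1 - \<alpha>) * (t + e) powr (1 - \<alpha> - 1)))) (at t within T)"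
        unfolding \<Phi>_def using pos[OF t]
        by (intro DERIV_cmult DERIV_diff DERIV_chain'[where g = "\<lambda>u. u powr (1 - \<alpha>)" and f = "\<lambda>t. 1 - t + e", unfolded o_def]
             has_field_derivative_at_within[OF has_real_derivative_powr]
             DERIV_chain'[where g = "\<lambda>u. u powr (1 - \<alpha>)" and f = "\<lambda>t. t + e" and E = 1, unfolded o_def mult_1_right])
           (auto intro!: derivative_eq_intros)
      also have "K * (A * ((1 - \<alpha>) * (1 - t + e) powr (1 - \<alpha> - 1) * (-1) - (1 - \<alpha>) * (t + e) powr (1 - \<alpha> - 1))) = \<psi> t"
        unfolding \<psi>_def A_def using \<alpha> by (simp add: field_simps)
      finally show ?thesis .
    qed
    have main: "\<bar>G p v - G p u\<bar> \<le> \<Phi> v - \<Phi> u" if uv: "u \<in> {0..1}" "v \<in> {0..1}" "u \<le> v" for u v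
    proof (rule increment_le_antiderivative[where \<psi> = \<psi>])
      show "continuous_on {u..v} \<psi>" unfolding \<psi>_def
        using pos uv by (intro continuous_intros) (force simp: less_le)+
      show "(\<Phi> has_real_derivative \<psi> t) (at t within {u..v})" if "t \<in> {u..v}" for t
        using that uv by (intro \<Phi>') auto
      fix a b assume ab: "u \<le> a" "a \<le> b" "b \<le> v"
      then have ab': "a \<in> {0..1}" "b \<in> {0..1}" using uv by auto
      have "\<bar>G p b - G p a\<bar> \<le> K * \<bar>b - a\<bar> * max (S b) (S a) ^ (p + 1)"
        using G ab' unfolding bern_class_def S_def by blast
      also have "\<dots> = (b - a) * (K * max (S b) (S a) ^ (p + 1))" using ab by simp
      also have "\<dots> \<le> (b - a) * max (\<psi> a) (\<psi> b)"
        using K\<psi>[OF ab'(1)] K\<psi>[OF ab'(2)] ab by (intro mult_left_mono) (auto simp: max_def split: if_splits)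
      finally show "\<bar>G p b - G p a\<bar> \<le> (b - a) * max (\<psi> a) (\<psi> b)" .
    qed (use uv in simp)
    have \<Phi>b: "\<bar>\<Phi> t\<bar> \<le> K * (A * S t ^ (p - 1))" if t: "t \<in> {0..1}" for t
    proof -
      have 1: "(t + e) powr (1 - \<alpha>) = (1 / (t + e)) powr (\<alpha> - 1)" "(1 - t + e) powr (1 - \<alpha>) = (1 / (1 - t + e)) powr (\<alpha> - 1)"
        using pos[OF t] powr_minus[of _ "\<alpha> - 1"] by (simp_all add: powr_divide inverse_eq_divide)
      have 2: "(1 / (t + e)) powr (\<alpha> - 1) \<le> bern_weight n t powr (\<alpha> - 1)" "(1 / (1 - t + e)) powr (\<alpha> - 1) \<le> bern_weight n t powr (\<alpha> - 1)"
        using pos[OF t] \<alpha> unfolding bern_weight_def e_def[symmetric] by (auto intro!: powr_mono2)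
      have 3: "bern_weight n t powr (\<alpha> - 1) = S t ^ (p - 1)"
        unfolding Spow[OF t] \<alpha>_def using p by (simp add: of_nat_diff field_simps)
      have "\<bar>(1 - t + e) powr (1 - \<alpha>) - (t + e) powr (1 - \<alpha>)\<bar> \<le> S t ^ (p - 1)"
        using 1 2 3 powr_ge_zero[of "1 / (t + e)" "\<alpha> - 1"] powr_ge_zero[of "1 / (1 - t + e)" "\<alpha> - 1"] by linarith
      then show ?thesis unfolding \<Phi>_def using K A by (simp add: abs_mult mult_left_mono)
    qed
    obtain \<xi> where \<xi>: "\<xi> \<in> {1/4..3/4}" "\<bar>G p \<xi>\<bar> \<le> (4 * (real p + 1)) ^ p * K"
      using bern_class_deriv_at_point[OF G order_refl] by blast
    have \<xi>01: "\<xi> \<in> {0..1}" using \<xi> by auto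
    have "\<bar>G p x - G p \<xi>\<bar> \<le> \<bar>\<Phi> x\<bar> + \<bar>\<Phi> \<xi>\<bar>"
      using main[OF x \<xi>01] main[OF \<xi>01 x] by (cases "x \<le> \<xi>") auto
    also have "\<dots> \<le> K * (A * S x ^ (p - 1)) + K * (A * 3 ^ (p - 1))"
    proof -
      have "S \<xi> ^ (p - 1) \<le> 3 ^ (p - 1)"
        using bern_root_weight_mid[of n \<xi>] n \<xi> S1[OF \<xi>01] unfolding S_def by (intro power_mono) auto
      then have "K * (A * S \<xi> ^ (p - 1)) \<le> K * (A * 3 ^ (p - 1))" using K A by (intro mult_left_mono)
      then show ?thesis using \<Phi>b[OF x] \<Phi>b[OF \<xi>01] by linarith
    qed
    also have "\<dots> \<le> K * (A * S x ^ (p - 1)) + K * (A * 3 ^ (p - 1)) * S x ^ (p - 1)"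
      using K A S1[OF x] mult_left_mono[of 1 "S x ^ (p - 1)" "K * (A * 3 ^ (p - 1))"] by (simp add: one_le_power)
    finally have 1: "\<bar>G p x - G p \<xi>\<bar> \<le> K * (A * S x ^ (p - 1)) + K * (A * 3 ^ (p - 1)) * S x ^ (p - 1)" .
    have "(4 * (real p + 1)) ^ p * K * 1 \<le> (4 * (real p + 1)) ^ p * K * S x ^ (p - 1)"
      using K S1[OF x] by (intro mult_left_mono) (auto simp: one_le_power)
    then have "\<bar>G p x\<bar> \<le> (4 * (real p + 1)) ^ p * K * S x ^ (p - 1) + K * (A * S x ^ (p - 1)) + K * (A * 3 ^ (p - 1)) * S x ^ (p - 1)"
      using 1 \<xi>(2) by linarith
    also have "\<dots> = ((4 * (real p + 1)) ^ p + A + A * 3 ^ (p - 1)) * K * S x ^ (p - 1)"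
      by (simp add: algebra_simps)
    finally show "\<bar>G p x\<bar> \<le> ((4 * (real p + 1)) ^ p + A + A * 3 ^ (p - 1)) * K * bern_root_weight n x ^ (p - 1)"
      unfolding S_def .
  qed
qed

text \<open>The mean value point lies between x and y, and by
  \<open>bern_root_weight_between\<close> the weight there does not exceed the larger end
  weight.\<close>

lemma bern_lipschitz_of_deriv_bound:
  assumes n: "n \<ge> 2" and K: "K \<ge> 0"
    and D: "\<And>x. x \<in> {0..1} \<Longrightarrow> (g has_real_derivative g' x) (at x within {0..1})"
    and B: "\<And>x. x \<in> {0..1} \<Longrightarrow> \<bar>g' x\<bar> \<le> K * bern_root_weight n x ^ q"
    and xy: "x \<in> {0..1}" "y \<in> {0..1}"
  shows "\<bar>g x - g y\<bar> \<le> K * \<bar>x - y\<bar> * max (bern_root_weight n x) (bern_root_weight n y) ^ q"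
proof -
  have "\<exists>z\<in>{min y x..max y x}. g x - g y = (x - y) * g' z"
    by (rule MVT_between[where S = "{0..1}"]) (use D xy in auto)
  then obtain z where z: "z \<in> {min y x..max y x}" "g x - g y = (x - y) * g' z" by blast
  have z01: "z \<in> {0..1}" using z xy by (auto simp: min_def max_def split: if_splits)
  have z': "z \<in> {min x y..max x y}" using z by (simp add: min.commute max.commute)
  have S1: "bern_root_weight n z \<ge> 1" using bern_root_weight_ge_1 n z01 by auto
  have "\<bar>g x - g y\<bar> = \<bar>x - y\<bar> * \<bar>g' z\<bar>" unfolding z(2) by (simp add: abs_mult)
  also have "\<dots> \<le> \<bar>x - y\<bar> * (K * bern_root_weight n z ^ q)" by (intro mult_left_mono B z01) auto
  also have "\<dots> \<le> \<bar>x - y\<bar> * (K * max (bern_root_weight n x) (bern_root_weight n y) ^ q)"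
    using K S1 bern_root_weight_between[OF _ xy z'] n by (intro mult_left_mono power_mono) auto
  finally show ?thesis by (simp add: mult_ac)
qed

text \<open>Membership at order p - 1 asks for a bound on G_p by the p-th power of the root weight,
  one power more than \<open>bern_class_top_bound\<close> gives. The constant is C + 1 because it
  has to cover the bound K on G_0 too.\<close>

lemma bern_class_lower:
  assumes p: "p \<ge> 2"
  shows "\<exists>C\<ge>0. \<forall>n K G. n \<ge> 2 \<longrightarrow> bern_class n p K G \<longrightarrow> bern_class n (p - 1) (C * K) G"
proof -
  obtain C where C: "C \<ge> 0" "\<And>n K G x. n \<ge> 2 \<Longrightarrow> bern_class n p K G \<Longrightarrow> x \<in> {0..1} \<Longrightarrow>
     \<bar>G p x\<bar> \<le> C * K * bern_root_weight n x ^ (p - 1)"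
    using bern_class_top_bound[OF p] by blast
  show ?thesis
  proof (intro exI[of _ "C + 1"] conjI allI impI)
    show "C + 1 \<ge> 0" using C by simp
    fix n K G assume n: "n \<ge> 2" and G: "bern_class n p K G"
    have K: "K \<ge> 0" by (rule bern_class_nonneg[OF G])
    have CK: "C * K \<le> (C + 1) * K" "K \<le> (C + 1) * K" using C K by (auto simp: algebra_simps)
    have Suc: "Suc (p - 1) = p" "p - 1 + 1 = p" using p by auto
    show "bern_class n (p - 1) ((C + 1) * K) G"
      unfolding bern_class_def
    proof (intro conjI ballI)
      show "\<forall>k<p - 1. \<forall>x\<in>{0..1}. (G k has_real_derivative G (Suc k) x) (at x within {0..1})"
        using G unfolding bern_class_def by auto
      show "\<bar>G 0 x\<bar> \<le> (C + 1) * K" if "x \<in> {0..1}" for x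
        using G CK that unfolding bern_class_def by (meson order_trans)
      fix x y :: real assume xy: "x \<in> {0..1}" "y \<in> {0..1}"
      show "\<bar>G (p - 1) x - G (p - 1) y\<bar> \<le> (C + 1) * K * \<bar>x - y\<bar> * max (bern_root_weight n x) (bern_root_weight n y) ^ (p - 1 + 1)"
        unfolding Suc
      proof (rule bern_lipschitz_of_deriv_bound[OF n _ _ _ xy])
        show "(G (p - 1) has_real_derivative G p t) (at t within {0..1})" if "t \<in> {0..1}" for t
          using G that Suc p unfolding bern_class_def by (metis diff_less less_numeral_extra(1) order_less_le_trans pos2)
        fix t :: real assume t: "t \<in> {0..1}"
        have S1: "bern_root_weight n t \<ge> 1" using bern_root_weight_ge_1 n t by auto
        have "\<bar>G p t\<bar> \<le> C * K * bern_root_weight n t ^ (p - 1)" by (rule C(2)[OF n G t])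
        also have "\<dots> \<le> (C + 1) * K * bern_root_weight n t ^ p"
          using CK C K S1 by (intro mult_mono power_increasing) auto
        finally show "\<bar>G p t\<bar> \<le> (C + 1) * K * bern_root_weight n t ^ p" .
      qed (use C K in auto)
    qed
  qed
qed

text \<open>Used to bound the error of G_0 itself, for which order 1 already gives the full factor
  1/n.\<close>

lemma bern_class_lower_1:
  assumes "p \<ge> 1"
  shows "\<exists>C\<ge>0. \<forall>n K G. n \<ge> 2 \<longrightarrow> bern_class n p K G \<longrightarrow> bern_class n 1 (C * K) G"
  using assms
proof (induction p rule: nat_induct_at_least)
  case base
  then show ?case by (intro exI[of _ 1]) auto
next
  case (Suc p)
  obtain C where C: "C \<ge> 0" "\<And>n K G. n \<ge> 2 \<Longrightarrow> bern_class n p K G \<Longrightarrow> bern_class n 1 (C * K) G" using Suc.IH by blast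
  obtain C' where C': "C' \<ge> 0" "\<And>n K G. n \<ge> 2 \<Longrightarrow> bern_class n (Suc p) K G \<Longrightarrow> bern_class n p (C' * K) G"
    using bern_class_lower[of "Suc p"] Suc.hyps by auto
  show ?case
    by (intro exI[of _ "C * C'"] conjI allI impI)
      (use C C' in \<open>auto simp: mult.assoc\<close>)
qed

definition bern_err :: "nat \<Rightarrow> (real \<Rightarrow> real) \<Rightarrow> real \<Rightarrow> real" where
  "bern_err n f x = f x - bern_sum n (\<lambda>k. f (real k / real n)) x"

text \<open>This is \<open>bern_deriv_error\<close> with s = 0, where both terms without K
  vanish.\<close>

lemma bern_err_class_1:
  "\<exists>C\<ge>0. \<forall>n K G x. n \<ge> 2 \<longrightarrow> bern_class n 1 K G \<longrightarrow> x \<in> {0..1} \<longrightarrow> \<bar>bern_err n (G 0) x\<bar> \<le> C * K / n"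
proof -
  obtain C where C: "C \<ge> 0" "bern_deriv_error_bound 0 C"
    using bern_deriv_error by blast
  show ?thesis
  proof (intro exI[of _ C] conjI allI impI C(1))
    fix n K G x assume n: "n \<ge> 2" and G: "bern_class n 1 K G" and x: "x \<in> {0..1::real}"
    have "\<bar>G 0 x - bern_deriv n (\<lambda>k. G 0 (real k / real n)) 0 x\<bar>
     \<le> (real 0)\<^sup>2 / n * \<bar>G 0 x\<bar> + real 0 / n * \<bar>G (Suc 0) x\<bar> + C * K / n * bern_root_weight n x ^ 0"
      by (rule C(2)[unfolded bern_deriv_error_bound_def, rule_format, OF n _ bern_class_nonneg[OF G] x])
        (use G in \<open>auto simp: bern_class_def\<close>)
    then show "\<bar>bern_err n (G 0) x\<bar> \<le> C * K / n"
      by (simp add: bern_err_def)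
  qed
qed

text \<open>The Lipschitz condition leads to a weighted first moment. The inequality u \<le> q u^2 +
  1/q with q = sqrt n reduces it to the second moment and balances the two terms.\<close>

lemma bern_err_class_0:
  "\<exists>C\<ge>0. \<forall>n K G x. n \<ge> 2 \<longrightarrow> bern_class n 0 K G \<longrightarrow> x \<in> {0..1} \<longrightarrow> \<bar>bern_err n (G 0) x\<bar> \<le> C * K / sqrt n"
proof -
  obtain C where C: "C \<ge> 0" and master: "\<And>n N x \<xi>. n = N + 0 \<Longrightarrow> 0 \<le> N \<Longrightarrow> N \<ge> 1 \<Longrightarrow> n \<ge> 2 \<Longrightarrow> 0 \<le> x \<Longrightarrow> x \<le> 1 \<Longrightarrow>
     (\<forall>k\<le>N. real k / real n \<le> \<xi> k \<and> \<xi> k \<le> real (k + 0) / real n) \<Longrightarrow>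
     (\<Sum>k\<le>N. Bernstein N k x * (\<xi> k - x)\<^sup>2 * max (bern_root_weight n x) (bern_root_weight n (\<xi> k)) ^ (0 + 2))
       \<le> C / real n * bern_root_weight n x ^ 0"
    using Bernstein_moment_root_weight[of 0 0] by blast
  show ?thesis
  proof (intro exI[of _ "C + 1"] conjI allI impI)
    show "C + 1 \<ge> 0" using C by simp
    fix n K G x assume n: "n \<ge> 2" and G: "bern_class n 0 K G" and x: "x \<in> {0..1::real}"
    have K: "K \<ge> 0" by (rule bern_class_nonneg[OF G])
    have n0: "sqrt n > 0" "sqrt n * sqrt n = n" using n by auto
    define M where "M k = max (bern_root_weight n x) (bern_root_weight n (real k / n))" for k
    have B0: "Bernstein n k x \<ge> 0" for k using x by (auto intro: Bernstein_nonneg)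
    have "bern_err n (G 0) x = (\<Sum>k\<le>n. Bernstein n k x) * G 0 x - bern_sum n (\<lambda>k. G 0 (real k / n)) x"
      by (simp add: bern_err_def)
    also have "\<dots> = (\<Sum>k\<le>n. Bernstein n k x * (G 0 x - G 0 (real k / n)))"
      unfolding bern_sum_def sum_distrib_right sum_subtractf[symmetric]
      by (intro sum.cong refl) (simp add: algebra_simps)
    finally have "\<bar>bern_err n (G 0) x\<bar> \<le> (\<Sum>k\<le>n. \<bar>Bernstein n k x * (G 0 x - G 0 (real k / n))\<bar>)" by (simp add: sum_abs)
    also have "\<dots> \<le> (\<Sum>k\<le>n. K * (sqrt n * (Bernstein n k x * (real k / n - x)\<^sup>2 * M k ^ 2) + Bernstein n k x / sqrt n))"
    proof (intro sum_mono)
      fix k assume "k \<in> {..n}"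
      then have k: "real k / n \<in> {0..1}" by (auto simp: divide_simps)
      have "\<bar>G 0 x - G 0 (real k / n)\<bar> \<le> K * \<bar>x - real k / n\<bar> * M k ^ 1"
        using G x k unfolding bern_class_def M_def by (metis add_0)
      also have "\<dots> = K * (\<bar>real k / n - x\<bar> * M k)" by (simp add: abs_minus_commute)
      also have "\<bar>real k / n - x\<bar> * M k \<le> sqrt n * (\<bar>real k / n - x\<bar> * M k) ^ 2 + 1 / sqrt n"
      proof -
        define u where "u = \<bar>real k / n - x\<bar> * M k"
        have "u \<le> q * u\<^sup>2 + 1 / q" if q: "q > 0" for q :: real
        proof -
          have "0 \<le> (q * u - 1 / 2)\<^sup>2 + 3 / 4" by simp
          also have "\<dots> = q * (q * u\<^sup>2 + 1 / q - u)"
            using q by (simp add: power2_eq_square field_simps)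
          finally have "q * u\<^sup>2 + 1 / q - u \<ge> 0" using q by (simp add: zero_le_mult_iff)
          then show ?thesis by simp
        qed
        then show ?thesis using n0(1) unfolding u_def by blast
      qed
      finally have "\<bar>G 0 x - G 0 (real k / n)\<bar> \<le> K * (sqrt n * ((real k / n - x)\<^sup>2 * M k ^ 2) + 1 / sqrt n)"
        using K by (simp add: power_mult_distrib mult_left_mono)
      then have "Bernstein n k x * \<bar>G 0 x - G 0 (real k / n)\<bar> \<le> Bernstein n k x * (K * (sqrt n * ((real k / n - x)\<^sup>2 * M k ^ 2) + 1 / sqrt n))"
        using B0 by (intro mult_left_mono)
      then show "\<bar>Bernstein n k x * (G 0 x - G 0 (real k / n))\<bar> \<le> K * (sqrt n * (Bernstein n k x * (real k / n - x)\<^sup>2 * M k ^ 2) + Bernstein n k x / sqrt n)"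
        unfolding abs_mult abs_of_nonneg[OF B0] by (simp add: algebra_simps)
    qed
    also have "\<dots> = K * (sqrt n * (\<Sum>k\<le>n. Bernstein n k x * (real k / n - x)\<^sup>2 * M k ^ 2) + (\<Sum>k\<le>n. Bernstein n k x) / sqrt n)"
      by (simp only: sum_distrib_left[symmetric] sum.distrib sum_divide_distrib[symmetric])
    also have "\<dots> \<le> K * (sqrt n * (C / n) + 1 / sqrt n)"
      using master[of n n x "\<lambda>k. real k / n"] n x K
      by (intro mult_left_mono add_mono) (auto simp: M_def power2_eq_square simp del: times_divide_eq_right)
    also have "\<dots> = (C + 1) * K / sqrt n"
      using n0(1) by (simp add: real_div_sqrt field_simps)
    finally show "\<bar>bern_err n (G 0) x\<bar> \<le> (C + 1) * K / sqrt n" .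
  qed
qed

text \<open>With s = p + 1, \<open>bern_deriv_error\<close> bounds the s-th derivative of the
  difference, and a bound on that derivative is the Lipschitz condition of order p. The inputs are
  G_(s+1), from \<open>bern_class_top_bound\<close>, and G_s, found by integrating G_(s+1) from a
  middle point. The maximum of the difference itself is bounded by lowering G to order 1.\<close>

lemma bern_class_diff_bern_deriv:
  "\<exists>C\<ge>0. \<forall>n K G. n \<ge> 2 * (p + 1) \<longrightarrow> bern_class n (p + 2) K G \<longrightarrow>
     bern_class n p (C * K / n) (\<lambda>k x. G k x - bern_deriv n (\<lambda>j. G 0 (real j / n)) k x)"
proof -
  define s where "s = p + 1"
  obtain C1 where C1: "C1 \<ge> 0" "bern_deriv_error_bound s C1"
    using bern_deriv_error by blast
  obtain C2 where C2: "C2 \<ge> 0" "\<And>n K G x. n \<ge> 2 \<Longrightarrow> bern_class n (p + 2) K G \<Longrightarrow> x \<in> {0..1} \<Longrightarrow>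
     \<bar>G (p + 2) x\<bar> \<le> C2 * K * bern_root_weight n x ^ (p + 1)"
    using bern_class_top_bound[of "p + 2"] by auto
  obtain C3 where C3: "C3 \<ge> 0" "\<And>n K G. n \<ge> 2 \<Longrightarrow> bern_class n (p + 2) K G \<Longrightarrow> bern_class n 1 (C3 * K) G"
    using bern_class_lower_1[of "p + 2"] by auto
  obtain C4 where C4: "C4 \<ge> 0" "\<And>n K G x. n \<ge> 2 \<Longrightarrow> bern_class n 1 K G \<Longrightarrow> x \<in> {0..1} \<Longrightarrow> \<bar>bern_err n (G 0) x\<bar> \<le> C4 * K / n"
    using bern_err_class_1 by blast
  \<comment> \<open>The value of G_s at the middle point plus the growth of G_s away from it; the
    root weight at the middle point is at most 3.\<close>
  define D where "D = (4 * (real s + 1)) ^ s + C2 * 3 ^ s"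
  have D: "D \<ge> 0" unfolding D_def using C2(1) by (intro add_nonneg_nonneg) auto
  \<comment> \<open>The first three summands collect the error of the s-th derivative, the last one
    the maximum of the difference.\<close>
  define C where "C = (real s)\<^sup>2 * D + real s * C2 + C1 + C4 * C3"
  have C: "C \<ge> 0" unfolding C_def using D C1(1) C2(1) C3(1) C4(1) by (intro add_nonneg_nonneg) auto
  show ?thesis
  proof (intro exI[of _ C] conjI allI impI C)
    fix n K G assume n: "n \<ge> 2 * (p + 1)" and G: "bern_class n (p + 2) K G"
    have n2: "n \<ge> 2" "2 * s \<le> n" using n by (auto simp: s_def)
    have n0: "real n > 0" using n2 by simp
    have K: "K \<ge> 0" by (rule bern_class_nonneg[OF G])
    define c where "c j = G 0 (real j / n)" for j
    have GD: "(G k has_real_derivative G (Suc k) x) (at x within {0..1})" if "k < p + 2" "x \<in> {0..1}" for k x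
      using G that unfolding bern_class_def by blast
    have L: "\<bar>G (Suc s) t - G (Suc s) u\<bar> \<le> K * \<bar>t - u\<bar> * max (bern_root_weight n t) (bern_root_weight n u) ^ (s + 2)"
      if "t \<in> {0..1}" "u \<in> {0..1}" for t u
      using G that unfolding bern_class_def s_def by (simp add: numeral_3_eq_3 numeral_2_eq_2)
    have top: "\<bar>G (Suc s) x\<bar> \<le> C2 * K * bern_root_weight n x ^ s" if "x \<in> {0..1}" for x
      using C2(2)[OF n2(1) G that] by (simp add: s_def)
    have mid: "\<bar>G s x\<bar> \<le> D * K * bern_root_weight n x ^ s" if x: "x \<in> {0..1}" for x
    proof -
      have S1: "bern_root_weight n x \<ge> 1" using bern_root_weight_ge_1 n2 x by auto
      obtain \<xi> where \<xi>: "\<xi> \<in> {1/4..3/4}" "\<bar>G s \<xi>\<bar> \<le> (4 * (real s + 1)) ^ s * K"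
        using bern_class_deriv_at_point[OF G, of s] by (auto simp: s_def)
      have \<xi>01: "\<xi> \<in> {0..1}" using \<xi> by auto
      have \<xi>3: "bern_root_weight n \<xi> \<le> 3" using bern_root_weight_mid[of n \<xi>] n2 \<xi> by auto
      have "\<bar>G s x - G s \<xi>\<bar> \<le> C2 * K * \<bar>x - \<xi>\<bar> * max (bern_root_weight n x) (bern_root_weight n \<xi>) ^ s"
        by (rule bern_lipschitz_of_deriv_bound[OF n2(1) _ _ top x \<xi>01])
          (use C2 K GD in \<open>auto simp: s_def\<close>)
      also have "\<dots> \<le> C2 * K * 1 * (3 * bern_root_weight n x) ^ s"
        using C2 K x \<xi>01 \<xi>3 S1 by (intro mult_mono power_mono) (auto intro!: mult_nonneg_nonneg simp: max_def)
      also have "\<dots> = C2 * 3 ^ s * K * bern_root_weight n x ^ s" by (simp add: power_mult_distrib)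
      finally have 1: "\<bar>G s x - G s \<xi>\<bar> \<le> C2 * 3 ^ s * K * bern_root_weight n x ^ s" .
      have "(4 * (real s + 1)) ^ s * K * 1 \<le> (4 * (real s + 1)) ^ s * K * bern_root_weight n x ^ s"
        using K S1 by (intro mult_left_mono) (auto simp: one_le_power)
      then have "\<bar>G s x\<bar> \<le> (4 * (real s + 1)) ^ s * K * bern_root_weight n x ^ s + C2 * 3 ^ s * K * bern_root_weight n x ^ s"
        using 1 \<xi>(2) by linarith
      then show ?thesis by (simp add: D_def algebra_simps)
    qed
    have nonneg: "0 \<le> D * K" "0 \<le> C2 * K" "0 \<le> C1 * K" "0 \<le> C4 * (C3 * K)"
      using D C1 C2 C3 C4 K by auto
    have err: "\<bar>G s x - bern_deriv n c s x\<bar> \<le> C * K / n * bern_root_weight n x ^ s" if x: "x \<in> {0..1}" for x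
    proof -
      have S1: "bern_root_weight n x \<ge> 1" using bern_root_weight_ge_1 n2 x by auto
      have "\<bar>G s x - bern_deriv n (\<lambda>j. G 0 (real j / n)) s x\<bar>
          \<le> (real s)\<^sup>2 / n * \<bar>G s x\<bar> + real s / n * \<bar>G (Suc s) x\<bar> + C1 * K / n * bern_root_weight n x ^ s"
        by (rule C1(2)[unfolded bern_deriv_error_bound_def, rule_format, OF n2 K x])
          (use GD L in \<open>auto simp: s_def\<close>)
      also have "\<dots> \<le> (real s)\<^sup>2 / n * (D * K * bern_root_weight n x ^ s) + real s / n * (C2 * K * bern_root_weight n x ^ s) + C1 * K / n * bern_root_weight n x ^ s"
        using n0 by (intro add_mono mult_left_mono mid top x order_refl) auto
      also have "\<dots> = ((real s)\<^sup>2 * D + real s * C2 + C1) * K / n * bern_root_weight n x ^ s"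
        using n0 by (simp add: field_simps)
      also have "\<dots> \<le> C * K / n * bern_root_weight n x ^ s"
        unfolding C_def using K C3 C4 S1 by (intro mult_right_mono divide_right_mono) auto
      finally show ?thesis unfolding c_def .
    qed
    show "bern_class n p (C * K / n) (\<lambda>k x. G k x - bern_deriv n (\<lambda>j. G 0 (real j / n)) k x)"
      unfolding bern_class_def c_def[symmetric]
    proof (intro conjI allI ballI impI)
      fix k x assume "k < p" and x: "x \<in> {0..1::real}"
      then show "((\<lambda>x. G k x - bern_deriv n c k x) has_real_derivative G (Suc k) x - bern_deriv n c (Suc k) x) (at x within {0..1})"
        using n by (intro DERIV_diff GD DERIV_bern_deriv) auto
    next
      fix x :: real assume x: "x \<in> {0..1}"
      have "\<bar>bern_err n (G 0) x\<bar> \<le> C4 * (C3 * K) / n"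
        by (rule C4(2)[OF n2(1) C3(2)[OF n2(1) G] x])
      also have "\<dots> \<le> C * K / n"
        unfolding C_def using nonneg n0 D C2 C1 K
        by (intro divide_right_mono) (auto simp: algebra_simps intro!: add_nonneg_nonneg mult_nonneg_nonneg)
      finally show "\<bar>G 0 x - bern_deriv n c 0 x\<bar> \<le> C * K / n" by (simp add: bern_err_def c_def[abs_def])
    next
      fix x y :: real assume xy: "x \<in> {0..1}" "y \<in> {0..1}"
      show "\<bar>(G p x - bern_deriv n c p x) - (G p y - bern_deriv n c p y)\<bar>
          \<le> C * K / n * \<bar>x - y\<bar> * max (bern_root_weight n x) (bern_root_weight n y) ^ (p + 1)"
        unfolding s_def[symmetric]
      proof (rule bern_lipschitz_of_deriv_bound[OF n2(1) _ _ err xy])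
        show "((\<lambda>x. G p x - bern_deriv n c p x) has_real_derivative G s t - bern_deriv n c s t) (at t within {0..1})"
          if "t \<in> {0..1}" for t
          unfolding s_def Suc_eq_plus1[symmetric] using n that
          by (intro DERIV_diff GD DERIV_bern_deriv) auto
      qed (use C K n0 in auto)
    qed
  qed
qed

text \<open>Each application of the error operator lowers the order by two; the remaining orders 0
  and 1 take one more application, which yields 1/sqrt n or 1/n. The threshold for n keeps the
  degrees n - s that occur at n/2 or above.\<close>

theorem bern_class_approx:
  "\<exists>C\<ge>0. \<exists>n0. \<forall>n\<ge>n0. \<forall>K G x. bern_class n p K G \<longrightarrow> x \<in> {0..1} \<longrightarrow>
     \<bar>(bern_err n ^^ (p div 2 + 1)) (G 0) x\<bar> \<le> C * K / sqrt n ^ (p + 1)"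
proof (induction p rule: nat_less_induct)
  case (1 p)
  consider "p = 0" | "p = 1" | q where "p = q + 2"
    by (metis One_nat_def add_2_eq_Suc' not0_implies_Suc)
  then show ?case
  proof cases
    case 1
    obtain C where C: "C\<ge>0" "\<And>n K G x. n \<ge> 2 \<Longrightarrow> bern_class n 0 K G \<Longrightarrow> x \<in> {0..1} \<Longrightarrow> \<bar>bern_err n (G 0) x\<bar> \<le> C * K / sqrt n"
      using bern_err_class_0 by blast
    show ?thesis unfolding 1
      by (intro exI[of _ C] exI[of _ 2] conjI C(1)) (use C in auto)
  next
    case 2
    obtain C where C: "C\<ge>0" "\<And>n K G x. n \<ge> 2 \<Longrightarrow> bern_class n 1 K G \<Longrightarrow> x \<in> {0..1} \<Longrightarrow> \<bar>bern_err n (G 0) x\<bar> \<le> C * K / n"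
      using bern_err_class_1 by blast
    show ?thesis unfolding 2
      by (intro exI[of _ C] exI[of _ 2] conjI C(1)) (use C in auto)
  next
    case (3 q)
    have "q < p" using 3 by simp
    then have "\<exists>C\<ge>0. \<exists>n0. \<forall>n\<ge>n0. \<forall>K G x. bern_class n q K G \<longrightarrow> x \<in> {0..1} \<longrightarrow>
       \<bar>(bern_err n ^^ (q div 2 + 1)) (G 0) x\<bar> \<le> C * K / sqrt n ^ (q + 1)"
      using "1.IH" by blast
    then obtain C n0 where C: "C \<ge> 0" "\<And>n K G x. n \<ge> n0 \<Longrightarrow> bern_class n q K G \<Longrightarrow> x \<in> {0..1} \<Longrightarrow>
       \<bar>(bern_err n ^^ (q div 2 + 1)) (G 0) x\<bar> \<le> C * K / sqrt n ^ (q + 1)"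
      by blast
    obtain D where D: "D \<ge> 0" "\<And>n K G. n \<ge> 2 * (q + 1) \<Longrightarrow> bern_class n (q + 2) K G \<Longrightarrow>
        bern_class n q (D * K / n) (\<lambda>k x. G k x - bern_deriv n (\<lambda>j. G 0 (real j / n)) k x)"
      using bern_class_diff_bern_deriv by blast
    show ?thesis
    proof (intro exI[of _ "C * D"] exI[of _ "max n0 (2 * (q + 1))"] conjI allI impI)
      show "C * D \<ge> 0" using C D by simp
      fix n K G and x :: real assume n: "n \<ge> max n0 (2 * (q + 1))" and G: "bern_class n p K G" and x: "x \<in> {0..1}"
      have n0: "real n > 0" using n by auto
      define H where "H k x = G k x - bern_deriv n (\<lambda>j. G 0 (real j / n)) k x" for k x
      have H: "bern_class n q (D * K / n) H"
        unfolding H_def using D(2)[of n K G] n G 3 by auto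
      have H0: "H 0 = bern_err n (G 0)" by (simp add: H_def bern_err_def fun_eq_iff)
      have e: "p div 2 + 1 = Suc (q div 2 + 1)" using 3 by simp
      have "(bern_err n ^^ (p div 2 + 1)) (G 0) x = (bern_err n ^^ (q div 2 + 1)) (H 0) x"
        unfolding e funpow_Suc_right o_def H0 ..
      also have "\<bar>\<dots>\<bar> \<le> C * (D * K / n) / sqrt n ^ (q + 1)"
        by (rule C(2)[OF _ H x]) (use n in simp)
      also have "\<dots> = C * D * K / (sqrt n ^ 2 * sqrt n ^ (q + 1))" using n0 by simp
      also have "\<dots> = C * D * K / sqrt n ^ (p + 1)" unfolding 3 by (simp add: power_add[symmetric] add.commute)
      finally show "\<bar>(bern_err n ^^ (p div 2 + 1)) (G 0) x\<bar> \<le> C * D * K / sqrt n ^ (p + 1)" .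
    qed
  qed
qed

section \<open>Boundedness and linearity of the error operator\<close>

lemma bern_sum_bound:
  assumes "\<And>k. k \<le> n \<Longrightarrow> \<bar>c k\<bar> \<le> K" "x \<in> {0..1}"
  shows "\<bar>bern_sum n c x\<bar> \<le> K"
proof -
  have B0: "Bernstein n k x \<ge> 0" for k using assms by (auto intro: Bernstein_nonneg)
  have "\<bar>bern_sum n c x\<bar> \<le> (\<Sum>k\<le>n. \<bar>c k * Bernstein n k x\<bar>)"
    unfolding bern_sum_def by (rule sum_abs)
  also have "\<dots> \<le> (\<Sum>k\<le>n. K * Bernstein n k x)"
    using assms B0 by (intro sum_mono) (auto simp: abs_mult intro!: mult_right_mono)
  also have "\<dots> = K" by (simp add: sum_distrib_left[symmetric])
  finally show ?thesis .
qed

lemma bern_err_bound: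
  assumes "n \<ge> 1" "\<And>x. x \<in> {0..1} \<Longrightarrow> \<bar>f x\<bar> \<le> K" "x \<in> {0..1}"
  shows "\<bar>bern_err n f x\<bar> \<le> 2 * K"
proof -
  have "\<bar>bern_sum n (\<lambda>k. f (real k / n)) x\<bar> \<le> K"
    by (rule bern_sum_bound) (use assms in \<open>auto simp: divide_simps\<close>)
  then show ?thesis using assms(2)[OF assms(3)] unfolding bern_err_def by linarith
qed

lemma bern_err_funpow_bound:
  assumes "n \<ge> 1" "\<And>x. x \<in> {0..1} \<Longrightarrow> \<bar>f x\<bar> \<le> K" "x \<in> {0..1}"
  shows "\<bar>(bern_err n ^^ l) f x\<bar> \<le> 2 ^ l * K"
  using assms(3)
proof (induction l arbitrary: x)
  case (Suc l)
  have "\<bar>bern_err n ((bern_err n ^^ l) f) x\<bar> \<le> 2 * (2 ^ l * K)"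
    by (rule bern_err_bound[OF assms(1) Suc.IH Suc.prems])
  then show ?case by simp
qed (use assms in simp)

lemma bern_err_diff: "bern_err n (\<lambda>x. f x - g x) x = bern_err n f x - bern_err n g x"
  unfolding bern_err_def bern_sum_def by (simp add: algebra_simps sum_subtractf)

lemma bern_err_funpow_diff:
  "(bern_err n ^^ l) (\<lambda>x. f x - g x) x = (bern_err n ^^ l) f x - (bern_err n ^^ l) g x"
proof (induction l arbitrary: x)
  case (Suc l)
  have "(bern_err n ^^ l) (\<lambda>x. f x - g x) = (\<lambda>x. (bern_err n ^^ l) f x - (bern_err n ^^ l) g x)"
    using Suc by blast
  then show ?case by (simp add: bern_err_diff)
qed simp

section \<open>Functions that are smooth in the open interval\<close>

lemma sqrt_power_eq_powr:
  assumes "x > 0" shows "sqrt x ^ k = x powr (real k / 2)"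
proof -
  have "x powr (real k / 2) = (x powr (1/2)) powr real k" by (simp add: powr_powr)
  also have "\<dots> = sqrt x powr real k" using assms by (simp add: powr_half_sqrt)
  finally show ?thesis using assms by (simp add: powr_realpow)
qed

text \<open>Half-integer exponents are used because integrating integer ones would produce a logarithm.\<close>

lemma powr_tail_bound:
  fixes D :: "real \<Rightarrow> real"
  assumes c: "c \<ge> 0" and D\<delta>: "D \<delta> = 0"
    and D: "\<And>x y. 0 < x \<Longrightarrow> x \<le> y \<Longrightarrow> y \<le> \<delta> \<Longrightarrow> \<bar>D y - D x\<bar> \<le> (y - x) * (c * x powr - (real q + 1/2))"
    and x: "0 < x" "x \<le> \<delta>"
  shows "\<bar>D x\<bar> \<le> 2 * c * (if q = 0 then \<delta> powr (1/2) else x powr - (real q - 1/2))"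
proof -
  define \<psi> where "\<psi> t = c * t powr - (real q + 1/2)" for t
  define \<Phi> where "\<Phi> t = c * (t powr (1/2 - real q) / (1/2 - real q))" for t
  have h: "1/2 - real q \<noteq> 0"
  proof
    assume "1/2 - real q = 0"
    then have "real (2 * q) = real 1" by simp
    then have "2 * q = 1" by (simp only: of_nat_eq_iff)
    then show False by presburger
  qed
  have "\<bar>D \<delta> - D x\<bar> \<le> \<Phi> \<delta> - \<Phi> x"
  proof (rule increment_le_antiderivative[where \<psi> = \<psi>])
    have nz: "t \<noteq> 0" if "t \<in> {x..\<delta>}" for t using that x by simp
    have "continuous_on {x..\<delta>} (\<lambda>t. t powr - (real q + 1/2))"
      using continuous_on_powr[OF continuous_on_id continuous_on_const] nz by blast
    from continuous_on_mult[OF continuous_on_const[of _ c] this]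
    show "continuous_on {x..\<delta>} \<psi>" unfolding \<psi>_def .
    fix t assume t: "t \<in> {x..\<delta>}"
    have "((\<lambda>t. t powr (1/2 - real q)) has_real_derivative (1/2 - real q) * t powr (1/2 - real q - 1)) (at t within {x..\<delta>})"
      by (rule has_field_derivative_at_within[OF has_real_derivative_powr]) (use t x in auto)
    from DERIV_cmult[OF DERIV_cdivide[OF this, of "1/2 - real q"], of c]
    have "(\<Phi> has_real_derivative c * ((1/2 - real q) * t powr (1/2 - real q - 1) / (1/2 - real q))) (at t within {x..\<delta>})"
      unfolding \<Phi>_def .
    moreover have "(1/2 - real q) * t powr (1/2 - real q - 1) / (1/2 - real q) = t powr (1/2 - real q - 1)"
      using h by (rule nonzero_mult_div_cancel_left)
    moreover have "1/2 - real q - 1 = - (real q + 1/2)" by simp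
    ultimately show "(\<Phi> has_real_derivative \<psi> t) (at t within {x..\<delta>})"
      unfolding \<psi>_def by metis
  next
    fix u v assume uv: "x \<le> u" "u \<le> v" "v \<le> \<delta>"
    then have "\<bar>D v - D u\<bar> \<le> (v - u) * \<psi> u" using D[of u v] x unfolding \<psi>_def by simp
    also have "\<dots> \<le> (v - u) * max (\<psi> u) (\<psi> v)" using uv by (intro mult_left_mono) auto
    finally show "\<bar>D v - D u\<bar> \<le> (v - u) * max (\<psi> u) (\<psi> v)" .
  qed (use x in simp)
  then have b: "\<bar>D x\<bar> \<le> \<Phi> \<delta> - \<Phi> x" using D\<delta> by simp
  show ?thesis
  \<comment> \<open>For q = 0 the exponent 1/2 - q is positive and the value at \<delta> dominates;
    otherwise it is negative and the value at x does.\<close>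
  proof (cases "q = 0")
    case True
    have "\<Phi> \<delta> - \<Phi> x \<le> 2 * c * \<delta> powr (1/2)" unfolding \<Phi>_def True using c by simp
    then show ?thesis using b True by simp
  next
    case False
    have "\<Phi> \<delta> \<le> 0" unfolding \<Phi>_def using False c by (intro mult_nonneg_nonpos divide_nonneg_neg) auto
    moreover have "- \<Phi> x = c * (x powr (1/2 - real q) * (1 / (real q - 1/2)))"
    proof -
      have m: "1/2 - real q = - (real q - 1/2)" by simp
      have "P / (1/2 - real q) = - (P * (1 / (real q - 1/2)))" for P
        unfolding m divide_minus_right by simp
      then show ?thesis unfolding \<Phi>_def by simp
    qed
    moreover have "c * (x powr (1/2 - real q) * (1 / (real q - 1/2))) \<le> c * (x powr (1/2 - real q) * 2)"
    proof (intro mult_left_mono c)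
      have "real q \<ge> 1" using False by simp
      then have "1 \<le> 2 * (real q - 1/2)" by simp
      then show "1 / (real q - 1/2) \<le> 2" using \<open>real q \<ge> 1\<close> by (subst pos_divide_le_eq) auto
    qed simp
    ultimately have "\<Phi> \<delta> - \<Phi> x \<le> 2 * c * x powr (1/2 - real q)" by linarith
    then show ?thesis using b False by simp
  qed
qed

text \<open>All D_k vanish at \<delta>, so integrating from \<delta> towards 0 bounds D_p, D_(p-1),
  ..., D_0 in turn, each time with a factor 2. To fit \<open>powr_tail_bound\<close>, the
  singularity x^(-(p+1)/2) is first replaced by the larger \<delta>^(p/2) x^(-(p+1/2)); each
  integration raises the exponent of x by one, and the last one leaves \<delta>^(1/2).\<close>

lemma endpoint_tail_bound:
  fixes D :: "nat \<Rightarrow> real \<Rightarrow> real"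
  assumes K: "K \<ge> 0" and \<delta>: "\<delta> > 0"
    and deriv: "\<And>k x. k < p \<Longrightarrow> x \<in> {0<..\<delta>} \<Longrightarrow> (D k has_real_derivative D (Suc k) x) (at x within {0<..\<delta>})"
    and zero: "\<And>k. k \<le> p \<Longrightarrow> D k \<delta> = 0"
    and top: "\<And>x y. 0 < x \<Longrightarrow> x \<le> y \<Longrightarrow> y \<le> \<delta> \<Longrightarrow> \<bar>D p y - D p x\<bar> \<le> K * (y - x) / sqrt x ^ (p + 1)"
    and x: "0 < x" "x \<le> \<delta>"
  shows "\<bar>D 0 x\<bar> \<le> 2 ^ (p + 1) * K * sqrt \<delta> ^ (p + 1)"
proof -
  define c where "c = K * \<delta> powr (real p / 2)"
  have c: "c \<ge> 0" unfolding c_def using K by simp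
  have "\<bar>D (p - j) x\<bar> \<le> 2 ^ (j + 1) * c * (if p - j = 0 then \<delta> powr (1/2) else x powr - (real (p - j) - 1/2))"
    if "j \<le> p" "0 < x" "x \<le> \<delta>" for j x
    using that
  proof (induction j arbitrary: x)
    case 0
    have "\<bar>D p x\<bar> \<le> 2 * c * (if p = 0 then \<delta> powr (1/2) else x powr - (real p - 1/2))"
    proof (rule powr_tail_bound[where D = "D p" and \<delta> = \<delta>, OF c zero[OF order_refl] _ 0(2,3)])
      fix x y :: real assume xy: "0 < x" "x \<le> y" "y \<le> \<delta>"
      have "1 / sqrt x ^ (p + 1) = x powr - ((real p + 1) / 2)"
      proof -
        have "sqrt x ^ (p + 1) = x powr ((real p + 1) / 2)"
          using sqrt_power_eq_powr[OF xy(1), of "p + 1"] by (simp add: add.commute)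
        then show ?thesis by (simp add: powr_minus_divide)
      qed
      also have "\<dots> = x powr (real p / 2) * x powr - (real p + 1/2)"
        unfolding powr_add[symmetric] by (rule arg_cong[where f = "(powr) x"]) (simp add: field_simps)
      also have "\<dots> \<le> \<delta> powr (real p / 2) * x powr - (real p + 1/2)"
        using xy by (intro mult_right_mono powr_mono2) auto
      finally have "1 / sqrt x ^ (p + 1) \<le> \<delta> powr (real p / 2) * x powr - (real p + 1/2)" .
      then have "K * (y - x) * (1 / sqrt x ^ (p + 1)) \<le> K * (y - x) * (\<delta> powr (real p / 2) * x powr - (real p + 1/2))"
        using K xy by (intro mult_left_mono) auto
      then show "\<bar>D p y - D p x\<bar> \<le> (y - x) * (c * x powr - (real p + 1/2))"
        using top[OF xy] unfolding c_def by (simp add: mult_ac)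
    qed
    then show ?case by (cases "p = 0") auto
  next
    case (Suc j)
    define q where "q = p - Suc j"
    have q: "p - j = Suc q" "q < p" using Suc.prems unfolding q_def by auto
    have "\<bar>D q x\<bar> \<le> 2 * (2 ^ (j + 1) * c) * (if q = 0 then \<delta> powr (1/2) else x powr - (real q - 1/2))"
    proof (rule powr_tail_bound[where D = "D q" and \<delta> = \<delta>, OF _ zero[OF less_imp_le[OF q(2)]] _ Suc.prems(2,3)])
      show "0 \<le> 2 ^ (j + 1) * c" using c by simp
      fix x y :: real assume xy: "0 < x" "x \<le> y" "y \<le> \<delta>"
      have "\<exists>z\<in>{min x y..max x y}. D q y - D q x = (y - x) * D (Suc q) z"
        by (rule MVT_between[where S = "{0<..\<delta>}"]) (use xy deriv q in auto)
      then obtain z where z: "z \<in> {x..y}" "D q y - D q x = (y - x) * D (Suc q) z" using xy by auto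
      have "\<bar>D (Suc q) z\<bar> \<le> 2 ^ (j + 1) * c * z powr - (real (Suc q) - 1/2)"
        using Suc.IH[of z] Suc.prems z xy q by simp
      also have "\<dots> \<le> 2 ^ (j + 1) * c * x powr - (real q + 1/2)"
      proof (intro mult_left_mono)
        have "z powr - (real q + 1/2) \<le> x powr - (real q + 1/2)"
          using z xy by (intro powr_mono2') auto
        then show "z powr - (real (Suc q) - 1/2) \<le> x powr - (real q + 1/2)"
          by (simp add: algebra_simps)
      qed (use c in simp)
      finally have "\<bar>D (Suc q) z\<bar> \<le> 2 ^ (j + 1) * c * x powr - (real q + 1/2)" .
      then show "\<bar>D q y - D q x\<bar> \<le> (y - x) * (2 ^ (j + 1) * c * x powr - (real q + 1/2))"
        unfolding z(2) abs_mult using xy by (simp add: mult_left_mono)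
    qed
    then show ?case unfolding q_def by (simp add: mult_ac)
  qed
  from this[of p x] x have b: "\<bar>D 0 x\<bar> \<le> 2 ^ (p + 1) * (c * \<delta> powr (1/2))" by (simp add: mult.assoc)
  have e: "c * \<delta> powr (1/2) = K * sqrt \<delta> ^ (p + 1)"
  proof -
    have "\<delta> powr (real p / 2) * \<delta> powr (1/2) = sqrt \<delta> ^ (p + 1)"
      unfolding sqrt_power_eq_powr[OF \<delta>] powr_add[symmetric] by (simp add: add_divide_distrib add.commute)
    then show ?thesis unfolding c_def by simp
  qed
  show ?thesis using b unfolding e by (simp add: mult.assoc)
qed

text \<open>Iterated antiderivatives of $h$; the one of order $j \ge 1$ takes the value $v_j$ at $1/2$.\<close>

primrec antideriv_family :: "(nat \<Rightarrow> real) \<Rightarrow> (real \<Rightarrow> real) \<Rightarrow> nat \<Rightarrow> real \<Rightarrow> real" where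
  "antideriv_family v h 0 = h"
| "antideriv_family v h (Suc j) = (\<lambda>x. v (Suc j) + (integral {0..x} (antideriv_family v h j) - integral {0..1/2} (antideriv_family v h j)))"

lemma antideriv_family_mid: "antideriv_family v h (Suc j) (1/2) = v (Suc j)"
  by simp

lemma antideriv_family_deriv_aux:
  assumes c: "continuous_on {0..1} (antideriv_family v h j)" and x: "x \<in> {0..1}"
  shows "(antideriv_family v h (Suc j) has_real_derivative antideriv_family v h j x) (at x within {0..1})"
proof -
  have "((\<lambda>x. integral {0..x} (antideriv_family v h j)) has_real_derivative antideriv_family v h j x) (at x within {0..1})"
    by (rule integral_has_real_derivative[OF c x])
  from DERIV_add[OF DERIV_const[of "v (Suc j)"] DERIV_diff[OF this DERIV_const[of "integral {0..1/2} (antideriv_family v h j)"]]]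
  show ?thesis by simp
qed

lemma continuous_on_antideriv_family:
  assumes "continuous_on {0..1} h"
  shows "continuous_on {0..1} (antideriv_family v h j)"
proof (induction j)
  case (Suc j)
  show ?case
    by (rule DERIV_continuous_on[where D = "antideriv_family v h j"]) (rule antideriv_family_deriv_aux[OF Suc])
qed (use assms in simp)

lemma antideriv_family_deriv:
  assumes "continuous_on {0..1} h" "x \<in> {0..1}"
  shows "(antideriv_family v h (Suc j) has_real_derivative antideriv_family v h j x) (at x within {0..1})"
  by (rule antideriv_family_deriv_aux[OF continuous_on_antideriv_family[OF assms(1)] assms(2)])

text \<open>The derivatives in the family F may blow up at the endpoints, so G is built to agree
  with F on [\<delta>, 1 - \<delta>], \<delta> = 1/n, and to belong to a class. By
  \<open>endpoint_tail_bound\<close> the difference of F_0 and G_0 already has the required order in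
  the maximum norm, and every application of the error operator at most doubles it.\<close>

theorem bern_err_approx_interior:
  "\<exists>C\<ge>0. \<exists>n0. \<forall>n\<ge>n0. \<forall>K F x. K \<ge> 0 \<longrightarrow>
     (\<forall>k<p. \<forall>t\<in>{0<..<1}. (F k has_real_derivative F (Suc k) t) (at t)) \<longrightarrow>
     continuous_on {0..1} (F 0) \<longrightarrow> (\<forall>t\<in>{0..1}. \<bar>F 0 t\<bar> \<le> K) \<longrightarrow>
     (\<forall>t\<in>{0<..<1}. \<forall>u\<in>{0<..<1}. \<bar>F p t - F p u\<bar> \<le> K * \<bar>t - u\<bar> * max (1 / sqrt (t * (1 - t))) (1 / sqrt (u * (1 - u))) ^ (p + 1)) \<longrightarrow>
     x \<in> {0..1} \<longrightarrow> \<bar>(bern_err n ^^ (p div 2 + 1)) (F 0) x\<bar> \<le> C * K / sqrt n ^ (p + 1)"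
proof -
  obtain C1 n1 where C1: "C1 \<ge> 0" "\<And>n K G x. n \<ge> n1 \<Longrightarrow> bern_class n p K G \<Longrightarrow> x \<in> {0..1} \<Longrightarrow>
     \<bar>(bern_err n ^^ (p div 2 + 1)) (G 0) x\<bar> \<le> C1 * K / sqrt n ^ (p + 1)"
    using bern_class_approx[of p] by blast
  \<comment> \<open>One factor 2^(p+1) is that of \<open>endpoint_tail_bound\<close>, the other
    comes from 1/sqrt(t(1-t)) \<le> 2/sqrt t near 0.\<close>
  define T where "T = (2 ^ (p + 1) * 2 ^ (p + 1) :: real)"
  have T: "T \<ge> 1" unfolding T_def power_add[symmetric] by (rule one_le_power) simp
  define C where "C = C1 * (1 + T) + 2 ^ (p div 2 + 1) * T"
  show ?thesis
  proof (intro exI[of _ C] exI[of _ "max n1 4"] conjI allI impI)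
    show "C \<ge> 0" unfolding C_def using C1(1) T by (intro add_nonneg_nonneg mult_nonneg_nonneg) auto
    fix n K F and x :: real
    assume n: "n \<ge> max n1 4" and K: "K \<ge> 0"
      and deriv: "\<forall>k<p. \<forall>t\<in>{0<..<1}. (F k has_real_derivative F (Suc k) t) (at t)"
      and cont: "continuous_on {0..1} (F 0)" and bd: "\<forall>t\<in>{0..1}. \<bar>F 0 t\<bar> \<le> K"
      and L: "\<forall>t\<in>{0<..<1}. \<forall>u\<in>{0<..<1}. \<bar>F p t - F p u\<bar> \<le> K * \<bar>t - u\<bar> * max (1 / sqrt (t * (1 - t))) (1 / sqrt (u * (1 - u))) ^ (p + 1)"
      and x: "x \<in> {0..1}"
    define \<delta> where "\<delta> = 1 / real n"
    have n0: "real n > 0" "n \<ge> 4" using n by auto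
    have \<delta>: "\<delta> > 0" "\<delta> \<le> 1 / 4" unfolding \<delta>_def using n0 by (auto simp: divide_simps)
    have sn: "sqrt \<delta> ^ (p + 1) = 1 / sqrt n ^ (p + 1)" unfolding \<delta>_def by (simp add: real_sqrt_divide power_divide)
    \<comment> \<open>Projection onto [\<delta>, 1 - \<delta>]; composing F_p with it freezes F_p
      near the endpoints.\<close>
    define cl where "cl t = max \<delta> (min (1 - \<delta>) t)" for t
    have cl01: "cl t \<in> {\<delta>..1 - \<delta>}" for t unfolding cl_def using \<delta> by auto
    have clI: "cl t \<in> {0<..<1}" for t using cl01[of t] \<delta> by auto
    have cl_id: "cl t = t" if "t \<in> {\<delta>..1 - \<delta>}" for t using that unfolding cl_def by auto
    have cl_lip: "\<bar>cl t - cl u\<bar> \<le> \<bar>t - u\<bar>" for t u unfolding cl_def by (auto simp: max_def min_def)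
    define S where "S = bern_root_weight n"
    have S1: "S t \<ge> 1" if "t \<in> {0..1}" for t using bern_root_weight_ge_1[of n t] n0 that unfolding S_def by auto
    \<comment> \<open>The projected point c satisfies c \<ge> (t+\<delta>)/2 and 1 - c \<ge>
      (1-t+\<delta>)/2, because \<delta> \<le> 1/4.\<close>
    have clS: "1 / sqrt (cl t * (1 - cl t)) \<le> 2 * S t" if t: "t \<in> {0..1}" for t
    proof -
      define c where "c = cl t"
      have c: "0 < c" "c < 1" using clI[of t] unfolding c_def by auto
      have "1 / (c * (1 - c)) = 1 / c + 1 / (1 - c)" using c by (simp add: divide_simps)
      also have "1 / c \<le> 2 * (1 / (t + \<delta>))"
        using c t \<delta> unfolding c_def cl_def by (simp add: divide_simps) (auto simp: max_def min_def)
      also have "1 / (1 - c) \<le> 2 * (1 / (1 - t + \<delta>))"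
        using c t \<delta> unfolding c_def cl_def by (simp add: divide_simps) (auto simp: max_def min_def)
      finally have "1 / (c * (1 - c)) \<le> 2 * bern_weight n t" unfolding bern_weight_def \<delta>_def by simp
      also have "\<dots> \<le> 4 * bern_weight n t" using bern_weight_ge_1[of n t] t n0 by simp
      finally have "sqrt (1 / (c * (1 - c))) \<le> sqrt (4 * bern_weight n t)" by simp
      then show ?thesis unfolding S_def bern_root_weight_def c_def[symmetric] by (simp add: real_sqrt_divide real_sqrt_mult)
    qed
    define h where "h = F p \<circ> cl"
    \<comment> \<open>G_k is the antiderivative of order p - k of h, with constants chosen so that
      G_k and F_k agree at 1/2 for k < p. As h = F_p away from the endpoints, this forces G_k = F_k
      there.\<close>
    define G where "G k = antideriv_family (\<lambda>j. F (p - j) (1/2)) h (p - k)" for k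
    have Gp: "G p = h" unfolding G_def by simp
    have Lh: "\<bar>h t - h u\<bar> \<le> 2 ^ (p + 1) * K * \<bar>t - u\<bar> * max (S t) (S u) ^ (p + 1)" if tu: "t \<in> {0..1}" "u \<in> {0..1}" for t u
    proof -
      have "\<bar>h t - h u\<bar> \<le> K * \<bar>cl t - cl u\<bar> * max (1 / sqrt (cl t * (1 - cl t))) (1 / sqrt (cl u * (1 - cl u))) ^ (p + 1)"
        unfolding h_def o_def using L clI by blast
      also have "\<dots> \<le> K * \<bar>t - u\<bar> * (2 * max (S t) (S u)) ^ (p + 1)"
      proof (intro mult_mono power_mono)
        show "max (1 / sqrt (cl t * (1 - cl t))) (1 / sqrt (cl u * (1 - cl u))) \<le> 2 * max (S t) (S u)"
          using clS[OF tu(1)] clS[OF tu(2)] by auto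
        show "0 \<le> max (1 / sqrt (cl t * (1 - cl t))) (1 / sqrt (cl u * (1 - cl u)))"
          using clI[of t] by (auto simp: le_max_iff_disj)
        then show "0 \<le> max (1 / sqrt (cl t * (1 - cl t))) (1 / sqrt (cl u * (1 - cl u))) ^ (p + 1)" by simp
      qed (use K cl_lip in auto)
      finally show ?thesis by (simp only: power_mult_distrib mult_ac)
    qed
    \<comment> \<open>The Lipschitz constant M depends on n, but only continuity is wanted
      here.\<close>
    have hcont: "continuous_on {0..1} h"
    proof -
      define M where "M = 2 ^ (p + 1) * K * (S 0 + S 1) ^ (p + 1)"
      have S01: "S 0 \<ge> 1" "S 1 \<ge> 1" using S1 by auto
      have "S t \<le> S 0 + S 1" if "t \<in> {0..1}" for t
        using bern_root_weight_between[of n 0 1 t] n0 that S01 unfolding S_def by auto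
      then have lip: "\<bar>h t - h u\<bar> \<le> M * \<bar>t - u\<bar>" if "t \<in> {0..1}" "u \<in> {0..1}" for t u
      proof -
        have "max (S t) (S u) ^ (p + 1) \<le> (S 0 + S 1) ^ (p + 1)"
          using \<open>\<And>t. t \<in> {0..1} \<Longrightarrow> S t \<le> S 0 + S 1\<close> S1[OF that(1)] that by (intro power_mono) auto
        then have "2 ^ (p + 1) * K * \<bar>t - u\<bar> * max (S t) (S u) ^ (p + 1) \<le> 2 ^ (p + 1) * K * \<bar>t - u\<bar> * (S 0 + S 1) ^ (p + 1)"
          using K by (intro mult_left_mono) auto
        then show ?thesis using Lh[OF that] unfolding M_def by (simp only: mult_ac) 
      qed
      have M: "M \<ge> 0" unfolding M_def using K S01 by simp
      have "lipschitz_on M {0..1} h"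
        using lip M by (intro lipschitz_onI) (auto simp: dist_real_def)
      then show ?thesis by (rule lipschitz_on_continuous_on)
    qed
    have GD: "(G k has_real_derivative G (Suc k) t) (at t within {0..1})" if "k < p" "t \<in> {0..1}" for k t
    proof -
      have "p - k = Suc (p - Suc k)" using that by simp
      then show ?thesis unfolding G_def using antideriv_family_deriv[OF hcont that(2)] by metis
    qed
    have Gcont: "continuous_on {0..1} (G 0)" unfolding G_def by (rule continuous_on_antideriv_family[OF hcont])
    have GF: "G k t = F k t" if "k \<le> p" "t \<in> {\<delta>..1 - \<delta>}" for k t
      using that
    proof (induction "p - k" arbitrary: k t)
      case 0
      then have "k = p" by simp
      then show ?case using cl_id[OF 0(3)] by (simp add: Gp h_def)
    next
      case (Suc j)
      have k: "k < p" "j = p - Suc k" using Suc.hyps(2) by auto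
      have IH: "G (Suc k) z = F (Suc k) z" if "z \<in> {\<delta>..1 - \<delta>}" for z
        using Suc.hyps(1)[OF k(2)] k that by simp
      have half: "1/2 \<in> {\<delta>..1 - \<delta>}" using \<delta> by auto
      have mid: "G k (1/2) = F k (1/2)"
      proof -
        have "p - k = Suc j" using Suc.hyps(2) by simp
        then show ?thesis unfolding G_def using antideriv_family_mid[of "\<lambda>j. F (p - j) (1/2)" h j] k by (metis diff_diff_cancel less_imp_le)
      qed
      have "\<exists>z\<in>{min (1/2) t..max (1/2) t}. (G k t - F k t) - (G k (1/2) - F k (1/2)) = (t - 1/2) * (G (Suc k) z - F (Suc k) z)"
      proof (rule MVT_between[where S = "{\<delta>..1 - \<delta>}"])
        fix z assume z: "z \<in> {\<delta>..1 - \<delta>}"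
        have "(G k has_real_derivative G (Suc k) z) (at z within {\<delta>..1 - \<delta>})"
          by (rule DERIV_subset[OF GD[OF k(1)]]) (use z \<delta> in auto)
        moreover have "(F k has_real_derivative F (Suc k) z) (at z within {\<delta>..1 - \<delta>})"
          by (rule has_field_derivative_at_within) (use deriv k z \<delta> in auto)
        ultimately show "((\<lambda>t. G k t - F k t) has_real_derivative G (Suc k) z - F (Suc k) z) (at z within {\<delta>..1 - \<delta>})"
          by (rule DERIV_diff)
      qed (use half Suc.prems in auto)
      then obtain z where z: "z \<in> {min (1/2) t..max (1/2) t}" "(G k t - F k t) - (G k (1/2) - F k (1/2)) = (t - 1/2) * (G (Suc k) z - F (Suc k) z)" by blast
      have "z \<in> {\<delta>..1 - \<delta>}" using z(1) half Suc.prems by (auto simp: min_def max_def split: if_splits)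
      then show ?case using IH z(2) mid by simp
    qed
    have inv_sqrt: "1 / sqrt (t * (1 - t)) \<le> 2 / sqrt t" if "0 < t" "t \<le> 1/2" for t
    proof -
      have "sqrt t \<le> sqrt (4 * (t * (1 - t)))" using that by (intro real_sqrt_le_mono) (simp add: algebra_simps)
      then have "sqrt t \<le> 2 * sqrt (t * (1 - t))" by (simp add: real_sqrt_mult)
      then show ?thesis using that by (simp add: divide_simps)
    qed
    have topb: "\<bar>F p u - F p t\<bar> \<le> 2 ^ (p + 1) * K * \<bar>u - t\<bar> / sqrt s ^ (p + 1)"
      if "t \<in> {0<..<1}" "u \<in> {0<..<1}" "1 / sqrt (t * (1 - t)) \<le> 2 / sqrt s" "1 / sqrt (u * (1 - u)) \<le> 2 / sqrt s" for t u s
    proof -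
      have "\<bar>F p u - F p t\<bar> \<le> K * \<bar>u - t\<bar> * max (1 / sqrt (u * (1 - u))) (1 / sqrt (t * (1 - t))) ^ (p + 1)"
        using L that by blast
      also have "\<dots> \<le> K * \<bar>u - t\<bar> * (2 / sqrt s) ^ (p + 1)"
        using K that by (intro mult_left_mono power_mono) (auto simp: le_max_iff_disj)
      finally show ?thesis by (simp add: power_divide mult_ac)
    qed
    have near: "\<bar>F 0 t - G 0 t\<bar> \<le> T * K / sqrt n ^ (p + 1)" if t: "t \<in> {0<..<1}" for t
    proof -
      consider "t \<in> {\<delta>..1 - \<delta>}" | "t < \<delta>" | "1 - t < \<delta>" using t by force
      then show ?thesis
      proof cases
        case 1
        then show ?thesis using GF[of 0 t] T K by simp
      next
        case 2
        have hc: "h s = h \<delta>" if "s \<in> {0<..\<delta>}" for s using that \<delta> unfolding h_def cl_def by auto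
        have "\<bar>F 0 t - G 0 t\<bar> \<le> 2 ^ (p + 1) * (2 ^ (p + 1) * K) * sqrt \<delta> ^ (p + 1)"
        proof (rule endpoint_tail_bound[where D = "\<lambda>k t. F k t - G k t" and \<delta> = \<delta>])
          fix k s assume k: "k < p" and s: "s \<in> {0<..\<delta>}"
          have "(G k has_real_derivative G (Suc k) s) (at s within {0<..\<delta>})"
            by (rule DERIV_subset[OF GD[OF k]]) (use s \<delta> in auto)
          moreover have "(F k has_real_derivative F (Suc k) s) (at s within {0<..\<delta>})"
            by (rule has_field_derivative_at_within) (use deriv k s \<delta> in auto)
          ultimately show "((\<lambda>t. F k t - G k t) has_real_derivative F (Suc k) s - G (Suc k) s) (at s within {0<..\<delta>})"
            by (intro DERIV_diff)
        next
          fix s u assume su: "0 < s" "s \<le> u" "u \<le> \<delta>"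
          have "1 / sqrt (u * (1 - u)) \<le> 2 / sqrt u" using inv_sqrt[of u] su \<delta> by simp
          also have "\<dots> \<le> 2 / sqrt s" using su by (intro divide_left_mono) auto
          finally have "\<bar>F p u - F p s\<bar> \<le> 2 ^ (p + 1) * K * \<bar>u - s\<bar> / sqrt s ^ (p + 1)"
            using inv_sqrt[of s] su \<delta> by (intro topb) auto
          then show "\<bar>F p u - G p u - (F p s - G p s)\<bar> \<le> 2 ^ (p + 1) * K * (u - s) / sqrt s ^ (p + 1)"
            using su hc[of u] hc[of s] unfolding Gp by simp
        qed (use K \<delta> 2 t GF in auto)
        then show ?thesis unfolding sn T_def by (simp add: mult_ac)
      next
        case 3
        \<comment> \<open>Reflection at 1/2; the sign makes D_(k+1) the derivative of D_k.\<close>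
        define D where "D k s = (- 1) ^ k * (F k (1 - s) - G k (1 - s))" for k s
        have hc: "h (1 - s) = h (1 - \<delta>)" if "s \<in> {0<..\<delta>}" for s using that \<delta> unfolding h_def cl_def by auto
        have "\<bar>D 0 (1 - t)\<bar> \<le> 2 ^ (p + 1) * (2 ^ (p + 1) * K) * sqrt \<delta> ^ (p + 1)"
        proof (rule endpoint_tail_bound[where D = D and \<delta> = \<delta>])
          fix k s assume k: "k < p" and s: "s \<in> {0<..\<delta>}"
          have G1: "(G k has_real_derivative G (Suc k) (1 - s)) (at (1 - s) within (\<lambda>s. 1 - s) ` {0<..\<delta>})"
            by (rule DERIV_subset[OF GD[OF k]]) (use s \<delta> in auto)
          have F1: "(F k has_real_derivative F (Suc k) (1 - s)) (at (1 - s) within (\<lambda>s. 1 - s) ` {0<..\<delta>})"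
            by (rule has_field_derivative_at_within) (use deriv k s \<delta> in auto)
          have "((\<lambda>s. 1 - s) has_real_derivative - 1) (at s within {0<..\<delta>})" by (auto intro!: derivative_eq_intros)
          from DERIV_image_chain[OF DERIV_diff[OF F1 G1] this]
          have "((\<lambda>s. F k (1 - s) - G k (1 - s)) has_real_derivative (F (Suc k) (1 - s) - G (Suc k) (1 - s)) * (- 1)) (at s within {0<..\<delta>})"
            by (simp add: o_def)
          note d = DERIV_cmult[OF this, of "(- 1) ^ k"]
          have e1: "D (Suc k) s = (- 1) ^ k * ((F (Suc k) (1 - s) - G (Suc k) (1 - s)) * (- 1))" by (simp add: D_def algebra_simps)
          have e2: "D k = (\<lambda>s. (- 1) ^ k * (F k (1 - s) - G k (1 - s)))" by (simp add: D_def fun_eq_iff)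
          show "(D k has_real_derivative D (Suc k) s) (at s within {0<..\<delta>})"
            unfolding e1 e2 by (rule d)
        next
          fix s u assume su: "0 < s" "s \<le> u" "u \<le> \<delta>"
          have "1 / sqrt ((1 - u) * (1 - (1 - u))) \<le> 2 / sqrt u" using inv_sqrt[of u] su \<delta> by (simp add: mult.commute)
          also have "\<dots> \<le> 2 / sqrt s" using su by (intro divide_left_mono) auto
          finally have "\<bar>F p (1 - u) - F p (1 - s)\<bar> \<le> 2 ^ (p + 1) * K * \<bar>(1 - u) - (1 - s)\<bar> / sqrt s ^ (p + 1)"
            using inv_sqrt[of s] su \<delta> by (intro topb) (auto simp: mult.commute)
          moreover have "D p u - D p s = (- 1) ^ p * (F p (1 - u) - F p (1 - s))"
            using su hc[of u] hc[of s] unfolding D_def Gp by (simp add: algebra_simps)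
          ultimately show "\<bar>D p u - D p s\<bar> \<le> 2 ^ (p + 1) * K * (u - s) / sqrt s ^ (p + 1)"
            using su by (simp add: abs_mult power_abs)
        qed (use K \<delta> 3 t GF in \<open>auto simp: D_def\<close>)
        then show ?thesis unfolding sn T_def D_def by (simp add: mult_ac)
      qed
    qed
    \<comment> \<open>Continuity carries the estimate to the endpoints, where no derivatives of F
      are assumed.\<close>
    have close: "\<bar>F 0 t - G 0 t\<bar> \<le> T * K / sqrt n ^ (p + 1)" if t: "t \<in> {0..1}" for t
    proof -
      have cl: "closure {0<..<1::real} = {0..1}" by simp
      have "norm (F 0 t - G 0 t) \<le> T * K / sqrt n ^ (p + 1)"
      proof (rule continuous_on_closure_norm_le[where f = "\<lambda>t. F 0 t - G 0 t"])
        show "continuous_on (closure {0<..<1}) (\<lambda>t. F 0 t - G 0 t)"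
          unfolding cl by (intro continuous_on_diff cont Gcont)
        show "\<forall>t\<in>{0<..<1}. norm (F 0 t - G 0 t) \<le> T * K / sqrt n ^ (p + 1)" using near by simp
      qed (use t in \<open>simp add: cl\<close>)
      then show ?thesis by simp
    qed
    have sq1: "sqrt n ^ (p + 1) \<ge> 1" using n0 by (intro one_le_power) simp
    have "bern_class n p ((1 + T) * K) G"
      unfolding bern_class_def
    proof (intro conjI ballI allI impI)
      fix t :: real assume t: "t \<in> {0..1}"
      have "T * K / sqrt n ^ (p + 1) \<le> T * K / 1" using T K sq1 by (intro divide_left_mono) auto
      moreover have "\<bar>F 0 t\<bar> \<le> K" using bd t by blast
      ultimately have "\<bar>G 0 t\<bar> \<le> K + T * K" using close[OF t] by simp
      then show "\<bar>G 0 t\<bar> \<le> (1 + T) * K" by (simp add: distrib_right)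
    next
      fix t u :: real assume tu: "t \<in> {0..1}" "u \<in> {0..1}"
      have "2 ^ (p + 1) * 1 \<le> T" unfolding T_def by (intro mult_left_mono one_le_power) auto
      then have "2 ^ (p + 1) \<le> 1 + T" by simp
      then have "2 ^ (p + 1) * K * \<bar>t - u\<bar> * max (S t) (S u) ^ (p + 1) \<le> (1 + T) * K * \<bar>t - u\<bar> * max (S t) (S u) ^ (p + 1)"
        using S1[OF tu(1)] K by (intro mult_right_mono) auto
      then show "\<bar>G p t - G p u\<bar> \<le> (1 + T) * K * \<bar>t - u\<bar> * max (bern_root_weight n t) (bern_root_weight n u) ^ (p + 1)"
        using Lh[OF tu] unfolding Gp S_def by linarith
    qed (use GD in auto)
    then have 1: "\<bar>(bern_err n ^^ (p div 2 + 1)) (G 0) x\<bar> \<le> C1 * ((1 + T) * K) / sqrt n ^ (p + 1)"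
      using n x by (intro C1(2)) auto
    have "\<bar>(bern_err n ^^ (p div 2 + 1)) (\<lambda>t. F 0 t - G 0 t) x\<bar> \<le> 2 ^ (p div 2 + 1) * (T * K / sqrt n ^ (p + 1))"
      by (rule bern_err_funpow_bound[OF _ close x]) (use n0 in auto)
    then have "\<bar>(bern_err n ^^ (p div 2 + 1)) (F 0) x\<bar> \<le> C1 * ((1 + T) * K) / sqrt n ^ (p + 1) + 2 ^ (p div 2 + 1) * (T * K / sqrt n ^ (p + 1))"
      using 1 unfolding bern_err_funpow_diff by linarith
    also have "\<dots> = C * K / sqrt n ^ (p + 1)"
      unfolding C_def by (simp only: add_divide_distrib[symmetric] times_divide_eq_right) (simp add: algebra_simps)
    finally show "\<bar>(bern_err n ^^ (p div 2 + 1)) (F 0) x\<bar> \<le> C * K / sqrt n ^ (p + 1)" .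
  qed
qed

section \<open>Absolutely continuous functions\<close>

lemma finite_subcover_measure:
  fixes A :: "'i \<Rightarrow> real set"
  assumes "countable C" "\<And>i. i \<in> C \<Longrightarrow> A i \<in> sets lebesgue" "E \<in> lmeasurable"
    and "negligible (E - (\<Union>i\<in>C. A i))" "\<tau> > 0"
  shows "\<exists>F\<subseteq>C. finite F \<and> measure lebesgue (E - (\<Union>i\<in>F. A i)) < \<tau>"
proof (cases "C = {}")
  case True
  then show ?thesis using assms negligible_imp_measure0[OF assms(4)] by (intro exI[of _ "{}"]) auto
next
  case False
  define f where "f = from_nat_into C"
  have f: "range f = C" unfolding f_def using False assms(1) by (rule range_from_nat_into)
  define B where "B n = E - (\<Union>i\<in>f ` {..n}. A i)" for n :: nat
  have B: "B n \<in> lmeasurable" for n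
    unfolding B_def using assms f by (intro fmeasurable_Diff sets.finite_UN) auto
  have "(\<lambda>n. measure lebesgue (B n)) \<longlonglongrightarrow> measure lebesgue (\<Inter>n. B n)"
  proof (rule Lim_measure_decseq)
    show "decseq B" unfolding B_def decseq_def by (fastforce)
    show "emeasure lebesgue (B i) \<noteq> \<infinity>" for i using B[of i] by (auto simp: fmeasurable_def)
  qed (use B in auto)
  also have "(\<Inter>n. B n) = E - (\<Union>i\<in>C. A i)"
    unfolding B_def f[symmetric] by auto
  also have "measure lebesgue (E - (\<Union>i\<in>C. A i)) = 0" using assms(4) by (rule negligible_imp_measure0)
  finally have "\<forall>\<^sub>F n in sequentially. measure lebesgue (B n) < \<tau>"
    using assms(5) by (auto elim: order_tendstoD)
  then obtain n where "measure lebesgue (B n) < \<tau>" by (meson eventually_happens sequentially_bot)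
  then show ?thesis unfolding B_def using f by (intro exI[of _ "f ` {..n}"]) auto
qed

text \<open>Vitali's theorem, with closed intervals written as balls around their midpoints, covers
  E up to a null set by countably many disjoint ones. Their endpoints form a countable set and may
  be left out, and finitely many of the intervals already cover E up to measure \<tau>.\<close>

lemma vitali_finite_intervals:
  fixes E U :: "real set"
  assumes E: "E \<in> lmeasurable" and U: "open U" "E \<subseteq> U" and "\<tau> > 0"
    and P: "\<And>x \<eta>. x \<in> E \<Longrightarrow> \<eta> > 0 \<Longrightarrow> \<exists>u v. u < x \<and> x < v \<and> v - u < \<eta> \<and> P u v"
  shows "\<exists>F. finite F \<and> (\<forall>(u, v)\<in>F. u < v \<and> {u..v} \<subseteq> U \<and> P u v) \<and> disjoint_family_on (\<lambda>(u, v). {u..v}) F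
     \<and> measure lebesgue (E - (\<Union>(u, v)\<in>F. {u<..<v})) < \<tau>"
proof -
  define K where "K = {(u, v). u < v \<and> {u..v} \<subseteq> U \<and> P u v}"
  define a r where "a i = (fst i + snd i) / 2" and "r i = (snd i - fst i) / 2" for i :: "real \<times> real"
  have cb: "cball (a i) (r i) = {fst i..snd i}" for i
    unfolding a_def r_def cball_eq_atLeastAtMost by (simp add: field_simps)
  obtain C where C: "countable C" "C \<subseteq> K" "pairwise (\<lambda>i j. disjnt (cball (a i) (r i)) (cball (a j) (r j))) C"
    "negligible (E - (\<Union>i\<in>C. cball (a i) (r i)))"
  proof (rule Vitali_covering_theorem_cballs[of K r E a])
    show "0 < r i" if "i \<in> K" for i using that by (auto simp: K_def r_def)
    fix x d :: real assume x: "x \<in> E" and d: "d > 0"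
    obtain e where e: "e > 0" "ball x e \<subseteq> U" using U x open_contains_ball by blast
    obtain u v where uv: "u < x" "x < v" "v - u < min d e" "P u v" using P[OF x, of "min d e"] d e by auto
    have "{u..v} \<subseteq> ball x e" using uv by (auto simp: dist_real_def)
    then have "(u, v) \<in> K" using uv e by (auto simp: K_def)
    then show "\<exists>i. i \<in> K \<and> x \<in> cball (a i) (r i) \<and> r i < d"
      using uv unfolding cb by (intro exI[of _ "(u, v)"]) (auto simp: r_def)
  qed
  have neg: "negligible (E - (\<Union>i\<in>C. {fst i<..<snd i}))"
  proof (rule negligible_subset)
    show "negligible ((E - (\<Union>i\<in>C. cball (a i) (r i))) \<union> (\<Union>i\<in>C. {fst i, snd i}))"
      using C by (intro negligible_Un negligible_countable_Union) auto
    show "E - (\<Union>i\<in>C. {fst i<..<snd i}) \<subseteq> (E - (\<Union>i\<in>C. cball (a i) (r i))) \<union> (\<Union>i\<in>C. {fst i, snd i})"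
      unfolding cb by force
  qed
  obtain F where F: "F \<subseteq> C" "finite F" "measure lebesgue (E - (\<Union>i\<in>F. {fst i<..<snd i})) < \<tau>"
    using finite_subcover_measure[OF C(1) _ E neg \<open>\<tau> > 0\<close>] by auto
  show ?thesis
  proof (intro exI[of _ F] conjI F)
    show "\<forall>(u, v)\<in>F. u < v \<and> {u..v} \<subseteq> U \<and> P u v" using F C unfolding K_def by auto
    show "disjoint_family_on (\<lambda>(u, v). {u..v}) F"
      unfolding disjoint_family_on_def case_prod_beta
    proof (intro ballI impI)
      fix i j assume "i \<in> F" "j \<in> F" "i \<noteq> j"
      then have "disjnt (cball (a i) (r i)) (cball (a j) (r j))" using F(1) C(3) by (meson pairwiseD subsetD)
      then show "{fst i..snd i} \<inter> {fst j..snd j} = {}" unfolding cb disjnt_def .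
    qed
    show "measure lebesgue (E - (\<Union>(u, v)\<in>F. {u<..<v})) < \<tau>" using F(3) by (simp add: case_prod_beta)
  qed
qed

lemma measure_le_sum_intervals:
  fixes E :: "real set"
  assumes E: "E \<in> lmeasurable" and F: "finite F"
  shows "measure lebesgue E \<le> measure lebesgue (E - (\<Union>(u, v)\<in>F. {u<..<v})) + (\<Sum>(u, v)\<in>F. measure lebesgue (E \<inter> {u<..<v}))"
proof -
  let ?U = "\<Union>(u, v)\<in>F. {u<..<v}"
  have U: "?U \<in> sets lebesgue" unfolding case_prod_beta using F by (intro sets.finite_UN sets_completionI_sets) (auto intro!: borel_open)
  have "E = (E - ?U) \<union> (\<Union>i\<in>F. E \<inter> {fst i<..<snd i})" by (auto simp: case_prod_beta)
  then have "measure lebesgue E = measure lebesgue ((E - ?U) \<union> (\<Union>i\<in>F. E \<inter> {fst i<..<snd i}))" by simp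
  also have "\<dots> \<le> measure lebesgue (E - ?U) + measure lebesgue (\<Union>i\<in>F. E \<inter> {fst i<..<snd i})"
    using E U F by (intro measure_Un_le sets.finite_UN) auto
  also have "measure lebesgue (\<Union>i\<in>F. E \<inter> {fst i<..<snd i}) \<le> (\<Sum>i\<in>F. measure lebesgue (E \<inter> {fst i<..<snd i}))"
    using E F by (intro measure_UNION_le) auto
  finally show ?thesis by (simp add: case_prod_beta)
qed

lemma measure_Int_interval_le:
  fixes E :: "real set"
  assumes "E \<in> lmeasurable" "u \<le> v"
  shows "measure lebesgue (E \<inter> {u<..<v}) \<le> v - (u::real)"
proof -
  have "measure lebesgue (E \<inter> {u<..<v}) \<le> measure lebesgue {u<..<v}"
    using assms by (intro measure_mono_fmeasurable) auto
  then show ?thesis using assms by simp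
qed

text \<open>G consists of the gaps that F leaves in [c, d]. Stating the telescoping identity for
  every h allows it to be used for lengths, with h the identity, and for increments of a given
  function. The induction removes the rightmost interval.\<close>

lemma interval_gaps:
  fixes c d :: real
  assumes "finite F" "\<And>u v. (u, v) \<in> F \<Longrightarrow> c \<le> u \<and> u < v \<and> v \<le> d" "disjoint_family_on (\<lambda>(u, v). {u..v}) F" "c \<le> d"
  shows "\<exists>G. finite G \<and> (\<forall>(u, v)\<in>G. c \<le> u \<and> u < v \<and> v \<le> d) \<and> disjoint_family_on (\<lambda>(u, v). {u<..<v}) G
    \<and> (\<forall>h :: real \<Rightarrow> real. h d - h c = (\<Sum>(u, v)\<in>F. h v - h u) + (\<Sum>(u, v)\<in>G. h v - h u))"
  using assms
proof (induction "card F" arbitrary: F d)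
  case 0
  then have F: "F = {}" by simp
  show ?case
  proof (cases "c = d")
    case True then show ?thesis using F by (intro exI[of _ "{}"]) (auto simp: disjoint_family_on_def)
  next
    case False then show ?thesis using F "0.prems" by (intro exI[of _ "{(c, d)}"]) (auto simp: disjoint_family_on_def)
  qed
next
  case (Suc k)
  have Fne: "F \<noteq> {}" using Suc.hyps(2) by auto
  obtain i where i: "i \<in> F" "\<And>j. j \<in> F \<Longrightarrow> snd j \<le> snd i"
    using Max_in[of "snd ` F"] Max_ge[of "snd ` F"] Suc.prems(1) Fne by (metis (no_types, lifting) finite_imageI imageE imageI image_is_empty)
  obtain u v where uv: "i = (u, v)" by (cases i)
  have uvF: "(u, v) \<in> F" "c \<le> u" "u < v" "v \<le> d" using i Suc.prems uv by auto
  have less: "v' < u" if "(u', v') \<in> F - {(u, v)}" for u' v'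
  proof -
    have "{u'..v'} \<inter> {u..v} = {}"
      using Suc.prems(3) that uvF unfolding disjoint_family_on_def by fastforce
    moreover have "u' < v'" "v' \<le> v" using Suc.prems(2) that i(2)[of "(u', v')"] uv by auto
    ultimately show ?thesis using uvF by (metis Int_iff atLeastAtMost_iff empty_iff less_imp_le not_le order_refl)
  qed
  have "\<exists>G. finite G \<and> (\<forall>(u', v')\<in>G. c \<le> u' \<and> u' < v' \<and> v' \<le> u) \<and> disjoint_family_on (\<lambda>(u, v). {u<..<v}) G
    \<and> (\<forall>h :: real \<Rightarrow> real. h u - h c = (\<Sum>(u, v)\<in>F - {(u, v)}. h v - h u) + (\<Sum>(u, v)\<in>G. h v - h u))"
  proof (rule Suc.hyps(1))
    show "k = card (F - {(u, v)})" using Suc.hyps(2) Suc.prems(1) uvF by simp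
    show "disjoint_family_on (\<lambda>(u, v). {u..v}) (F - {(u, v)})" using Suc.prems(3) by (auto simp: disjoint_family_on_def)
    show "c \<le> u' \<and> u' < v' \<and> v' \<le> u" if "(u', v') \<in> F - {(u, v)}" for u' v'
      using less[OF that] Suc.prems(2) that by force
  qed (use Suc.prems uvF in auto)
  then obtain G where G: "finite G" "\<forall>(u', v')\<in>G. c \<le> u' \<and> u' < v' \<and> v' \<le> u" "disjoint_family_on (\<lambda>(u, v). {u<..<v}) G"
    "\<And>h :: real \<Rightarrow> real. h u - h c = (\<Sum>(u, v)\<in>F - {(u, v)}. h v - h u) + (\<Sum>(u, v)\<in>G. h v - h u)" by blast
  have FF: "(\<Sum>(u, v)\<in>F. h v - h u) = (h v - h u) + (\<Sum>(u, v)\<in>F - {(u, v)}. h v - h u)" for h :: "real \<Rightarrow> real"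
    using sum.remove[OF Suc.prems(1) uvF(1), of "\<lambda>(u, v). h v - h u"] by simp
  show ?case
  proof (cases "v = d")
    case True
    show ?thesis
    proof (intro exI[of _ G] conjI G(1,3) allI)
      show "\<forall>(u, v)\<in>G. c \<le> u \<and> u < v \<and> v \<le> d" using G(2) uvF by fastforce
      fix h :: "real \<Rightarrow> real"
      show "h d - h c = (\<Sum>(u, v)\<in>F. h v - h u) + (\<Sum>(u, v)\<in>G. h v - h u)" using G(4)[of h] FF[of h] True by simp
    qed
  next
    case False
    have nin: "(v, d) \<notin> G" using G(2) uvF by fastforce
    show ?thesis
    proof (intro exI[of _ "insert (v, d) G"] conjI allI)
      show "\<forall>(u, v)\<in>insert (v, d) G. c \<le> u \<and> u < v \<and> v \<le> d" using G(2) uvF False by fastforce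
      show "disjoint_family_on (\<lambda>(u, v). {u<..<v}) (insert (v, d) G)"
        using G(2,3) uvF unfolding disjoint_family_on_def by fastforce
      fix h :: "real \<Rightarrow> real"
      show "h d - h c = (\<Sum>(u, v)\<in>F. h v - h u) + (\<Sum>(u, v)\<in>insert (v, d) G. h v - h u)"
        using G(1) nin G(4)[of h] FF[of h] by simp
    qed (use G in simp)
  qed
qed

section \<open>Points with steep chords at every scale\<close>

definition steep_points :: "(real \<Rightarrow> real) \<Rightarrow> real \<Rightarrow> real \<Rightarrow> real \<Rightarrow> real set" where
  "steep_points g c d q = {x. \<forall>\<eta>>0. \<exists>u v. c \<le> u \<and> u < x \<and> x < v \<and> v \<le> d \<and> v - u < \<eta> \<and> g v - g u > q * (v - u)}"

lemma steep_points_subset: "steep_points g c d q \<subseteq> {c<..<d}"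
  unfolding steep_points_def by (auto dest: spec[of _ 1])

text \<open>The intervals in the definition straddle the point strictly, so the set is a countable
  intersection of unions of open intervals, whatever g is.\<close>

lemma steep_points_measurable: "steep_points g c d q \<in> lmeasurable"
proof -
  define T where "T n = {(u, v). c \<le> u \<and> v \<le> d \<and> v - u < 1 / real (Suc n) \<and> g v - g u > q * (v - u)}" for n
  have "steep_points g c d q = (\<Inter>n. \<Union>(u, v)\<in>T n. {u<..<v})"
  proof (intro equalityI subsetI)
    fix x assume "x \<in> steep_points g c d q"
    then have x: "\<And>\<eta>. \<eta> > 0 \<Longrightarrow> \<exists>u v. c \<le> u \<and> u < x \<and> x < v \<and> v \<le> d \<and> v - u < \<eta> \<and> g v - g u > q * (v - u)"
      unfolding steep_points_def by blast
    show "x \<in> (\<Inter>n. \<Union>(u, v)\<in>T n. {u<..<v})"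
    proof (intro INT_I)
      fix n
      obtain u v where "c \<le> u" "u < x" "x < v" "v \<le> d" "v - u < 1 / real (Suc n)" "g v - g u > q * (v - u)"
        using x[of "1 / real (Suc n)"] by auto
      then show "x \<in> (\<Union>(u, v)\<in>T n. {u<..<v})" unfolding T_def by (intro UN_I[of "(u, v)"]) auto
    qed
  next
    fix x assume x: "x \<in> (\<Inter>n. \<Union>(u, v)\<in>T n. {u<..<v})"
    show "x \<in> steep_points g c d q" unfolding steep_points_def
    proof (intro CollectI allI impI)
      fix \<eta> :: real assume "\<eta> > 0"
      then obtain n where n: "1 / real (Suc n) < \<eta>" using nat_approx_posE by blast
      from x have "x \<in> (\<Union>(u, v)\<in>T n. {u<..<v})" by blast
      then obtain u v where "(u, v) \<in> T n" "u < x" "x < v" by auto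
      then show "\<exists>u v. c \<le> u \<and> u < x \<and> x < v \<and> v \<le> d \<and> v - u < \<eta> \<and> g v - g u > q * (v - u)"
        using n unfolding T_def by (intro exI[of _ u] exI[of _ v]) auto
    qed
  qed
  moreover have "(\<Union>(u, v)\<in>T n. {u<..<v}) \<in> sets borel" for n
    by (intro borel_open open_UN) auto
  ultimately have "steep_points g c d q \<in> sets borel" by auto
  then have "steep_points g c d q \<in> sets lebesgue" by auto
  moreover have "bounded (steep_points g c d q)"
    using steep_points_subset[of g c d q] by (metis bounded_box box_real(1) bounded_subset)
  ultimately show ?thesis by (intro bounded_set_imp_lmeasurable)
qed

text \<open>Comparing total increments requires only the absolute value of the sum, not the sum of
  absolute values.\<close>

lemma abs_cont_onD:
  assumes "abs_cont_on c d g" "\<epsilon> > 0"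
  obtains \<delta> where "\<delta> > 0" "\<And>S. finite S \<Longrightarrow> \<forall>(u, v)\<in>S. c \<le> u \<and> u < v \<and> v \<le> d \<Longrightarrow> disjoint_family_on (\<lambda>(u, v). {u<..<v}) S \<Longrightarrow>
     (\<Sum>(u, v)\<in>S. v - u) < \<delta> \<Longrightarrow> \<bar>\<Sum>(u, v)\<in>S. g v - g u\<bar> < \<epsilon>"
proof -
  obtain \<delta> where d: "\<delta> > 0" "\<And>S. finite S \<and> (\<forall>(u, v)\<in>S. c \<le> u \<and> u < v \<and> v \<le> d) \<and> disjoint_family_on (\<lambda>(u, v). {u<..<v}) S \<and>
     (\<Sum>(u, v)\<in>S. v - u) < \<delta> \<Longrightarrow> (\<Sum>(u, v)\<in>S. \<bar>g v - g u\<bar>) < \<epsilon>"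
    using assms unfolding abs_cont_on_def by meson
  show thesis
  proof (rule that[OF d(1)])
    fix S assume "finite S" "\<forall>(u, v)\<in>S. c \<le> u \<and> u < v \<and> v \<le> d" "disjoint_family_on (\<lambda>(u, v). {u<..<v}) S" "(\<Sum>(u, v)\<in>S. v - u) < \<delta>"
    then have "(\<Sum>(u, v)\<in>S. \<bar>g v - g u\<bar>) < \<epsilon>" using d(2) by blast
    moreover have "\<bar>\<Sum>(u, v)\<in>S. g v - g u\<bar> \<le> (\<Sum>(u, v)\<in>S. \<bar>g v - g u\<bar>)"
      using sum_abs[of "\<lambda>(u, v). g v - g u" S] by (simp add: case_prod_beta)
    ultimately show "\<bar>\<Sum>(u, v)\<in>S. g v - g u\<bar> < \<epsilon>" by linarith
  qed
qed

text \<open>Around the points of E there are, at every scale, chords of slope below p (steep for -g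
  and -p) and chords of slope above q. F covers most of E by intervals of slope below p whose total
  length hardly exceeds the measure \<mu> of E. Inside each of them, \<open>H i\<close> covers most
  of E again, now with slope above q. The gaps S between the two families are short and by absolute
  continuity carry an increment below \<epsilon>. Comparing increments gives q \<mu> \<le> p \<mu>
  up to small errors.\<close>

lemma steep_both_ways_negligible:
  assumes ac: "abs_cont_on c d g" and pq: "p < q"
  shows "negligible (steep_points (\<lambda>x. - g x) c d (- p) \<inter> steep_points g c d q)"
proof -
  define E where "E = steep_points (\<lambda>x. - g x) c d (- p) \<inter> steep_points g c d q"
  have E: "E \<in> lmeasurable" unfolding E_def using steep_points_measurable by (intro fmeasurable_Int_fmeasurable) (auto simp: fmeasurableD)
  have Ecd: "E \<subseteq> {c<..<d}" unfolding E_def using steep_points_subset by blast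
  have E1: "\<exists>u v. u < x \<and> x < v \<and> v - u < \<eta> \<and> g v - g u < p * (v - u)" if xE: "x \<in> E" "\<eta> > 0" for x \<eta>
  proof -
    obtain u v where "u < x" "x < v" "v - u < \<eta>" "- g v - - g u > - p * (v - u)"
      using xE unfolding E_def steep_points_def by blast
    then show ?thesis by (intro exI[of _ u] exI[of _ v]) auto
  qed
  have E2: "\<exists>u v. u < x \<and> x < v \<and> v - u < \<eta> \<and> g v - g u > q * (v - u)" if "x \<in> E" "\<eta> > 0" for x \<eta>
    using that unfolding E_def steep_points_def by blast
  have "measure lebesgue E = 0"
  proof (rule ccontr)
    assume "measure lebesgue E \<noteq> 0"
    then have \<mu>: "measure lebesgue E > 0" using zero_less_measure_iff by blast
    define \<mu> where "\<mu> = measure lebesgue E"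
    define \<epsilon> where "\<epsilon> = (q - p) * \<mu> / 4"
    have \<epsilon>: "\<epsilon> > 0" unfolding \<epsilon>_def \<mu>_def using \<mu> pq by simp
    obtain \<delta> where \<delta>: "\<delta> > 0" "\<And>S. finite S \<Longrightarrow> \<forall>(u, v)\<in>S. c \<le> u \<and> u < v \<and> v \<le> d \<Longrightarrow> disjoint_family_on (\<lambda>(u, v). {u<..<v}) S \<Longrightarrow>
     (\<Sum>(u, v)\<in>S. v - u) < \<delta> \<Longrightarrow> \<bar>\<Sum>(u, v)\<in>S. g v - g u\<bar> < \<epsilon>"
      using abs_cont_onD[OF ac \<epsilon>] by blast
    \<comment> \<open>The first entry gives 3 \<tau> < \<delta>, where 3 \<tau> bounds the total
      length of the gaps; the second bounds the errors (|p| + 2|q|) \<tau> by (q-p) \<mu> /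
      4.\<close>
    define \<tau> where "\<tau> = min (\<delta> / 4) ((q - p) * \<mu> / (8 * (\<bar>p\<bar> + \<bar>q\<bar> + 1)))"
    have \<tau>: "\<tau> > 0" unfolding \<tau>_def \<mu>_def using \<mu> pq \<delta>(1) by (auto intro!: divide_pos_pos add_nonneg_pos)
    \<comment> \<open>Outer regularity: the intervals of F stay in an open set that exceeds E by
      less than \<tau>, which bounds their total length from above.\<close>
    obtain T where T: "open T" "E \<subseteq> T" "T - E \<in> lmeasurable" "emeasure lebesgue (T - E) < ennreal \<tau>"
      using sets_lebesgue_outer_open[OF fmeasurableD[OF E] \<tau>] .
    define U where "U = T \<inter> {c<..<d}"
    have U: "open U" "E \<subseteq> U" "U \<subseteq> {c<..<d}" unfolding U_def using T Ecd by auto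
    have "bounded {c<..<d}" by (metis bounded_box box_real(1))
    then have Um: "U \<in> lmeasurable" using U bounded_subset by (intro lmeasurable_open) blast+
    have U\<mu>: "measure lebesgue U < \<mu> + \<tau>"
    proof -
      have "measure lebesgue (T - E) < \<tau>"
        using T(3,4) \<tau> by (simp add: emeasure_eq_measure2 ennreal_less_iff)
      moreover have "measure lebesgue (U - E) \<le> measure lebesgue (T - E)"
        using T Um E by (intro measure_mono_fmeasurable) (auto simp: U_def)
      moreover have "measure lebesgue (U - E) = measure lebesgue U - \<mu>"
        unfolding \<mu>_def using U Um E by (intro measurable_measure_Diff) auto
      ultimately show ?thesis by linarith
    qed
    obtain F where F: "finite F" "\<forall>(u, v)\<in>F. u < v \<and> {u..v} \<subseteq> U \<and> g v - g u < p * (v - u)" "disjoint_family_on (\<lambda>(u, v). {u..v}) F"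
      "measure lebesgue (E - (\<Union>(u, v)\<in>F. {u<..<v})) < \<tau>"
      using vitali_finite_intervals[OF E U(1,2) \<tau> E1] by blast
    have Fcd: "c < u \<and> u < v \<and> v < d \<and> {u..v} \<subseteq> U \<and> g v - g u < p * (v - u)" if "(u, v) \<in> F" for u v
    proof -
      have "u < v" "{u..v} \<subseteq> U" "g v - g u < p * (v - u)" using F(2) that by auto
      moreover have "u \<in> {u..v}" "v \<in> {u..v}" using \<open>u < v\<close> by auto
      then have "u \<in> {c<..<d}" "v \<in> {c<..<d}" using U(3) \<open>{u..v} \<subseteq> U\<close> by blast+
      ultimately show ?thesis by auto
    qed
    define L where "L = (\<Sum>(u, v)\<in>F. v - u)"
    have L1: "L \<le> \<mu> + \<tau>"
    proof -
      have "L = (\<Sum>i\<in>F. measure lebesgue {fst i..snd i})"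
        unfolding L_def case_prod_beta using Fcd by (intro sum.cong) (auto simp: less_imp_le)
      also have "\<dots> = measure lebesgue (\<Union>i\<in>F. {fst i..snd i})"
        using F(1,3) by (intro measure_UNION'[symmetric]) (auto simp: disjoint_family_on_def pairwise_def disjnt_def case_prod_beta)
      also have "\<dots> \<le> measure lebesgue U"
        using Um F(1) Fcd by (intro measure_mono_fmeasurable sets.finite_UN) (auto, fastforce)
      finally show ?thesis using U\<mu> by simp
    qed
    have L2: "\<mu> - \<tau> \<le> (\<Sum>(u, v)\<in>F. measure lebesgue (E \<inter> {u<..<v}))"
      using measure_le_sum_intervals[OF E F(1)] F(4) unfolding \<mu>_def by linarith
    have L3: "\<mu> - \<tau> \<le> L"
    proof -
      have "(\<Sum>(u, v)\<in>F. measure lebesgue (E \<inter> {u<..<v})) \<le> L"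
        unfolding L_def case_prod_beta using E Fcd by (intro sum_mono measure_Int_interval_le) (auto simp: less_imp_le)
      then show ?thesis using L2 by linarith
    qed
    \<comment> \<open>The permitted loss \<tau> is distributed over the intervals of F.\<close>
    define \<tau>' where "\<tau>' = \<tau> / (real (card F) + 1)"
    have \<tau>': "\<tau>' > 0" "card F * \<tau>' \<le> \<tau>" unfolding \<tau>'_def using \<tau> by (auto simp: divide_simps algebra_simps intro: add_nonneg_pos)
    have "\<forall>i. \<exists>H. i \<in> F \<longrightarrow> finite H \<and> (\<forall>(u, v)\<in>H. u < v \<and> {u..v} \<subseteq> {fst i<..<snd i} \<and> g v - g u > q * (v - u)) \<and>
        disjoint_family_on (\<lambda>(u, v). {u..v}) H \<and> measure lebesgue (E \<inter> {fst i<..<snd i} - (\<Union>(u, v)\<in>H. {u<..<v})) < \<tau>'"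
    proof (intro allI)
      fix i :: "real \<times> real"
      have Ei: "E \<inter> {fst i<..<snd i} \<in> lmeasurable" using E by (intro fmeasurable_Int_fmeasurable) auto
      show "\<exists>H. i \<in> F \<longrightarrow> finite H \<and> (\<forall>(u, v)\<in>H. u < v \<and> {u..v} \<subseteq> {fst i<..<snd i} \<and> g v - g u > q * (v - u)) \<and>
        disjoint_family_on (\<lambda>(u, v). {u..v}) H \<and> measure lebesgue (E \<inter> {fst i<..<snd i} - (\<Union>(u, v)\<in>H. {u<..<v})) < \<tau>'"
        using vitali_finite_intervals[OF Ei open_greaterThanLessThan _ \<tau>'(1), of "fst i" "snd i" "\<lambda>u v. g v - g u > q * (v - u)"] E2 by blast
    qed
    from choice[OF this] obtain H where H0: "\<forall>i. i \<in> F \<longrightarrow> finite (H i) \<and> (\<forall>(u, v)\<in>H i. u < v \<and> {u..v} \<subseteq> {fst i<..<snd i} \<and> g v - g u > q * (v - u)) \<and>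
        disjoint_family_on (\<lambda>(u, v). {u..v}) (H i) \<and> measure lebesgue (E \<inter> {fst i<..<snd i} - (\<Union>(u, v)\<in>H i. {u<..<v})) < \<tau>'"
      by blast
    have H: "\<And>i. i \<in> F \<Longrightarrow> finite (H i)"
      "\<And>i u v. i \<in> F \<Longrightarrow> (u, v) \<in> H i \<Longrightarrow> u < v \<and> {u..v} \<subseteq> {fst i<..<snd i} \<and> g v - g u > q * (v - u)"
      "\<And>i. i \<in> F \<Longrightarrow> disjoint_family_on (\<lambda>(u, v). {u..v}) (H i)"
      "\<And>i. i \<in> F \<Longrightarrow> measure lebesgue (E \<inter> {fst i<..<snd i} - (\<Union>(u, v)\<in>H i. {u<..<v})) < \<tau>'"
      using H0 by blast+
    have "\<forall>i. \<exists>G. i \<in> F \<longrightarrow> finite G \<and> (\<forall>(u, v)\<in>G. fst i \<le> u \<and> u < v \<and> v \<le> snd i) \<and> disjoint_family_on (\<lambda>(u, v). {u<..<v}) G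
        \<and> (\<forall>h :: real \<Rightarrow> real. h (snd i) - h (fst i) = (\<Sum>(u, v)\<in>H i. h v - h u) + (\<Sum>(u, v)\<in>G. h v - h u))"
    proof (intro allI)
      fix i
      have "\<exists>G. finite G \<and> (\<forall>(u, v)\<in>G. fst i \<le> u \<and> u < v \<and> v \<le> snd i) \<and> disjoint_family_on (\<lambda>(u, v). {u<..<v}) G
        \<and> (\<forall>h :: real \<Rightarrow> real. h (snd i) - h (fst i) = (\<Sum>(u, v)\<in>H i. h v - h u) + (\<Sum>(u, v)\<in>G. h v - h u))" if i: "i \<in> F"
      proof (rule interval_gaps[OF H(1)[OF i] _ H(3)[OF i]])
        show "fst i \<le> u \<and> u < v \<and> v \<le> snd i" if "(u, v) \<in> H i" for u v
        proof -
          have "u < v" "{u..v} \<subseteq> {fst i<..<snd i}" using H(2)[OF i that] by auto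
          moreover have "u \<in> {u..v}" "v \<in> {u..v}" using \<open>u < v\<close> by auto
          then have "u \<in> {fst i<..<snd i}" "v \<in> {fst i<..<snd i}" using \<open>{u..v} \<subseteq> {fst i<..<snd i}\<close> by blast+
          ultimately show ?thesis by auto
        qed
        show "fst i \<le> snd i" using Fcd[of "fst i" "snd i"] i by simp
      qed
      then show "\<exists>G. i \<in> F \<longrightarrow> finite G \<and> (\<forall>(u, v)\<in>G. fst i \<le> u \<and> u < v \<and> v \<le> snd i) \<and> disjoint_family_on (\<lambda>(u, v). {u<..<v}) G
        \<and> (\<forall>h :: real \<Rightarrow> real. h (snd i) - h (fst i) = (\<Sum>(u, v)\<in>H i. h v - h u) + (\<Sum>(u, v)\<in>G. h v - h u))" by blast
    qed
    from choice[OF this] obtain G where G0: "\<forall>i. i \<in> F \<longrightarrow> finite (G i) \<and> (\<forall>(u, v)\<in>G i. fst i \<le> u \<and> u < v \<and> v \<le> snd i) \<and> disjoint_family_on (\<lambda>(u, v). {u<..<v}) (G i)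
        \<and> (\<forall>h :: real \<Rightarrow> real. h (snd i) - h (fst i) = (\<Sum>(u, v)\<in>H i. h v - h u) + (\<Sum>(u, v)\<in>G i. h v - h u))"
      by blast
    have G: "\<And>i. i \<in> F \<Longrightarrow> finite (G i)"
      "\<And>i u v. i \<in> F \<Longrightarrow> (u, v) \<in> G i \<Longrightarrow> fst i \<le> u \<and> u < v \<and> v \<le> snd i"
      "\<And>i. i \<in> F \<Longrightarrow> disjoint_family_on (\<lambda>(u, v). {u<..<v}) (G i)"
      "\<And>i h. i \<in> F \<Longrightarrow> h (snd i) - h (fst i) = (\<Sum>(u, v)\<in>H i. h v - h u) + (\<Sum>(u, v)\<in>G i. h v - h u :: real)"
      using G0 by blast+
    define S where "S = (\<Union>i\<in>F. G i)"
    define M where "M = (\<Sum>i\<in>F. \<Sum>(u, v)\<in>H i. v - u)"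
    have disjF: "{fst i..snd i} \<inter> {fst j..snd j} = {}" if "i \<in> F" "j \<in> F" "i \<noteq> j" for i j
      using F(3) that unfolding disjoint_family_on_def case_prod_beta by blast
    have SS: "(\<Sum>(u, v)\<in>S. h v - h u) = (\<Sum>i\<in>F. \<Sum>(u, v)\<in>G i. h v - h u)" for h :: "real \<Rightarrow> real"
      unfolding S_def
    proof (rule sum.UNION_disjoint[OF F(1)])
      show "\<forall>i\<in>F. \<forall>j\<in>F. i \<noteq> j \<longrightarrow> G i \<inter> G j = {}"
      proof (intro ballI impI)
        fix i j assume ij: "i \<in> F" "j \<in> F" "i \<noteq> j"
        show "G i \<inter> G j = {}"
        proof (rule ccontr)
          assume "G i \<inter> G j \<noteq> {}"
          then obtain w where "w \<in> G i" "w \<in> G j" by blast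
          then have "fst w \<in> {fst i..snd i}" "fst w \<in> {fst j..snd j}"
            using G(2)[of i "fst w" "snd w"] G(2)[of j "fst w" "snd w"] ij by auto
          then show False using disjF[OF ij] by blast
        qed
      qed
    qed (use G in auto)
    have tot: "(\<Sum>(u, v)\<in>F. h v - h u) = (\<Sum>i\<in>F. \<Sum>(u, v)\<in>H i. h v - h u) + (\<Sum>(u, v)\<in>S. h v - h u)" for h :: "real \<Rightarrow> real"
    proof -
      have "(\<Sum>(u, v)\<in>F. h v - h u) = (\<Sum>i\<in>F. h (snd i) - h (fst i))" by (simp add: case_prod_beta)
      also have "\<dots> = (\<Sum>i\<in>F. (\<Sum>(u, v)\<in>H i. h v - h u) + (\<Sum>(u, v)\<in>G i. h v - h u))"
        by (intro sum.cong refl G(4))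
      finally show ?thesis by (simp add: SS sum.distrib)
    qed
    have M: "\<mu> - 2 * \<tau> \<le> M"
    proof -
      have "(\<Sum>i\<in>F. measure lebesgue (E \<inter> {fst i<..<snd i})) \<le> (\<Sum>i\<in>F. \<tau>' + (\<Sum>(u, v)\<in>H i. v - u))"
      proof (rule sum_mono)
        fix i assume i: "i \<in> F"
        have Ei: "E \<inter> {fst i<..<snd i} \<in> lmeasurable" using E by (intro fmeasurable_Int_fmeasurable) auto
        have "(\<Sum>(u, v)\<in>H i. measure lebesgue (E \<inter> {fst i<..<snd i} \<inter> {u<..<v})) \<le> (\<Sum>(u, v)\<in>H i. v - u)"
          unfolding case_prod_beta using Ei H(2)[OF i] by (intro sum_mono measure_Int_interval_le) (auto simp: less_imp_le)
        then show "measure lebesgue (E \<inter> {fst i<..<snd i}) \<le> \<tau>' + (\<Sum>(u, v)\<in>H i. v - u)"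
          using measure_le_sum_intervals[OF Ei H(1)[OF i]] H(4)[OF i] by linarith
      qed
      also have "\<dots> = card F * \<tau>' + M" by (simp add: sum.distrib M_def)
      finally show ?thesis using L2 \<tau>'(2) unfolding case_prod_beta by linarith
    qed
    have Mup: "M \<le> \<mu> + \<tau>" and len: "(\<Sum>(u, v)\<in>S. v - u) < \<delta>"
    proof -
      have t: "L = M + (\<Sum>(u, v)\<in>S. v - u)" using tot[of "\<lambda>x. x"] unfolding L_def M_def .
      have "(\<Sum>(u, v)\<in>S. v - u) \<ge> 0" unfolding case_prod_beta S_def using G(2) by (intro sum_nonneg) fastforce
      then show "M \<le> \<mu> + \<tau>" using t L1 by linarith
      have "3 * \<tau> < \<delta>" unfolding \<tau>_def using \<delta>(1) by (auto simp: min_def)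
      then show "(\<Sum>(u, v)\<in>S. v - u) < \<delta>" using t L1 M by linarith
    qed
    have "\<bar>\<Sum>(u, v)\<in>S. g v - g u\<bar> < \<epsilon>"
    proof (rule \<delta>(2)[OF _ _ _ len])
      show "finite S" unfolding S_def using F(1) G(1) by auto
      show "\<forall>(u, v)\<in>S. c \<le> u \<and> u < v \<and> v \<le> d"
        unfolding S_def using G(2) Fcd by fastforce
      show "disjoint_family_on (\<lambda>(u, v). {u<..<v}) S"
        unfolding disjoint_family_on_def
      proof (intro ballI impI)
        fix I J assume IJ: "I \<in> S" "J \<in> S" "I \<noteq> J"
        obtain i j where ij: "i \<in> F" "I \<in> G i" "j \<in> F" "J \<in> G j" using IJ unfolding S_def by auto
        show "(case I of (u, v) \<Rightarrow> {u<..<v}) \<inter> (case J of (u, v) \<Rightarrow> {u<..<v}) = {}"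
        proof (cases "i = j")
          case True
          then show ?thesis using G(3)[OF ij(1)] ij IJ unfolding disjoint_family_on_def by blast
        next
          case False
          have "{fst I<..<snd I} \<subseteq> {fst i..snd i}" "{fst J<..<snd J} \<subseteq> {fst j..snd j}"
            using G(2)[of i "fst I" "snd I"] G(2)[of j "fst J" "snd J"] ij by auto
          then show ?thesis using disjF[OF ij(1,3) False] unfolding case_prod_beta by blast
        qed
      qed
    qed
    moreover have "(\<Sum>(u, v)\<in>F. g v - g u) \<le> p * L"
      unfolding L_def sum_distrib_left case_prod_beta using Fcd by (intro sum_mono) (auto simp: less_imp_le)
    moreover have "(\<Sum>i\<in>F. \<Sum>(u, v)\<in>H i. g v - g u) \<ge> q * M"
      unfolding M_def sum_distrib_left case_prod_beta using H(2) by (intro sum_mono) (auto simp: less_imp_le)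
    ultimately have key: "q * M < p * L + \<epsilon>" using tot[of g] by linarith
    have "p * L \<le> p * \<mu> + \<bar>p\<bar> * \<tau>"
    proof -
      have "p * (L - \<mu>) \<le> \<bar>p\<bar> * \<bar>L - \<mu>\<bar>" by (metis abs_ge_self abs_mult)
      also have "\<dots> \<le> \<bar>p\<bar> * \<tau>" using L1 L3 by (intro mult_left_mono) auto
      finally show ?thesis by (simp add: algebra_simps)
    qed
    moreover have "q * M \<ge> q * \<mu> - \<bar>q\<bar> * (2 * \<tau>)"
    proof -
      have "- (q * (M - \<mu>)) \<le> \<bar>q\<bar> * \<bar>M - \<mu>\<bar>" by (metis abs_ge_minus_self abs_mult)
      also have "\<dots> \<le> \<bar>q\<bar> * (2 * \<tau>)" using M Mup \<tau> by (intro mult_left_mono) auto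
      finally show ?thesis by (simp add: algebra_simps)
    qed
    ultimately have "(q - p) * \<mu> < \<epsilon> + (\<bar>p\<bar> + 2 * \<bar>q\<bar>) * \<tau>" using key by (simp add: algebra_simps)
    also have "(\<bar>p\<bar> + 2 * \<bar>q\<bar>) * \<tau> \<le> (2 * (\<bar>p\<bar> + \<bar>q\<bar> + 1)) * ((q - p) * \<mu> / (8 * (\<bar>p\<bar> + \<bar>q\<bar> + 1)))"
      using \<tau> unfolding \<tau>_def by (intro mult_mono) auto
    also have "\<dots> = (q - p) * \<mu> / 4"
    proof -
      have "\<bar>p\<bar> + \<bar>q\<bar> + 1 \<noteq> 0" by linarith
      then show ?thesis by (simp add: field_simps)
    qed
    finally have "(q - p) * \<mu> < (q - p) * \<mu> / 2" unfolding \<epsilon>_def by simp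
    then show False using \<mu> pq unfolding \<mu>_def by simp
  qed
  then show ?thesis using E unfolding E_def[symmetric] by (simp add: negligible_iff_measure)
qed

text \<open>Localized to intervals of length 2\<delta>/3, in which every disjoint family has total
  length below \<delta>. If the set had positive measure \<mu> there, a family covering half of it
  with slopes above 2/\<mu> would have increments adding up to at least 1.\<close>

lemma steep_everywhere_negligible:
  assumes ac: "abs_cont_on c d g"
  shows "negligible (\<Inter>q::nat. steep_points g c d (real q))"
proof -
  define E where "E = (\<Inter>q::nat. steep_points g c d (real q))"
  have Ecd: "E \<subseteq> {c<..<d}" unfolding E_def using steep_points_subset by blast
  have E: "E \<in> sets lebesgue" unfolding E_def using steep_points_measurable by (intro sets.countable_INT) (auto simp: fmeasurableD)
  obtain \<delta> where \<delta>: "\<delta> > 0" "\<And>S. finite S \<Longrightarrow> \<forall>(u, v)\<in>S. c \<le> u \<and> u < v \<and> v \<le> d \<Longrightarrow> disjoint_family_on (\<lambda>(u, v). {u<..<v}) S \<Longrightarrow>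
     (\<Sum>(u, v)\<in>S. v - u) < \<delta> \<Longrightarrow> \<bar>\<Sum>(u, v)\<in>S. g v - g u\<bar> < 1"
    using abs_cont_onD[OF ac, of 1] by auto
  have "negligible (E \<inter> {x - \<delta> / 3<..<x + \<delta> / 3})" for x
  proof -
    define D where "D = E \<inter> {x - \<delta> / 3<..<x + \<delta> / 3}"
    have D: "D \<in> lmeasurable" unfolding D_def
      using fmeasurable_Int_fmeasurable[OF _ E, of "{x - \<delta> / 3<..<x + \<delta> / 3}"] by (simp add: Int_commute)
    have "measure lebesgue D = 0"
    proof (rule ccontr)
      assume "measure lebesgue D \<noteq> 0"
      then have \<mu>: "measure lebesgue D > 0" using zero_less_measure_iff by blast
      define U where "U = {c<..<d} \<inter> {x - \<delta> / 3<..<x + \<delta> / 3}"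
      have U: "open U" "D \<subseteq> U" unfolding U_def D_def using Ecd by auto
      obtain q :: nat where q: "real q > 2 / measure lebesgue D" using reals_Archimedean2 by blast
      have P: "\<exists>u v. u < y \<and> y < v \<and> v - u < \<eta> \<and> g v - g u > real q * (v - u)" if "y \<in> D" "\<eta> > 0" for y \<eta>
      proof -
        have "y \<in> steep_points g c d (real q)" using that unfolding D_def E_def by blast
        then show ?thesis using that unfolding steep_points_def by blast
      qed
      obtain F where F: "finite F" "\<forall>(u, v)\<in>F. u < v \<and> {u..v} \<subseteq> U \<and> g v - g u > real q * (v - u)" "disjoint_family_on (\<lambda>(u, v). {u..v}) F"
        "measure lebesgue (D - (\<Union>(u, v)\<in>F. {u<..<v})) < measure lebesgue D / 2"
        using vitali_finite_intervals[OF D U _ P, of "measure lebesgue D / 2"] \<mu> by auto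
      have FU: "u < v \<and> {u..v} \<subseteq> U \<and> c \<le> u \<and> v \<le> d \<and> g v - g u > real q * (v - u)" if "(u, v) \<in> F" for u v
      proof -
        have "u < v" "{u..v} \<subseteq> U" "g v - g u > real q * (v - u)" using F(2) that by auto
        moreover have "u \<in> {u..v}" "v \<in> {u..v}" using \<open>u < v\<close> by auto
        then have "u \<in> U" "v \<in> U" using \<open>{u..v} \<subseteq> U\<close> by blast+
        ultimately show ?thesis unfolding U_def by auto
      qed
      define L where "L = (\<Sum>(u, v)\<in>F. v - u)"
      have L: "L \<ge> measure lebesgue D / 2"
      proof -
        have "(\<Sum>(u, v)\<in>F. measure lebesgue (D \<inter> {u<..<v})) \<le> L"
          unfolding L_def case_prod_beta using D FU by (intro sum_mono measure_Int_interval_le) (auto simp: less_imp_le)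
        then show ?thesis using measure_le_sum_intervals[OF D F(1)] F(4) by linarith
      qed
      have "L < \<delta>"
      proof -
        have "L = (\<Sum>i\<in>F. measure lebesgue {fst i..snd i})"
          unfolding L_def case_prod_beta using FU by (intro sum.cong) (auto simp: less_imp_le)
        also have "\<dots> = measure lebesgue (\<Union>i\<in>F. {fst i..snd i})"
          using F(1,3) by (intro measure_UNION'[symmetric]) (auto simp: disjoint_family_on_def pairwise_def disjnt_def case_prod_beta)
        also have "\<dots> \<le> measure lebesgue {x - \<delta> / 3..x + \<delta> / 3}"
          using F(1) FU unfolding U_def by (intro measure_mono_fmeasurable sets.finite_UN) (auto, fastforce+)
        also have "\<dots> < \<delta>" using \<delta>(1) by simp
        finally show ?thesis .
      qed
      have "\<bar>\<Sum>(u, v)\<in>F. g v - g u\<bar> < 1"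
      proof (rule \<delta>(2)[OF F(1)])
        show "\<forall>(u, v)\<in>F. c \<le> u \<and> u < v \<and> v \<le> d" using FU by blast
        show "disjoint_family_on (\<lambda>(u, v). {u<..<v}) F"
          using F(3) unfolding disjoint_family_on_def case_prod_beta
          by (meson disjoint_iff greaterThanLessThan_subseteq_atLeastAtMost_iff order_refl subset_iff)
        show "(\<Sum>(u, v)\<in>F. v - u) < \<delta>" using \<open>L < \<delta>\<close> unfolding L_def .
      qed
      moreover have "(\<Sum>(u, v)\<in>F. g v - g u) \<ge> real q * L"
        unfolding L_def sum_distrib_left case_prod_beta using FU by (intro sum_mono) (auto simp: less_imp_le)
      moreover have "real q * L \<ge> 1"
      proof -
        have "1 = 2 / measure lebesgue D * (measure lebesgue D / 2)" using \<mu> by simp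
        also have "\<dots> \<le> real q * L" using q L \<mu> by (intro mult_mono) auto
        finally show ?thesis .
      qed
      ultimately show False by linarith
    qed
    then show ?thesis using D unfolding D_def by (simp add: negligible_iff_measure)
  qed
  then have "\<exists>U. openin (top_of_set E) U \<and> x \<in> U \<and> negligible U" if "x \<in> E" for x
    using that \<delta>(1) by (intro exI[of _ "E \<inter> {x - \<delta> / 3<..<x + \<delta> / 3}"]) (auto intro!: openin_open_Int)
  then show ?thesis
    unfolding E_def[symmetric] locally_negligible_alt[of E] by blast
qed

text \<open>L is the infimum of the slopes that short chords around x do not exceed. A rational q'
  below L is exceeded at every scale, so by \<open>sep\<close> no rational p < q' is undercut by
  short chords; hence short chords around x have slope close to L. By continuity one end of the
  chord may tend to x, which gives the derivative.\<close>

lemma differentiable_off_steep_points: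
  fixes g :: "real \<Rightarrow> real"
  assumes g: "continuous_on {c..d} g" and x: "c < x" "x < d"
    and bounded_above: "x \<notin> steep_points g c d B" and not_low: "x \<notin> steep_points (\<lambda>x. - g x) c d (- M)"
    and sep: "\<And>p q. p \<in> \<rat> \<Longrightarrow> q \<in> \<rat> \<Longrightarrow> p < q \<Longrightarrow> x \<notin> steep_points (\<lambda>x. - g x) c d (- p) \<or> x \<notin> steep_points g c d q"
  shows "\<exists>L\<ge>M. (g has_real_derivative L) (at x)"
proof -
  have up: "\<exists>\<eta>>0. \<forall>u v. c \<le> u \<and> u < x \<and> x < v \<and> v \<le> d \<and> v - u < \<eta> \<longrightarrow> g v - g u \<le> q * (v - u)" if nq: "x \<notin> steep_points g c d q" for q
  proof -
    obtain \<eta> where "\<eta> > 0" "\<And>u v. c \<le> u \<and> u < x \<and> x < v \<and> v \<le> d \<and> v - u < \<eta> \<Longrightarrow> \<not> (g v - g u > q * (v - u))"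
      using nq unfolding steep_points_def by blast
    then show ?thesis by (intro exI[of _ \<eta>]) (auto simp: not_less)
  qed
  have lo: "\<exists>\<eta>>0. \<forall>u v. c \<le> u \<and> u < x \<and> x < v \<and> v \<le> d \<and> v - u < \<eta> \<longrightarrow> g v - g u \<ge> p * (v - u)" if np: "x \<notin> steep_points (\<lambda>x. - g x) c d (- p)" for p
  proof -
    obtain \<eta> where \<eta>: "\<eta> > 0" "\<And>u v. c \<le> u \<and> u < x \<and> x < v \<and> v \<le> d \<and> v - u < \<eta> \<Longrightarrow> \<not> (- g v - - g u > - p * (v - u))"
      using np unfolding steep_points_def by blast
    show ?thesis
    proof (intro exI[of _ \<eta>] conjI allI impI \<eta>(1))
      fix u v assume "c \<le> u \<and> u < x \<and> x < v \<and> v \<le> d \<and> v - u < \<eta>"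
      from \<eta>(2)[OF this] show "g v - g u \<ge> p * (v - u)" by simp
    qed
  qed
  define Q where "Q = {q. x \<notin> steep_points g c d q}"
  have Qne: "B \<in> Q" unfolding Q_def using bounded_above by simp
  \<comment> \<open>A symmetric chord short enough for both conditions has slope at least M and at
    most q.\<close>
  have Qlow: "q \<ge> M" if qQ: "q \<in> Q" for q
  proof -
    obtain \<eta>1 where 1: "\<eta>1 > 0" "\<And>u v. c \<le> u \<and> u < x \<and> x < v \<and> v \<le> d \<and> v - u < \<eta>1 \<Longrightarrow> g v - g u \<le> q * (v - u)" using up qQ unfolding Q_def by blast
    obtain \<eta>2 where 2: "\<eta>2 > 0" "\<And>u v. c \<le> u \<and> u < x \<and> x < v \<and> v \<le> d \<and> v - u < \<eta>2 \<Longrightarrow> g v - g u \<ge> M * (v - u)" using lo not_low by blast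
    define h where "h = min (min \<eta>1 \<eta>2 / 3) (min (x - c) (d - x))"
    have h: "h > 0" "h \<le> x - c" "h \<le> d - x" "3 * h \<le> \<eta>1" "3 * h \<le> \<eta>2" unfolding h_def using 1 2 x by (auto simp: min_def)
    have "g (x + h) - g (x - h) \<le> q * (2 * h)" using 1(2)[of "x - h" "x + h"] h by simp
    moreover have "M * (2 * h) \<le> g (x + h) - g (x - h)" using 2(2)[of "x - h" "x + h"] h by simp
    ultimately have "M * (2 * h) \<le> q * (2 * h)" by linarith
    then show ?thesis using h by simp
  qed
  define L where "L = Inf Q"
  have bdd: "bdd_below Q" using Qlow by (rule bdd_belowI)
  have LM: "L \<ge> M" unfolding L_def using Qne Qlow by (intro cInf_greatest) auto
  have cont: "isCont g x" using g x by (intro continuous_on_interior[OF g]) auto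
  have key: "\<exists>\<eta>>0. \<forall>u v. c \<le> u \<and> u < x \<and> x < v \<and> v \<le> d \<and> v - u < \<eta> \<longrightarrow> \<bar>g v - g u - L * (v - u)\<bar> \<le> e * (v - u)" if e: "e > 0" for e
  proof -
    obtain q where q: "q \<in> Q" "q < L + e" using cInf_lessD[of Q "L + e"] Qne e unfolding L_def by auto
    obtain p where p: "p \<in> \<rat>" "L - e < p" "p < L - e / 2" using Rats_dense_in_real[of "L - e" "L - e / 2"] e by auto
    obtain q' where q': "q' \<in> \<rat>" "p < q'" "q' < L" using Rats_dense_in_real[of p L] p e by auto
    have "q' \<notin> Q" using q'(3) cInf_lower[OF _ bdd] unfolding L_def by force
    then have "x \<notin> steep_points (\<lambda>x. - g x) c d (- p)" using sep[OF p(1) q'(1,2)] unfolding Q_def by blast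
    from lo[OF this] obtain \<eta>2 where 2: "\<eta>2 > 0" "\<And>u v. c \<le> u \<and> u < x \<and> x < v \<and> v \<le> d \<and> v - u < \<eta>2 \<Longrightarrow> g v - g u \<ge> p * (v - u)" by blast
    obtain \<eta>1 where 1: "\<eta>1 > 0" "\<And>u v. c \<le> u \<and> u < x \<and> x < v \<and> v \<le> d \<and> v - u < \<eta>1 \<Longrightarrow> g v - g u \<le> q * (v - u)" using up q unfolding Q_def by blast
    show ?thesis
    proof (intro exI[of _ "min \<eta>1 \<eta>2"] conjI allI impI)
      fix u v assume uv: "c \<le> u \<and> u < x \<and> x < v \<and> v \<le> d \<and> v - u < min \<eta>1 \<eta>2"
      have "g v - g u \<le> q * (v - u)" "g v - g u \<ge> p * (v - u)" using 1(2) 2(2) uv by auto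
      moreover have "q * (v - u) \<le> (L + e) * (v - u)" "(L - e) * (v - u) \<le> p * (v - u)" using uv q p by (intro mult_right_mono; simp)+
      ultimately show "\<bar>g v - g u - L * (v - u)\<bar> \<le> e * (v - u)" by (auto simp: algebra_simps abs_le_iff)
    qed (use 1 2 in auto)
  qed
  have one_sided: "\<exists>\<eta>>0. \<forall>y. y \<noteq> x \<and> \<bar>y - x\<bar> < \<eta> \<longrightarrow> \<bar>g y - g x - L * (y - x)\<bar> \<le> e * \<bar>y - x\<bar>" if e: "e > 0" for e
  proof -
    obtain \<eta> where \<eta>: "\<eta> > 0" "\<And>u v. c \<le> u \<and> u < x \<and> x < v \<and> v \<le> d \<and> v - u < \<eta> \<Longrightarrow> \<bar>g v - g u - L * (v - u)\<bar> \<le> e * (v - u)" using key[OF e] by blast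
    define h where "h = min (\<eta> / 2) (min (x - c) (d - x))"
    have h: "h > 0" "h \<le> x - c" "h \<le> d - x" "2 * h \<le> \<eta>" unfolding h_def using \<eta> x by (auto simp: min_def)
    show ?thesis
    proof (intro exI[of _ h] conjI allI impI h)
      fix y assume y: "y \<noteq> x \<and> \<bar>y - x\<bar> < h"
      have T: "((\<lambda>t. g t) \<longlongrightarrow> g x) (at x)" using cont by (simp add: isCont_def)
      show "\<bar>g y - g x - L * (y - x)\<bar> \<le> e * \<bar>y - x\<bar>"
      proof (cases "y > x")
        case True
        \<comment> \<open>The chord from u to y straddles x, and u tends to x from the left.\<close>
        have lim: "((\<lambda>u. e * (y - u) - \<bar>g y - g u - L * (y - u)\<bar>) \<longlongrightarrow> e * (y - x) - \<bar>g y - g x - L * (y - x)\<bar>) (at_left x)"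
          by (intro tendsto_intros filterlim_at_split[THEN iffD1, OF T, THEN conjunct1])
        have "0 \<le> e * (y - x) - \<bar>g y - g x - L * (y - x)\<bar>"
        proof (rule tendsto_lowerbound[OF lim])
          show "\<forall>\<^sub>F u in at_left x. 0 \<le> e * (y - u) - \<bar>g y - g u - L * (y - u)\<bar>"
            unfolding eventually_at_left_field
          proof (intro exI[of _ "x - h"] conjI allI impI)
            fix u assume "x - h < u" "u < x"
            then show "0 \<le> e * (y - u) - \<bar>g y - g u - L * (y - u)\<bar>" using \<eta>(2)[of u y] True y h by auto
          qed (use h in simp)
        qed simp
        then show ?thesis using True by simp
      next
        case False
        have lim: "((\<lambda>v. e * (v - y) - \<bar>g v - g y - L * (v - y)\<bar>) \<longlongrightarrow> e * (x - y) - \<bar>g x - g y - L * (x - y)\<bar>) (at_right x)"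
          by (intro tendsto_intros filterlim_at_split[THEN iffD1, OF T, THEN conjunct2])
        have "0 \<le> e * (x - y) - \<bar>g x - g y - L * (x - y)\<bar>"
        proof (rule tendsto_lowerbound[OF lim])
          show "\<forall>\<^sub>F v in at_right x. 0 \<le> e * (v - y) - \<bar>g v - g y - L * (v - y)\<bar>"
            unfolding eventually_at_right_field
          proof (intro exI[of _ "x + h"] conjI allI impI)
            fix v assume "x < v" "v < x + h"
            then show "0 \<le> e * (v - y) - \<bar>g v - g y - L * (v - y)\<bar>" using \<eta>(2)[of y v] False y h by auto
          qed (use h in simp)
        qed simp
        moreover have "\<bar>g x - g y - L * (x - y)\<bar> = \<bar>g y - g x - L * (y - x)\<bar>" by (simp add: algebra_simps abs_minus_commute)
        ultimately show ?thesis using False y by simp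
      qed
    qed
  qed
  have "(g has_real_derivative L) (at x)"
    unfolding has_field_derivative_def has_derivative_at_alt
  proof (intro conjI allI impI)
    show "bounded_linear ((*) L)" by (rule bounded_linear_mult_right)
    fix e :: real assume "e > 0"
    from one_sided[OF this] obtain \<eta> where "\<eta> > 0" "\<And>y. y \<noteq> x \<and> \<bar>y - x\<bar> < \<eta> \<Longrightarrow> \<bar>g y - g x - L * (y - x)\<bar> \<le> e * \<bar>y - x\<bar>" by blast
    then show "\<exists>d>0. \<forall>y. norm (y - x) < d \<longrightarrow> norm (g y - g x - L * (y - x)) \<le> e * norm (y - x)"
      by (intro exI[of _ \<eta>]) (metis abs_zero cancel_comm_monoid_add_class.diff_cancel diff_zero mult_zero_right norm_eq_zero order_refl real_norm_def)
  qed
  then show ?thesis using LM by blast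
qed

lemma abs_cont_on_imp_continuous_on:
  assumes "abs_cont_on c d g" shows "continuous_on {c..d} g"
  unfolding continuous_on_iff
proof (intro ballI allI impI)
  fix x e :: real assume x: "x \<in> {c..d}" and e: "e > 0"
  obtain \<delta> where \<delta>: "\<delta> > 0" "\<And>S. finite S \<Longrightarrow> \<forall>(u, v)\<in>S. c \<le> u \<and> u < v \<and> v \<le> d \<Longrightarrow> disjoint_family_on (\<lambda>(u, v). {u<..<v}) S \<Longrightarrow>
     (\<Sum>(u, v)\<in>S. v - u) < \<delta> \<Longrightarrow> \<bar>\<Sum>(u, v)\<in>S. g v - g u\<bar> < e"
    using abs_cont_onD[OF assms e] by blast
  have *: "\<bar>g v - g u\<bar> < e" if "c \<le> u" "u < v" "v \<le> d" "v - u < \<delta>" for u v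
    using \<delta>(2)[of "{(u, v)}"] that by (auto simp: disjoint_family_on_def)
  show "\<exists>\<delta>>0. \<forall>y\<in>{c..d}. dist y x < \<delta> \<longrightarrow> dist (g y) (g x) < e"
  proof (intro exI[of _ \<delta>] conjI ballI impI \<delta>(1))
    fix y assume y: "y \<in> {c..d}" "dist y x < \<delta>"
    consider "x = y" | "x < y" | "y < x" by linarith
    then show "dist (g y) (g x) < e"
    proof cases
      case 1 then show ?thesis using e by simp
    next
      case 2 then show ?thesis using *[of x y] x y by (auto simp: dist_real_def)
    next
      case 3 then show ?thesis using *[of y x] x y by (auto simp: dist_real_def abs_minus_commute)
    qed
  qed
qed

text \<open>Off the exceptional null sets, a point without arbitrarily short chords of slope below M
  + e would have a derivative of at least M + e, contrary to D. So such chords exist around almost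
  every point; finitely many disjoint ones cover [c, d] up to total length \<delta>, and the gaps
  contribute less than e by absolute continuity.\<close>

theorem abs_cont_on_increment_le:
  assumes ac: "abs_cont_on c d g" and cd: "c \<le> d" and M: "M \<ge> 0" and N: "negligible N"
    and D: "\<And>x L. x \<in> {c<..<d} \<Longrightarrow> x \<notin> N \<Longrightarrow> (g has_real_derivative L) (at x) \<Longrightarrow> L \<le> M"
  shows "g d - g c \<le> M * (d - c)"
proof (rule field_le_epsilon)
  fix e' :: real assume e': "e' > 0"
  define e where "e = e' / (d - c + 1)"
  have cd1: "d - c + 1 > 0" using cd by simp
  have e: "e > 0" using e' cd1 by (simp add: e_def)
  have "e * (d - c + 1) = e'" using cd1 by (simp add: e_def)
  then have e2: "e * (d - c) + e = e'" by (simp add: algebra_simps)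
  define E where "E = steep_points (\<lambda>x. - g x) c d (- (M + e))"
  have E: "E \<in> lmeasurable" unfolding E_def by (rule steep_points_measurable)
  have Ecd: "E \<subseteq> {c<..<d}" unfolding E_def by (rule steep_points_subset)
  \<comment> \<open>Comparing only rational slopes makes the exceptional set a countable union of
    null sets.\<close>
  define Z where "Z = (\<Union>(p, q)\<in>{(p, q). p \<in> \<rat> \<and> q \<in> \<rat> \<and> p < q}. steep_points (\<lambda>x. - g x) c d (- p) \<inter> steep_points g c d q)"
  have "countable {(p, q :: real). p \<in> \<rat> \<and> q \<in> \<rat> \<and> p < q}"
    by (rule countable_subset[OF _ countable_SIGMA[OF countable_rat countable_rat]]) auto
  then have Z: "negligible Z" unfolding Z_def
    using steep_both_ways_negligible[OF ac] by (intro negligible_countable_Union) auto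
  have "negligible ({c<..<d} - E)"
  proof (rule negligible_subset)
    show "negligible (N \<union> (\<Inter>q::nat. steep_points g c d (real q)) \<union> Z)"
      using N Z steep_everywhere_negligible[OF ac] by (intro negligible_Un)
    show "{c<..<d} - E \<subseteq> N \<union> (\<Inter>q::nat. steep_points g c d (real q)) \<union> Z"
    proof (rule subsetI, rule ccontr)
      fix x assume x: "x \<in> {c<..<d} - E" and nx: "x \<notin> N \<union> (\<Inter>q::nat. steep_points g c d (real q)) \<union> Z"
      then obtain q :: nat where "x \<notin> steep_points g c d (real q)" by blast
      then have "\<exists>L\<ge>M + e. (g has_real_derivative L) (at x)"
        by (rule differentiable_off_steep_points[OF abs_cont_on_imp_continuous_on[OF ac], rotated 2])
          (use x nx in \<open>auto simp: E_def Z_def\<close>)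
      then show False using D[of x] x nx e by fastforce
    qed
  qed
  then have mE: "measure lebesgue E = d - c"
    using measure_negligible_symdiff[of "{c<..<d}" E] Ecd cd by (auto simp: Diff_eq_empty_iff[THEN iffD2, OF Ecd])
  obtain \<delta> where \<delta>: "\<delta> > 0" "\<And>S. finite S \<Longrightarrow> \<forall>(u, v)\<in>S. c \<le> u \<and> u < v \<and> v \<le> d \<Longrightarrow> disjoint_family_on (\<lambda>(u, v). {u<..<v}) S \<Longrightarrow>
     (\<Sum>(u, v)\<in>S. v - u) < \<delta> \<Longrightarrow> \<bar>\<Sum>(u, v)\<in>S. g v - g u\<bar> < e"
    using abs_cont_onD[OF ac e] by blast
  have P: "\<exists>u v. u < x \<and> x < v \<and> v - u < \<eta> \<and> g v - g u < (M + e) * (v - u)" if xE: "x \<in> E" "\<eta> > 0" for x \<eta>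
  proof -
    obtain u v where "u < x" "x < v" "v - u < \<eta>" "- g v - - g u > - (M + e) * (v - u)"
      using xE unfolding E_def steep_points_def by blast
    then show ?thesis by (intro exI[of _ u] exI[of _ v]) (auto simp: algebra_simps)
  qed
  obtain F where F: "finite F" "\<forall>(u, v)\<in>F. u < v \<and> {u..v} \<subseteq> {c<..<d} \<and> g v - g u < (M + e) * (v - u)" "disjoint_family_on (\<lambda>(u, v). {u..v}) F"
    "measure lebesgue (E - (\<Union>(u, v)\<in>F. {u<..<v})) < \<delta>"
    using vitali_finite_intervals[OF E open_greaterThanLessThan Ecd \<delta>(1) P] by blast
  have FU: "c \<le> u \<and> u < v \<and> v \<le> d" "g v - g u < (M + e) * (v - u)" if uvF: "(u, v) \<in> F" for u v
  proof -
    have *: "u < v" "{u..v} \<subseteq> {c<..<d}" "g v - g u < (M + e) * (v - u)" using F(2) uvF by auto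
    moreover have "u \<in> {u..v}" "v \<in> {u..v}" using * by auto
    then have "u \<in> {c<..<d}" "v \<in> {c<..<d}" using * by blast+
    ultimately show "c \<le> u \<and> u < v \<and> v \<le> d" "g v - g u < (M + e) * (v - u)" by auto
  qed
  obtain G where G: "finite G" "\<forall>(u, v)\<in>G. c \<le> u \<and> u < v \<and> v \<le> d" "disjoint_family_on (\<lambda>(u, v). {u<..<v}) G"
    "\<And>h :: real \<Rightarrow> real. h d - h c = (\<Sum>(u, v)\<in>F. h v - h u) + (\<Sum>(u, v)\<in>G. h v - h u)"
    using interval_gaps[OF F(1) FU(1) F(3) cd] by blast
  define L where "L = (\<Sum>(u, v)\<in>F. v - u)"
  have L: "d - c - \<delta> < L"
  proof -
    have "(\<Sum>(u, v)\<in>F. measure lebesgue (E \<inter> {u<..<v})) \<le> L"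
      unfolding L_def case_prod_beta using E FU(1) by (intro sum_mono measure_Int_interval_le) (auto simp: less_imp_le)
    then show ?thesis using measure_le_sum_intervals[OF E F(1)] F(4) mE by linarith
  qed
  have t: "d - c = L + (\<Sum>(u, v)\<in>G. v - u)" using G(4)[of "\<lambda>x. x"] unfolding L_def .
  have "(\<Sum>(u, v)\<in>G. v - u) \<ge> 0" unfolding case_prod_beta using G(2) by (intro sum_nonneg) fastforce
  then have L': "L \<le> d - c" using t by linarith
  have "\<bar>\<Sum>(u, v)\<in>G. g v - g u\<bar> < e"
    using \<delta>(2)[OF G(1,2,3)] t L by linarith
  moreover have "(\<Sum>(u, v)\<in>F. g v - g u) \<le> (M + e) * L"
    unfolding L_def sum_distrib_left case_prod_beta using FU(2) by (intro sum_mono) (auto simp: less_imp_le)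
  moreover have "(M + e) * L \<le> (M + e) * (d - c)" using L' M e by (intro mult_left_mono) auto
  ultimately have "g d - g c \<le> (M + e) * (d - c) + e" using G(4)[of g] by linarith
  then show "g d - g c \<le> M * (d - c) + e'" using e2 by (simp add: algebra_simps)
qed

section \<open>The Sobolev-type space\<close>

lemma abs_cont_on_uminus: "abs_cont_on c d g \<Longrightarrow> abs_cont_on c d (\<lambda>x. - g x)"
  unfolding abs_cont_on_def by (simp add: abs_minus_commute)

text \<open>The open interval has positive measure, so a nonnegative function cannot have a negative
  essential supremum. This also excludes -\<infinity>, and \<open>real_of_ereal\<close> loses
  nothing.\<close>

lemma weighted_esssup_AE:
  assumes a: "a > 0" and fin: "weighted_esssup a r f < \<infinity>"
  shows "0 \<le> real_of_ereal (weighted_esssup a r f)"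
    and "\<exists>N. negligible N \<and> (\<forall>x\<in>{-a<..<a} - N. \<bar>(deriv ^^ r) f x * sqrt (a\<^sup>2 - x\<^sup>2) ^ r\<bar> \<le> real_of_ereal (weighted_esssup a r f))"
proof -
  define M where "M = lebesgue_on {-a<..<a}"
  define E where "E = weighted_esssup a r f"
  have AE: "AE x in M. ereal \<bar>(deriv ^^ r) f x * sqrt (a\<^sup>2 - x\<^sup>2) ^ r\<bar> \<le> E"
    unfolding E_def weighted_esssup_def M_def by (rule esssup_AE)
  have E0: "0 \<le> E"
  proof (rule ccontr)
    assume "\<not> 0 \<le> E"
    then have neg: "E < 0" by simp
    have "AE x in M. False"
      using AE
    proof eventually_elim
      case (elim x)
      have "0 \<le> ereal \<bar>(deriv ^^ r) f x * sqrt (a\<^sup>2 - x\<^sup>2) ^ r\<bar>" by simp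
      then show ?case using elim neg by (meson leD order_trans)
    qed
    then have "emeasure M (space M) = 0" by (simp add: ae_filter_eq_bot_iff[symmetric] trivial_limit_def)
    then show False using a by (simp add: M_def emeasure_restrict_space space_restrict_space)
  qed
  have "E \<noteq> \<infinity>" using fin unfolding E_def by auto
  then have E: "E = ereal (real_of_ereal E)" using E0 by (cases E) auto
  show "0 \<le> real_of_ereal (weighted_esssup a r f)"
    using E0 unfolding E_def[symmetric] by (simp add: real_of_ereal_pos)
  have "AE x in lebesgue. x \<in> {-a<..<a} \<longrightarrow> ereal \<bar>(deriv ^^ r) f x * sqrt (a\<^sup>2 - x\<^sup>2) ^ r\<bar> \<le> E"
    using AE unfolding M_def by (subst (asm) AE_restrict_space_iff) auto
  then obtain N where N: "negligible N" "{x. \<not> (x \<in> {-a<..<a} \<longrightarrow> ereal \<bar>(deriv ^^ r) f x * sqrt (a\<^sup>2 - x\<^sup>2) ^ r\<bar> \<le> E)} \<subseteq> N"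
    unfolding eventually_ae_filter_negligible by blast
  have "\<bar>(deriv ^^ r) f x * sqrt (a\<^sup>2 - x\<^sup>2) ^ r\<bar> \<le> real_of_ereal E" if "x \<in> {-a<..<a} - N" for x
  proof -
    have "ereal \<bar>(deriv ^^ r) f x * sqrt (a\<^sup>2 - x\<^sup>2) ^ r\<bar> \<le> E" using N(2) that by blast
    then show ?thesis by (subst (asm) E) simp
  qed
  then show "\<exists>N. negligible N \<and> (\<forall>x\<in>{-a<..<a} - N. \<bar>(deriv ^^ r) f x * sqrt (a\<^sup>2 - x\<^sup>2) ^ r\<bar> \<le> real_of_ereal (weighted_esssup a r f))"
    using N(1) unfolding E_def by blast
qed

text \<open>Wherever g = f^(p) has a derivative outside a null set, this derivative is at most
  K/\<phi>^(p+1) in absolute value, and on an interval 1/\<phi> is at most the larger of its end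
  values. \<open>abs_cont_on_increment_le\<close>, applied to g and to -g, integrates the
  bound.\<close>

lemma sobolev_top_lipschitz:
  assumes a: "a > 0" and f: "f \<in> sobolev_W a (Suc p)" and xy: "x \<in> {-a<..<a}" "y \<in> {-a<..<a}"
  shows "\<bar>(deriv ^^ p) f x - (deriv ^^ p) f y\<bar> \<le> real_of_ereal (weighted_esssup a (Suc p) f) * \<bar>x - y\<bar>
     * max (1 / sqrt (a\<^sup>2 - x\<^sup>2)) (1 / sqrt (a\<^sup>2 - y\<^sup>2)) ^ Suc p"
proof -
  define K where "K = real_of_ereal (weighted_esssup a (Suc p) f)"
  define g where "g = (deriv ^^ p) f"
  define \<phi> where "\<phi> t = sqrt (a\<^sup>2 - t\<^sup>2)" for t
  have fin: "weighted_esssup a (Suc p) f < \<infinity>" using f unfolding sobolev_W_def by blast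
  have K: "K \<ge> 0" unfolding K_def by (rule weighted_esssup_AE(1)[OF a fin])
  obtain N where N: "negligible N" "\<And>t. t \<in> {-a<..<a} - N \<Longrightarrow> \<bar>(deriv ^^ Suc p) f t * \<phi> t ^ Suc p\<bar> \<le> K"
    using weighted_esssup_AE(2)[OF a fin] unfolding K_def \<phi>_def by blast
  have pos: "\<phi> t > 0" if "t \<in> {-a<..<a}" for t
  proof -
    have "a\<^sup>2 - t\<^sup>2 = (a - t) * (a + t)" by (simp add: power2_eq_square algebra_simps)
    then have "a\<^sup>2 - t\<^sup>2 > 0" using that by simp
    then show ?thesis unfolding \<phi>_def by simp
  qed
  have *: "\<bar>g d - g c\<bar> \<le> K * max (1 / \<phi> c) (1 / \<phi> d) ^ Suc p * (d - c)" if cd: "- a < c" "c \<le> d" "d < a" for c d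
  proof -
    define M where "M = K * max (1 / \<phi> c) (1 / \<phi> d) ^ Suc p"
    have pcd: "\<phi> c > 0" "\<phi> d > 0" using pos cd by auto
    have M: "M \<ge> 0" unfolding M_def using K pcd by (auto simp: le_max_iff_disj)
    have ac: "abs_cont_on c d g" using f cd unfolding sobolev_W_def g_def by auto
    have bd: "\<bar>L\<bar> \<le> M" if t: "t \<in> {c<..<d}" "t \<notin> N" and L: "(g has_real_derivative L) (at t)" for t L
    proof -
      have ta: "t \<in> {-a<..<a}" using t cd by auto
      have "(deriv ^^ Suc p) f t = L" using DERIV_imp_deriv[OF L] unfolding g_def by simp
      then have "\<bar>L\<bar> * \<phi> t ^ Suc p \<le> K" using N(2)[of t] ta t pos[OF ta] by (simp add: abs_mult)
      then have "\<bar>L\<bar> \<le> K * (1 / \<phi> t) ^ Suc p" using pos[OF ta] by (simp add: power_divide pos_le_divide_eq del: power_Suc)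
      also have "1 / \<phi> t \<le> max (1 / \<phi> c) (1 / \<phi> d)"
      proof (cases "t \<ge> 0")
        case True
        have "t\<^sup>2 \<le> d\<^sup>2" using True t by (intro power_mono) auto
        then have "\<phi> d \<le> \<phi> t" unfolding \<phi>_def by simp
        then have "1 / \<phi> t \<le> 1 / \<phi> d" using pcd by (intro divide_left_mono mult_pos_pos pcd pos[OF ta]) auto
        then show ?thesis by simp
      next
        case False
        have "(- t)\<^sup>2 \<le> (- c)\<^sup>2" using False t by (intro power_mono) auto
        then have "\<phi> c \<le> \<phi> t" unfolding \<phi>_def by simp
        then have "1 / \<phi> t \<le> 1 / \<phi> c" using pcd by (intro divide_left_mono mult_pos_pos pcd pos[OF ta]) auto
        then show ?thesis by simp
      qed
      then have "K * (1 / \<phi> t) ^ Suc p \<le> M"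
        unfolding M_def using K pos[OF ta] by (intro mult_left_mono power_mono) auto
      finally show ?thesis .
    qed
    have "g d - g c \<le> M * (d - c)"
      by (rule abs_cont_on_increment_le[OF ac cd(2) M N(1)]) (use bd abs_le_D1 in blast)
    moreover have "(- g d) - (- g c) \<le> M * (d - c)"
    proof (rule abs_cont_on_increment_le[OF abs_cont_on_uminus[OF ac] cd(2) M N(1)])
      fix t L assume t: "t \<in> {c<..<d}" "t \<notin> N" and L: "((\<lambda>x. - g x) has_real_derivative L) (at t)"
      have "(g has_real_derivative - L) (at t)" using DERIV_minus[OF L] by simp
      then show "L \<le> M" using bd[OF t] by fastforce
    qed
    ultimately show ?thesis unfolding M_def[symmetric] by linarith
  qed
  have "\<bar>g x - g y\<bar> \<le> K * max (1 / \<phi> x) (1 / \<phi> y) ^ Suc p * \<bar>x - y\<bar>"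
    using *[of x y] *[of y x] xy by (cases "x \<le> y") (auto simp: abs_minus_commute max.commute)
  then show ?thesis unfolding K_def g_def \<phi>_def by (simp only: mult_ac)
qed

lemma abs_le_sup_norm:
  assumes "continuous_on {-a..a} f" "x \<in> {-a..a}"
  shows "\<bar>f x\<bar> \<le> sup_norm a f"
  unfolding sup_norm_def
proof (rule cSUP_upper[OF assms(2)])
  have "compact ((\<lambda>x. \<bar>f x\<bar>) ` {-a..a})" using assms(1) by (intro compact_continuous_image continuous_intros) auto
  then show "bdd_above ((\<lambda>x. \<bar>f x\<bar>) ` {-a..a})" by (intro bounded_imp_bdd_above compact_imp_bounded)
qed

section \<open>Gauss--Legendre quadrature\<close>

lemma poly_rolle_finite_set:
  fixes p :: "real poly"
  assumes "finite Z" "card Z = Suc k" "\<And>z. z \<in> Z \<Longrightarrow> poly p z = 0"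
  shows "\<exists>Y. finite Y \<and> card Y = k \<and> Y \<subseteq> {Min Z<..<Max Z} \<and> (\<forall>y\<in>Y. poly (pderiv p) y = 0)"
  using assms
proof (induction k arbitrary: Z)
  case 0
  then show ?case by (intro exI[of _ "{}"]) auto
next
  case (Suc k)
  define b where "b = Max Z"
  define W where "W = Z - {b}"
  have Zne: "Z \<noteq> {}" using Suc.prems by auto
  have bZ: "b \<in> Z" unfolding b_def using Suc.prems Zne by simp
  have W: "finite W" "card W = Suc k" unfolding W_def using Suc.prems bZ by auto
  then have Wne: "W \<noteq> {}" by auto
  obtain Y where Y: "finite Y" "card Y = k" "Y \<subseteq> {Min W<..<Max W}" "\<forall>y\<in>Y. poly (pderiv p) y = 0"
    using Suc.IH[OF W] Suc.prems unfolding W_def by auto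
  have mW: "Max W \<in> W" using W Wne by simp
  then have "Max W < b" unfolding W_def b_def using Suc.prems(1) by (metis DiffD1 DiffD2 Max_ge insertCI less_eq_real_def)
  moreover have "poly p (Max W) = poly p b" using mW bZ Suc.prems(3) unfolding W_def by auto
  \<comment> \<open>Rolle's theorem between the two largest zeros. The critical points already found
    lie to the left of \<open>Max W\<close>, so this one is new.\<close>
  ultimately obtain x where x: "Max W < x" "x < b" "poly (pderiv p) x = 0"
    using poly_MVT[of "Max W" b p] by auto
  have "Min Z \<le> Min W" unfolding W_def using Wne W Suc.prems(1) by (intro Min_antimono) (auto simp: W_def)
  moreover have "Min W \<le> Max W" using W Wne by simp
  ultimately show ?case using x Y unfolding b_def[symmetric]
    by (intro exI[of _ "insert x Y"]) (auto simp: card_insert_if)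
qed

lemma linear_power_dvd_pderiv:
  fixes p :: "real poly"
  assumes "[:c, 1:] ^ Suc n dvd p" shows "[:c, 1:] ^ n dvd pderiv p"
proof -
  obtain r where "p = [:c, 1:] ^ Suc n * r" using assms by (elim dvdE)
  then have "pderiv p = [:c, 1:] ^ n * (Polynomial.smult (of_nat (Suc n)) (pderiv [:c, 1:] * r) + [:c, 1:] * pderiv r)"
    by (simp only: pderiv_mult pderiv_power_Suc) (simp add: algebra_simps)
  then show ?thesis by simp
qed

lemma linear_power_dvd_pderiv_funpow:
  fixes p :: "real poly"
  assumes "[:c, 1:] ^ n dvd p" "k \<le> n" shows "[:c, 1:] ^ (n - k) dvd (pderiv ^^ k) p"
  using assms(2)
proof (induction k)
  case (Suc k)
  then have "n - k = Suc (n - Suc k)" by simp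
  then show ?case using Suc linear_power_dvd_pderiv[of c "n - Suc k" "(pderiv ^^ k) p"] by simp
qed (use assms in simp)

text \<open>The intermediate derivatives in Rodrigues' formula; k = m gives the Legendre polynomial
  up to a factor. Zeros and orthogonality are both proved by induction on k.\<close>

abbreviation rodrigues :: "nat \<Rightarrow> nat \<Rightarrow> real poly" where
  "rodrigues m k \<equiv> (pderiv ^^ k) ([:-1, 0, 1:] ^ m)"

text \<open>(x^2 - 1)^m vanishes to order m at 1 and at -1, and each derivative lowers the order by
  one.\<close>

lemma rodrigues_endpoints:
  assumes "k < m" shows "poly (rodrigues m k) 1 = 0" "poly (rodrigues m k) (-1) = 0"
proof -
  have e: "[:-1, 0, 1 :: real:] ^ m = [:-1, 1:] ^ m * [:1, 1:] ^ m"
    by (simp add: power_mult_distrib[symmetric])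
  have "[:-1, 1:] ^ (m - k) dvd rodrigues m k" "[:1, 1:] ^ (m - k) dvd rodrigues m k"
    by (intro linear_power_dvd_pderiv_funpow; use assms in \<open>simp add: e\<close>)+
  moreover have "[:c, 1:] dvd [:c, 1 :: real:] ^ (m - k)" for c using assms by (simp add: dvd_power)
  ultimately have "[:-1, 1:] dvd rodrigues m k" "[:1, 1:] dvd rodrigues m k" by (meson dvd_trans)+
  then show "poly (rodrigues m k) 1 = 0" "poly (rodrigues m k) (-1) = 0"
    using poly_eq_0_iff_dvd[of "rodrigues m k" 1] poly_eq_0_iff_dvd[of "rodrigues m k" "-1"] by simp_all
qed

text \<open>As long as k < m, the k interior zeros and the two endpoints are k + 2 zeros, so by
  Rolle's theorem the next derivative has k + 1 interior zeros.\<close>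

lemma rodrigues_zeros:
  assumes "k \<le> m"
  shows "\<exists>Z. finite Z \<and> card Z = k \<and> Z \<subseteq> {-1<..<1} \<and> (\<forall>z\<in>Z. poly (rodrigues m k) z = 0)"
  using assms
proof (induction k)
  case 0
  then show ?case by (intro exI[of _ "{}"]) auto
next
  case (Suc k)
  then obtain Z where Z: "finite Z" "card Z = k" "Z \<subseteq> {-1<..<1}" "\<forall>z\<in>Z. poly (rodrigues m k) z = 0" by auto
  define W where "W = insert (-1) (insert 1 Z)"
  have W: "finite W" "card W = Suc (Suc k)" unfolding W_def using Z by (auto simp: card_insert_if)
  have W0: "poly (rodrigues m k) z = 0" if "z \<in> W" for z
    using that Z(4) rodrigues_endpoints[of k m] Suc.prems unfolding W_def by auto
  have Wb: "W \<subseteq> {-1..1}" unfolding W_def using Z(3) by force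
  have Wne: "W \<noteq> {}" using W by auto
  then have mm: "Min W \<ge> -1" "Max W \<le> 1" using W(1) Wb by auto
  obtain Y where Y: "finite Y" "card Y = Suc k" "Y \<subseteq> {Min W<..<Max W}" "\<forall>y\<in>Y. poly (pderiv (rodrigues m k)) y = 0"
    using poly_rolle_finite_set[OF W W0] by blast
  then show ?case using mm by (intro exI[of _ Y]) auto
qed

lemma degree_pderiv_funpow: "degree ((pderiv ^^ k) (p :: real poly)) = degree p - k"
  by (induction k) (auto simp: degree_pderiv)

lemma degree_legendre_poly: "degree (legendre_poly m) = m"
proof -
  have "degree ([:-1, 0, 1 :: real:] ^ m) = 2 * m" by (simp add: degree_power_eq)
  then show ?thesis unfolding legendre_poly_def by (simp add: degree_pderiv_funpow)
qed

lemma legendre_poly_zero_iff: "poly (legendre_poly m) z = 0 \<longleftrightarrow> poly (rodrigues m m) z = 0"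
  unfolding legendre_poly_def by simp

text \<open>The m zeros found by \<open>rodrigues_zeros\<close> are all of them, since the degree is
  m.\<close>

lemma legendre_zeros_props:
  assumes "m \<ge> 1"
  shows "finite (legendre_zeros m)" "card (legendre_zeros m) = m" "legendre_zeros m \<subseteq> {-1<..<1}"
proof -
  have ne: "legendre_poly m \<noteq> 0" using degree_legendre_poly[of m] assms by auto
  show fin: "finite (legendre_zeros m)" unfolding legendre_zeros_def using poly_roots_finite[OF ne] by simp
  obtain Z where Z: "finite Z" "card Z = m" "Z \<subseteq> {-1<..<1}" "\<forall>z\<in>Z. poly (rodrigues m m) z = 0"
    using rodrigues_zeros[of m m] by auto
  have sub: "Z \<subseteq> legendre_zeros m" unfolding legendre_zeros_def using Z(4) by (auto simp: legendre_poly_zero_iff)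
  have "card (legendre_zeros m) \<le> m"
    using card_poly_roots_bound[OF ne] degree_legendre_poly[of m] unfolding legendre_zeros_def by simp
  then have "Z = legendre_zeros m" using card_subset_eq[OF fin sub] Z(2) card_mono[OF fin sub] by linarith
  then show "card (legendre_zeros m) = m" "legendre_zeros m \<subseteq> {-1<..<1}" using Z by auto
qed

lemma integral_pderiv: "((\<lambda>x. poly (pderiv p) x) has_integral (poly p 1 - poly p (-1))) {-1..1::real}"
  by (rule fundamental_theorem_of_calculus)
    (auto simp: has_real_derivative_iff_has_vector_derivative[symmetric] intro!: has_field_derivative_at_within poly_DERIV)

lemma poly_integrable: "(\<lambda>x. poly p x) integrable_on {a..b::real}"
  by (intro integrable_continuous_real continuous_intros)

text \<open>Integration by parts: each step moves one derivative onto s, whose degree stays below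
  the remaining k, and the boundary terms vanish by \<open>rodrigues_endpoints\<close>.\<close>

lemma rodrigues_orthogonal:
  assumes "k \<le> m" "degree s < k \<or> s = 0"
  shows "integral {-1..1} (\<lambda>x. poly (rodrigues m k * s) x) = 0"
  using assms
proof (induction k arbitrary: s)
  case (Suc k)
  show ?case
  proof (cases "s = 0")
    case False
    have IH: "integral {-1..1} (\<lambda>x. poly (rodrigues m k * pderiv s) x) = 0"
    proof (rule Suc.IH)
      show "degree (pderiv s) < k \<or> pderiv s = 0"
        using Suc.prems False by (cases "degree s = 0") (auto simp: degree_pderiv pderiv_eq_0_iff)
    qed (use Suc.prems in simp)
    have p: "pderiv (rodrigues m k * s) = rodrigues m (Suc k) * s + rodrigues m k * pderiv s"
      by (simp add: pderiv_mult algebra_simps)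
    have "integral {-1..1} (\<lambda>x. poly (pderiv (rodrigues m k * s)) x) = 0"
      using integral_unique[OF integral_pderiv[of "rodrigues m k * s"]] rodrigues_endpoints[of k m] Suc.prems by simp
    then have "integral {-1..1} (\<lambda>x. poly (rodrigues m (Suc k) * s) x) + integral {-1..1} (\<lambda>x. poly (rodrigues m k * pderiv s) x) = 0"
      unfolding p poly_add by (subst integral_add[symmetric]) (auto intro: poly_integrable)
    then show ?thesis using IH by simp
  next
    case True
    have "poly (0 :: real poly) = (\<lambda>_. 0)" by (simp add: fun_eq_iff)
    then show ?thesis using True by simp
  qed
next
  case 0
  have "poly (0 :: real poly) = (\<lambda>_. 0)" by (simp add: fun_eq_iff)
  then show ?case using 0 by simp
qed

section \<open>Lagrange interpolation and exactness of the Gauss rule\<close>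

definition lagrange_poly :: "real set \<Rightarrow> real \<Rightarrow> real poly" where
  "lagrange_poly Z z = (\<Prod>w\<in>Z - {z}. Polynomial.smult (1 / (z - w)) [:- w, 1:])"

lemma poly_lagrange_poly: "poly (lagrange_poly Z z) x = (\<Prod>w\<in>Z - {z}. (x - w) / (z - w))"
  unfolding lagrange_poly_def poly_prod by (intro prod.cong) (auto simp: diff_divide_distrib)

lemma poly_lagrange_poly_node:
  assumes "finite Z" "z \<in> Z" "v \<in> Z"
  shows "poly (lagrange_poly Z z) v = (if v = z then 1 else 0)"
  using assms by (auto simp: poly_lagrange_poly intro!: prod_zero bexI[of _ v])

lemma degree_lagrange_poly:
  assumes "finite Z" "z \<in> Z"
  shows "degree (lagrange_poly Z z) \<le> card Z - 1"
proof -
  have "degree (lagrange_poly Z z) \<le> (\<Sum>w\<in>Z - {z}. degree (Polynomial.smult (1 / (z - w)) [:- w, 1:]))"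
    unfolding lagrange_poly_def using assms
      degree_prod_sum_le[of "Z - {z}" "\<lambda>w. Polynomial.smult (1 / (z - w)) [:- w, 1:]"] by (simp add: o_def)
  also have "\<dots> \<le> (\<Sum>w\<in>Z - {z}. 1)" by (intro sum_mono) auto
  finally show ?thesis using assms by simp
qed

lemma lagrange_interpolation:
  assumes "finite Z" "degree r < card Z"
  shows "r = (\<Sum>z\<in>Z. Polynomial.smult (poly r z) (lagrange_poly Z z))" (is "r = ?s")
proof (rule poly_eqI_degree[where A = Z])
  have "degree ?s \<le> card Z - 1"
    using assms degree_lagrange_poly[OF assms(1)] by (intro degree_sum_le) (auto intro: order_trans[OF degree_smult_le])
  then show "degree ?s < card Z" using assms by linarith
  fix v assume v: "v \<in> Z"
  have "poly ?s v = (\<Sum>z\<in>Z. if z = v then poly r v else 0)"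
    unfolding poly_sum using assms v by (intro sum.cong) (auto simp: poly_lagrange_poly_node)
  then show "poly r v = poly ?s v" using assms v by simp
qed (use assms in auto)

lemma gauss_weight_eq: "gauss_weight m z = integral {-1..1} (\<lambda>x. poly (lagrange_poly (legendre_zeros m) z) x)"
  unfolding gauss_weight_def poly_lagrange_poly ..

text \<open>Division by the Legendre polynomial L gives p = s L + r with s and r of degree below m.
  The product s L vanishes at the nodes and integrates to zero by orthogonality, while r is
  reproduced by interpolation, and the weights are the integrals of the Lagrange
  polynomials.\<close>

theorem gauss_quadrature_exact:
  assumes m: "m \<ge> 1" and p: "degree p < 2 * m"
  shows "integral {-1..1} (\<lambda>x. poly p x) = (\<Sum>z\<in>legendre_zeros m. gauss_weight m z * poly p z)"
proof -
  define L where "L = legendre_poly m"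
  define Z where "Z = legendre_zeros m"
  note Zp = legendre_zeros_props[OF m, folded Z_def]
  have L0: "L \<noteq> 0" unfolding L_def using degree_legendre_poly[of m] m by auto
  define s r where "s = p div L" and "r = p mod L"
  have pe: "p = s * L + r" unfolding s_def r_def by simp
  have r: "degree r < m" unfolding r_def using degree_mod_less[OF L0, of p] degree_legendre_poly[of m] m unfolding L_def by auto
  have s: "degree s < m \<or> s = 0"
  proof (cases "s = 0")
    case False
    have "degree (s * L) = degree s + m" using False L0 by (simp add: degree_mult_eq L_def degree_legendre_poly)
    moreover have "s * L = p - r" using pe by simp
    then have "degree (s * L) < 2 * m" using degree_diff_less[OF p, of r] r m by simp
    ultimately show ?thesis by simp
  qed simp
  have L: "L * s = Polynomial.smult (1 / (2 ^ m * fact m)) (rodrigues m m * s)" unfolding L_def legendre_poly_def by simp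
  have orth: "integral {-1..1} (\<lambda>x. poly (s * L) x) = 0"
    using rodrigues_orthogonal[of m m s] s unfolding mult.commute[of s L] L by simp
  have Lz: "poly L z = 0" if "z \<in> Z" for z using that unfolding Z_def L_def legendre_zeros_def by simp
  have "integral {-1..1} (\<lambda>x. poly p x) = integral {-1..1} (\<lambda>x. poly (s * L) x) + integral {-1..1} (\<lambda>x. poly r x)"
    unfolding pe poly_add by (intro integral_add poly_integrable)
  also have "\<dots> = integral {-1..1} (\<lambda>x. poly (\<Sum>z\<in>Z. Polynomial.smult (poly r z) (lagrange_poly Z z)) x)"
    unfolding orth using lagrange_interpolation[of Z r] Zp r by simp
  also have "\<dots> = (\<Sum>z\<in>Z. integral {-1..1} (\<lambda>x. poly r z * poly (lagrange_poly Z z) x))"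
    unfolding poly_sum poly_smult using Zp by (intro integral_sum) (auto intro!: integrable_on_mult_right poly_integrable)
  also have "\<dots> = (\<Sum>z\<in>Z. gauss_weight m z * poly p z)"
    unfolding gauss_weight_eq Z_def[symmetric] pe by (intro sum.cong) (auto simp: Lz)
  finally show ?thesis unfolding Z_def .
qed

text \<open>The rule is exact for the square of the Lagrange polynomial of z, which has degree at
  most 2m - 2, is 1 at z and 0 at the other nodes.\<close>

lemma gauss_weight_nonneg:
  assumes "m \<ge> 1" "z \<in> legendre_zeros m" shows "gauss_weight m z \<ge> 0"
proof -
  define l where "l = lagrange_poly (legendre_zeros m) z"
  note Zp = legendre_zeros_props[OF assms(1)]
  have "degree (l * l) \<le> (m - 1) + (m - 1)"
    using degree_lagrange_poly[OF Zp(1) assms(2)] Zp(2) unfolding l_def by (intro order_trans[OF degree_mult_le] add_mono) auto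
  then have "degree (l * l) < 2 * m" using assms(1) by linarith
  from gauss_quadrature_exact[OF assms(1) this]
  have "integral {-1..1} (\<lambda>x. poly (l * l) x) = (\<Sum>v\<in>legendre_zeros m. if v = z then gauss_weight m z else 0)"
    using Zp assms by (simp add: l_def poly_lagrange_poly_node if_distrib cong: if_cong)
  also have "\<dots> = gauss_weight m z" using Zp assms by simp
  finally have "gauss_weight m z = integral {-1..1} (\<lambda>x. poly (l * l) x)" ..
  also have "\<dots> \<ge> 0" by (intro integral_nonneg poly_integrable) simp
  finally show ?thesis .
qed

lemma sum_gauss_weight: "m \<ge> 1 \<Longrightarrow> (\<Sum>z\<in>legendre_zeros m. gauss_weight m z) = 2"
  using gauss_quadrature_exact[of m 1] by simp

text \<open>The rule is exact for p; replacing f by p changes the integral and the sum by at most 2e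
  each, since the interval and the nonnegative weights both have total mass 2.\<close>

theorem gauss_quadrature_error:
  assumes m: "m \<ge> 1" and p: "degree p < 2 * m" and f: "continuous_on {-1..1} f"
    and e: "\<And>x. x \<in> {-1..1} \<Longrightarrow> \<bar>f x - poly p x\<bar> \<le> e"
  shows "\<bar>integral {-1..1} f - (\<Sum>z\<in>legendre_zeros m. gauss_weight m z * f z)\<bar> \<le> 4 * e"
proof -
  note Zp = legendre_zeros_props[OF m]
  have fi: "f integrable_on {-1..1}" by (intro integrable_continuous_real f)
  have 1: "\<bar>integral {-1..1} f - integral {-1..1} (poly p)\<bar> \<le> 2 * e"
  proof -
    have "integral {-1..1} f - integral {-1..1} (poly p) = integral {-1..1} (\<lambda>x. f x - poly p x)"
      by (intro integral_diff[symmetric] fi poly_integrable)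
    also have "norm \<dots> \<le> integral {-1..1::real} (\<lambda>x. e)"
      by (intro integral_norm_bound_integral integrable_diff fi poly_integrable) (use e in auto)
    finally show ?thesis by simp
  qed
  have "\<bar>(\<Sum>z\<in>legendre_zeros m. gauss_weight m z * poly p z) - (\<Sum>z\<in>legendre_zeros m. gauss_weight m z * f z)\<bar>
      \<le> (\<Sum>z\<in>legendre_zeros m. \<bar>gauss_weight m z * (poly p z - f z)\<bar>)"
    unfolding sum_subtractf[symmetric] right_diff_distrib[symmetric] by (rule sum_abs)
  also have "\<dots> \<le> (\<Sum>z\<in>legendre_zeros m. gauss_weight m z * e)"
    unfolding abs_mult using gauss_weight_nonneg[OF m] Zp(3) e
    by (intro sum_mono mult_mono) (auto simp: abs_minus_commute dest!: subsetD)
  also have "\<dots> = 2 * e" using sum_gauss_weight[OF m] by (simp add: sum_distrib_right[symmetric])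
  finally show ?thesis using 1 gauss_quadrature_exact[OF m p] by linarith
qed

section \<open>The quadrature rule\<close>

text \<open>Under x = a (2u - 1) the weight \<phi> becomes 2a sqrt(u(1-u)). The powers of 2a from
  the derivatives cancel those from the weight, so the Sobolev norm itself can serve as K.\<close>

lemma sobolev_bern_err_bound:
  assumes a: "a > 0" and r: "1 \<le> r" "r \<le> 2 * l"
  shows "\<exists>C\<ge>0. \<exists>n0. \<forall>n\<ge>n0. \<forall>f\<in>sobolev_W a r. \<forall>u\<in>{0..1}.
     \<bar>(bern_err n ^^ l) (\<lambda>u. f (a * (2 * u - 1))) u\<bar> \<le> C * sobolev_norm a r f / sqrt n ^ r"
proof -
  obtain p where p: "r = Suc p" using r(1) by (cases r) auto
  \<comment> \<open>The number of applications that order r requires; r \<le> 2l makes it at most l,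
    and the other l - j applications cost a factor 2 each.\<close>
  define j where "j = p div 2 + 1"
  have jl: "j \<le> l" using r(2) unfolding j_def p by linarith
  obtain C n0 where C: "C \<ge> 0" and main: "\<And>n K F x. n \<ge> n0 \<Longrightarrow> K \<ge> 0 \<Longrightarrow>
     (\<forall>k<p. \<forall>t\<in>{0<..<1}. (F k has_real_derivative F (Suc k) t) (at t)) \<Longrightarrow>
     continuous_on {0..1} (F 0) \<Longrightarrow> (\<forall>t\<in>{0..1}. \<bar>F 0 t\<bar> \<le> K) \<Longrightarrow>
     (\<forall>t\<in>{0<..<1}. \<forall>u\<in>{0<..<1}. \<bar>F p t - F p u\<bar> \<le> K * \<bar>t - u\<bar> * max (1 / sqrt (t * (1 - t))) (1 / sqrt (u * (1 - u))) ^ (p + 1)) \<Longrightarrow>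
     x \<in> {0..1} \<Longrightarrow> \<bar>(bern_err n ^^ (p div 2 + 1)) (F 0) x\<bar> \<le> C * K / sqrt n ^ (p + 1)"
    using bern_err_approx_interior[of p] by blast
  show ?thesis
  proof (intro exI[of _ "2 ^ (l - j) * C"] exI[of _ "max n0 1"] conjI allI impI ballI)
    show "0 \<le> 2 ^ (l - j) * C" using C by simp
    fix n f and u :: real assume n: "n \<ge> max n0 1" and f: "f \<in> sobolev_W a r" and u: "u \<in> {0..1}"
    define E where "E = real_of_ereal (weighted_esssup a r f)"
    define K where "K = sobolev_norm a r f"
    have cont: "continuous_on {-a..a} f" using f unfolding sobolev_W_def by blast
    have E: "E \<ge> 0" unfolding E_def using f by (intro weighted_esssup_AE(1)[OF a]) (auto simp: sobolev_W_def)
    have sup0: "sup_norm a f \<ge> 0" using abs_le_sup_norm[OF cont, of 0] a by force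
    have K: "K \<ge> 0" "E \<le> K" "sup_norm a f \<le> K" unfolding K_def sobolev_norm_def E_def[symmetric] using E sup0 by auto
    define F where "F k t = (2 * a) ^ k * (deriv ^^ k) f (a * (2 * t - 1))" for k t
    have I: "a * (2 * t - 1) \<in> {-a..a}" if "t \<in> {0..1}" for t
    proof -
      have "a * (2 * t - 1) \<le> a * 1" "a * (- 1) \<le> a * (2 * t - 1)" using that a by (intro mult_left_mono; simp)+
      then show ?thesis by simp
    qed
    have I': "a * (2 * t - 1) \<in> {-a<..<a}" if "t \<in> {0<..<1}" for t
    proof -
      have "a * (2 * t - 1) < a * 1" "a * (- 1) < a * (2 * t - 1)" using that a by (intro mult_strict_left_mono; simp)+
      then show ?thesis by simp
    qed
    have F0: "F 0 = (\<lambda>u. f (a * (2 * u - 1)))" by (simp add: F_def fun_eq_iff)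
    have bound: "\<bar>(bern_err n ^^ j) (F 0) x\<bar> \<le> C * K / sqrt n ^ (p + 1)" if x: "x \<in> {0..1}" for x
      unfolding j_def
    proof (rule main[OF _ K(1) _ _ _ _ x])
      show "n \<ge> n0" using n by simp
      show "\<forall>k<p. \<forall>t\<in>{0<..<1}. (F k has_real_derivative F (Suc k) t) (at t)"
      proof (intro allI impI ballI)
        fix k and t :: real assume k: "k < p" and t: "t \<in> {0<..<1}"
        have "(deriv ^^ k) f differentiable (at (a * (2 * t - 1)))"
          using f k I'[OF t] unfolding sobolev_W_def p by auto
        then have "((deriv ^^ k) f has_real_derivative (deriv ^^ Suc k) f (a * (2 * t - 1))) (at (a * (2 * t - 1)))"
          by (simp add: DERIV_deriv_iff_real_differentiable)
        moreover have "((\<lambda>t. a * (2 * t - 1)) has_real_derivative 2 * a) (at t)"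
          by (auto intro!: derivative_eq_intros)
        ultimately have "((\<lambda>t. (deriv ^^ k) f (a * (2 * t - 1))) has_real_derivative (deriv ^^ Suc k) f (a * (2 * t - 1)) * (2 * a)) (at t)"
          by (rule DERIV_chain2)
        note d = DERIV_cmult[OF this, of "(2 * a) ^ k"]
        have e: "(2 * a) ^ k * ((deriv ^^ Suc k) f (a * (2 * t - 1)) * (2 * a)) = F (Suc k) t" by (simp add: F_def mult_ac)
        show "(F k has_real_derivative F (Suc k) t) (at t)"
          using d unfolding e F_def[of k, abs_def] .
      qed
      show "continuous_on {0..1} (F 0)" unfolding F0
        by (rule continuous_on_compose2[OF cont]) (use I in \<open>auto intro!: continuous_intros\<close>)
      show "\<forall>t\<in>{0..1}. \<bar>F 0 t\<bar> \<le> K"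
        unfolding F0 using abs_le_sup_norm[OF cont I] K(3) by (meson order_trans)
      show "\<forall>t\<in>{0<..<1}. \<forall>u\<in>{0<..<1}. \<bar>F p t - F p u\<bar> \<le> K * \<bar>t - u\<bar> * max (1 / sqrt (t * (1 - t))) (1 / sqrt (u * (1 - u))) ^ (p + 1)"
      proof (intro ballI)
        fix t u :: real assume t: "t \<in> {0<..<1}" and u: "u \<in> {0<..<1}"
        define x y where "x = a * (2 * t - 1)" and "y = a * (2 * u - 1)"
        have q: "1 / sqrt (a\<^sup>2 - (a * (2 * s - 1))\<^sup>2) = 1 / (2 * a) * (1 / sqrt (s * (1 - s)))" for s
        proof -
          have "a\<^sup>2 - (a * (2 * s - 1))\<^sup>2 = (2 * a)\<^sup>2 * (s * (1 - s))" by (simp add: power2_eq_square algebra_simps)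
          then have "sqrt (a\<^sup>2 - (a * (2 * s - 1))\<^sup>2) = 2 * a * sqrt (s * (1 - s))" using a by (simp add: real_sqrt_mult)
          then show ?thesis by simp
        qed
        define A B where "A = 1 / sqrt (t * (1 - t))" and "B = 1 / sqrt (u * (1 - u))"
        have AB: "A \<ge> 0" "B \<ge> 0" unfolding A_def B_def using t u by auto
        have mx: "max (1 / (2 * a) * A) (1 / (2 * a) * B) = 1 / (2 * a) * max A B"
          using a by (simp add: max_mult_distrib_left)
        have "\<bar>(deriv ^^ p) f x - (deriv ^^ p) f y\<bar> \<le> E * \<bar>x - y\<bar> * max (1 / sqrt (a\<^sup>2 - x\<^sup>2)) (1 / sqrt (a\<^sup>2 - y\<^sup>2)) ^ Suc p"
          unfolding E_def p x_def y_def by (rule sobolev_top_lipschitz[OF a f[unfolded p] I'[OF t] I'[OF u]])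
        also have "\<dots> = E * \<bar>x - y\<bar> * (1 / (2 * a) * max A B) ^ Suc p"
          unfolding x_def y_def q A_def[symmetric] B_def[symmetric] mx ..
        also have "\<bar>x - y\<bar> = 2 * a * \<bar>t - u\<bar>"
        proof -
          have "x - y = 2 * a * (t - u)" unfolding x_def y_def by (simp add: algebra_simps)
          then show ?thesis using a by (simp add: abs_mult)
        qed
        finally have 1: "\<bar>(deriv ^^ p) f x - (deriv ^^ p) f y\<bar> \<le> E * (2 * a * \<bar>t - u\<bar>) * (1 / (2 * a) * max A B) ^ Suc p" .
        have "\<bar>F p t - F p u\<bar> = (2 * a) ^ p * \<bar>(deriv ^^ p) f x - (deriv ^^ p) f y\<bar>"
          unfolding F_def x_def y_def right_diff_distrib[symmetric] abs_mult using a by simp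
        also have "\<dots> \<le> (2 * a) ^ p * (E * (2 * a * \<bar>t - u\<bar>) * (1 / (2 * a) * max A B) ^ Suc p)"
          using a by (intro mult_left_mono 1) auto
        also have "\<dots> = ((2 * a) ^ Suc p * (1 / (2 * a)) ^ Suc p) * (E * \<bar>t - u\<bar> * max A B ^ Suc p)"
          unfolding power_mult_distrib[of "1 / (2 * a)" "max A B" "Suc p"] by (simp add: mult_ac del: power_one_over)
        also have "(2 * a) ^ Suc p * (1 / (2 * a)) ^ Suc p = 1"
          unfolding power_mult_distrib[symmetric] using a by simp
        also have "1 * (E * \<bar>t - u\<bar> * max A B ^ Suc p) \<le> K * \<bar>t - u\<bar> * max A B ^ Suc p"
          using K AB unfolding mult_1 by (intro mult_right_mono) (auto simp: le_max_iff_disj)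
        finally show "\<bar>F p t - F p u\<bar> \<le> K * \<bar>t - u\<bar> * max (1 / sqrt (t * (1 - t))) (1 / sqrt (u * (1 - u))) ^ (p + 1)"
          unfolding A_def B_def by simp
      qed
    qed
    have "\<bar>(bern_err n ^^ (l - j)) ((bern_err n ^^ j) (F 0)) u\<bar> \<le> 2 ^ (l - j) * (C * K / sqrt n ^ (p + 1))"
      by (rule bern_err_funpow_bound[OF _ bound u]) (use n in auto)
    moreover have "(bern_err n ^^ (l - j)) ((bern_err n ^^ j) (F 0)) = (bern_err n ^^ l) (F 0)"
      using funpow_add[of "l - j" j "bern_err n"] jl by simp
    ultimately show "\<bar>(bern_err n ^^ l) (\<lambda>u. f (a * (2 * u - 1))) u\<bar> \<le> 2 ^ (l - j) * C * sobolev_norm a r f / sqrt n ^ r"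
      unfolding F0 p K_def by simp
  qed
qed

section \<open>The matrix of the rule and the iterates of I - B\<close>

lemma bern_eq_Bernstein: "a > 0 \<Longrightarrow> bern a m i x = Bernstein m i ((a + x) / (2 * a))"
proof -
  assume "a > 0"
  then have "(a - x) / (2 * a) = 1 - (a + x) / (2 * a)" by (simp add: field_simps)
  then show ?thesis unfolding bern_def Bernstein_def by simp
qed

lemma equi_node_scaled:
  assumes "a > 0" shows "(a + equi_node a m j) / (2 * a) = real j / real m" "equi_node a m j = a * (2 * (real j / real m) - 1)"
  using assms by (simp_all add: equi_node_def field_simps)

text \<open>At the nodes the error of F depends on the node values of F only, and through the matrix
  I - A, because A holds the values of the basis there. The induction splits off the innermost
  application.\<close>

lemma bern_err_funpow_nodes:
  assumes a: "a > 0" and m: "m \<ge> 1" and i: "i \<le> m"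
  shows "(bern_err m ^^ k) F (real i / real m)
     = (\<Sum>j\<le>m. ((1\<^sub>m (m + 1) - bern_mat a m) ^\<^sub>m k) $$ (i, j) * F (real j / real m))"
proof (induction k arbitrary: F)
  case 0
  have "(\<Sum>j\<le>m. ((1\<^sub>m (m + 1) - bern_mat a m) ^\<^sub>m 0) $$ (i, j) * F (real j / real m))
      = (\<Sum>j\<le>m. if j = i then F (real j / real m) else 0)"
    using i by (intro sum.cong) (auto simp: bern_mat_def)
  then show ?case using i by simp
next
  case (Suc k)
  define M where "M = 1\<^sub>m (m + 1) - bern_mat a m"
  have Mc: "M \<in> carrier_mat (m + 1) (m + 1)" unfolding M_def bern_mat_def by (rule minus_carrier_mat) simp
  have Mk: "M ^\<^sub>m k \<in> carrier_mat (m + 1) (m + 1)" using Mc by (rule pow_carrier_mat)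
  have node: "bern_err m F (real j / real m) = (\<Sum>q\<le>m. M $$ (j, q) * F (real q / real m))" if j: "j \<le> m" for j
  proof -
    have b: "bern a m q (equi_node a m j) = Bernstein m q (real j / real m)" for q
      unfolding bern_eq_Bernstein[OF a] equi_node_scaled(1)[OF a] ..
    have "(\<Sum>q\<le>m. M $$ (j, q) * F (real q / real m))
       = (\<Sum>q\<le>m. (if q = j then F (real q / real m) else 0) - F (real q / real m) * Bernstein m q (real j / real m))"
      using j by (intro sum.cong) (auto simp: M_def bern_mat_def b algebra_simps)
    also have "\<dots> = bern_err m F (real j / real m)"
      using j by (simp add: sum_subtractf bern_err_def bern_sum_def)
    finally show ?thesis ..
  qed
  have "(bern_err m ^^ Suc k) F (real i / real m) = (\<Sum>j\<le>m. (M ^\<^sub>m k) $$ (i, j) * bern_err m F (real j / real m))"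
    unfolding funpow_Suc_right o_def using Suc[of "bern_err m F"] unfolding M_def .
  also have "\<dots> = (\<Sum>j\<le>m. \<Sum>q\<le>m. (M ^\<^sub>m k) $$ (i, j) * M $$ (j, q) * F (real q / real m))"
    using node by (intro sum.cong) (auto simp: sum_distrib_left mult.assoc)
  also have "\<dots> = (\<Sum>q\<le>m. \<Sum>j\<le>m. (M ^\<^sub>m k) $$ (i, j) * M $$ (j, q) * F (real q / real m))"
    by (rule sum.swap)
  also have "\<dots> = (\<Sum>q\<le>m. (M ^\<^sub>m Suc k) $$ (i, q) * F (real q / real m))"
  proof (intro sum.cong refl)
    fix q assume "q \<in> {..m}"
    then have "(M ^\<^sub>m Suc k) $$ (i, q) = (\<Sum>j = 0..<m + 1. (M ^\<^sub>m k) $$ (i, j) * M $$ (j, q))"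
      using i Mc Mk by (simp add: times_mat_def scalar_prod_def)
    also have "{0..<m + 1} = {..m}" by auto
    finally show "(\<Sum>j\<le>m. (M ^\<^sub>m k) $$ (i, j) * M $$ (j, q) * F (real q / real m)) = (M ^\<^sub>m Suc k) $$ (i, q) * F (real q / real m)"
      by (simp add: sum_distrib_right)
  qed
  finally show ?case unfolding M_def .
qed

text \<open>C is the sum of the powers (I - A)^k, so the Bernstein sum with these coefficients is
  the sum of B (I - B)^k F over k < l, and writing B = I - (I - B) makes it telescope.\<close>

lemma C_mat_bern_sum:
  assumes a: "a > 0" and m: "m \<ge> 1"
  shows "bern_sum m (\<lambda>i. \<Sum>j\<le>m. C_mat a m l $$ (i, j) * F (real j / real m)) u = F u - (bern_err m ^^ l) F u"
proof -
  have c: "(\<Sum>j\<le>m. C_mat a m l $$ (i, j) * F (real j / real m)) = (\<Sum>k<l. (bern_err m ^^ k) F (real i / real m))" if i: "i \<le> m" for i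
  proof -
    have "(\<Sum>j\<le>m. C_mat a m l $$ (i, j) * F (real j / real m)) = (\<Sum>j\<le>m. \<Sum>k<l. ((1\<^sub>m (m + 1) - bern_mat a m) ^\<^sub>m k) $$ (i, j) * F (real j / real m))"
      using i by (intro sum.cong) (auto simp: C_mat_def sum_distrib_right)
    also have "\<dots> = (\<Sum>k<l. \<Sum>j\<le>m. ((1\<^sub>m (m + 1) - bern_mat a m) ^\<^sub>m k) $$ (i, j) * F (real j / real m))"
      by (rule sum.swap)
    finally show ?thesis using bern_err_funpow_nodes[OF a m i] by simp
  qed
  have "bern_sum m (\<lambda>i. \<Sum>j\<le>m. C_mat a m l $$ (i, j) * F (real j / real m)) u
      = (\<Sum>i\<le>m. \<Sum>k<l. (bern_err m ^^ k) F (real i / real m) * Bernstein m i u)"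
    unfolding bern_sum_def by (intro sum.cong) (auto simp: c sum_distrib_right)
  also have "\<dots> = (\<Sum>k<l. \<Sum>i\<le>m. (bern_err m ^^ k) F (real i / real m) * Bernstein m i u)"
    by (rule sum.swap)
  also have "\<dots> = (\<Sum>k<l. (bern_err m ^^ k) F u - (bern_err m ^^ Suc k) F u)"
    by (intro sum.cong) (auto simp: bern_err_def[of m "(bern_err m ^^ _) F"] bern_sum_def)
  also have "\<dots> = F u - (bern_err m ^^ l) F u"
    by (subst sum_lessThan_telescope') simp
  finally show ?thesis .
qed

lemma bern_err_funpow_const:
  "k \<ge> 1 \<Longrightarrow> (bern_err m ^^ k) (\<lambda>_. 1) = (\<lambda>_. 0)"
proof (induction k rule: nat_induct_at_least)
  case base
  show ?case by (auto simp: bern_err_def bern_sum_def fun_eq_iff)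
next
  case (Suc k)
  then show ?case by (auto simp: bern_err_def bern_sum_def fun_eq_iff)
qed

text \<open>B reproduces constants, so (I - A)^k with k \<ge> 1 annihilates the vector of ones, and
  only k = 0 contributes to the sum of a row. The row of index 0 is enough.\<close>

lemma mat_inf_norm_C_mat_ge_1:
  assumes a: "a > 0" and m: "m \<ge> 1" and l: "l \<ge> 1"
  shows "mat_inf_norm (C_mat a m l) \<ge> 1"
proof -
  have dims: "dim_row (C_mat a m l) = m + 1" "dim_col (C_mat a m l) = m + 1" by (auto simp: C_mat_def)
  have "(\<Sum>j\<le>m. C_mat a m l $$ (0, j)) = (\<Sum>j\<le>m. \<Sum>k<l. ((1\<^sub>m (m + 1) - bern_mat a m) ^\<^sub>m k) $$ (0, j))"
    by (intro sum.cong) (auto simp: C_mat_def)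
  also have "\<dots> = (\<Sum>k<l. \<Sum>j\<le>m. ((1\<^sub>m (m + 1) - bern_mat a m) ^\<^sub>m k) $$ (0, j))"
    by (rule sum.swap)
  also have "\<dots> = (\<Sum>k<l. (bern_err m ^^ k) (\<lambda>_. 1) (real 0 / real m))"
    using bern_err_funpow_nodes[OF a m, of 0 _ "\<lambda>_. 1"] by (intro sum.cong) auto
  also have "\<dots> = (\<Sum>k<l. if k = 0 then 1 else 0)"
    using bern_err_funpow_const by (intro sum.cong) auto
  also have "\<dots> = 1" using l by simp
  finally have "1 \<le> (\<Sum>j\<le>m. \<bar>C_mat a m l $$ (0, j)\<bar>)" using sum_abs[of "\<lambda>j. C_mat a m l $$ (0, j)" "{..m}"] by linarith
  also have "{..m} = {..<dim_col (C_mat a m l)}" unfolding dims by auto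
  also have "(\<Sum>j<dim_col (C_mat a m l). \<bar>C_mat a m l $$ (0, j)\<bar>) \<le> mat_inf_norm (C_mat a m l)"
    unfolding mat_inf_norm_def by (rule Max_ge) (auto simp: dims)
  finally show ?thesis .
qed

section \<open>Error of the composite rule\<close>

lemma trig_taylor_poly:
  fixes \<theta> \<rho> :: real
  assumes \<kappa>: "\<kappa> = sin \<or> \<kappa> = cos" and m: "m \<ge> 1" and \<rho>: "\<rho> \<ge> 0"
  shows "\<exists>T. degree T < m \<and> (\<forall>z\<in>{-1..1}. \<bar>\<kappa> (\<theta> - \<rho> * z) - poly T z\<bar> \<le> 2 * (\<rho> ^ m / fact m))"
proof -
  define Sp where "Sp = (\<Sum>k<m. Polynomial.monom (sin_coeff k * \<rho> ^ k) k)"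
  define Cp where "Cp = (\<Sum>k<m. Polynomial.monom (cos_coeff k * \<rho> ^ k) k)"
  have deg: "degree (\<Sum>k<m. Polynomial.monom (c k * \<rho> ^ k) k) \<le> m - 1" for c :: "nat \<Rightarrow> real"
    by (intro degree_sum_le) (auto intro: order_trans[OF degree_monom_le])
  have pw: "\<bar>\<rho> * z\<bar> ^ m \<le> \<rho> ^ m" if "z \<in> {-1..1}" for z
  proof -
    have "\<bar>\<rho> * z\<bar> \<le> \<rho>" using mult_left_le[of "\<bar>z\<bar>" \<rho>] \<rho> that by (auto simp: abs_mult)
    then show ?thesis by (intro power_mono) auto
  qed
  have S: "\<bar>sin (\<rho> * z) - poly Sp z\<bar> \<le> \<rho> ^ m / fact m" if z: "z \<in> {-1..1}" for z
  proof -
    have "poly Sp z = (\<Sum>k<m. sin_coeff k * (\<rho> * z) ^ k)"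
      unfolding Sp_def poly_sum poly_monom by (simp add: power_mult_distrib mult_ac)
    then have "\<bar>sin (\<rho> * z) - poly Sp z\<bar> \<le> inverse (fact m) * \<bar>\<rho> * z\<bar> ^ m"
      using Maclaurin_sin_bound[of "\<rho> * z" m] by simp
    also have "\<dots> \<le> inverse (fact m) * \<rho> ^ m" using pw[OF z] by (intro mult_left_mono) auto
    finally show ?thesis by (simp add: field_simps)
  qed
  have C: "\<bar>cos (\<rho> * z) - poly Cp z\<bar> \<le> \<rho> ^ m / fact m" if z: "z \<in> {-1..1}" for z
  proof -
    have p: "poly Cp z = (\<Sum>k<m. cos_coeff k * (\<rho> * z) ^ k)"
      unfolding Cp_def poly_sum poly_monom by (simp add: power_mult_distrib mult_ac)
    obtain t where "cos (\<rho> * z) = (\<Sum>k<m. cos_coeff k * (\<rho> * z) ^ k) + (cos (t + 1/2 * real m * pi) / fact m) * (\<rho> * z) ^ m"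
      using Maclaurin_cos_expansion[of "\<rho> * z" m] by blast
    then have "\<bar>cos (\<rho> * z) - poly Cp z\<bar> = \<bar>cos (t + 1/2 * real m * pi)\<bar> / fact m * \<bar>\<rho> * z\<bar> ^ m"
      unfolding p by (simp add: abs_mult power_abs)
    also have "\<dots> \<le> 1 / fact m * \<rho> ^ m"
      using pw[OF z] by (intro mult_mono divide_right_mono) (auto intro: abs_cos_le_one)
    finally show ?thesis by simp
  qed
  \<comment> \<open>By the addition theorems either kernel is a combination of cos(\<rho> z) and
    sin(\<rho> z) with coefficients at most 1 in absolute value; this gives the factor 2.\<close>
  define \<alpha> \<beta> where "\<alpha> = (if \<kappa> = sin then sin \<theta> else cos \<theta>)" and "\<beta> = (if \<kappa> = sin then - cos \<theta> else sin \<theta>)"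
  have ab: "\<bar>\<alpha>\<bar> \<le> 1" "\<bar>\<beta>\<bar> \<le> 1" unfolding \<alpha>_def \<beta>_def by auto
  have k: "\<kappa> (\<theta> - \<rho> * z) = \<alpha> * cos (\<rho> * z) + \<beta> * sin (\<rho> * z)" for z
    using \<kappa> unfolding \<alpha>_def \<beta>_def by (auto simp: sin_diff cos_diff)
  show ?thesis
  proof (intro exI[of _ "Polynomial.smult \<alpha> Cp + Polynomial.smult \<beta> Sp"] conjI ballI)
    have "degree (Polynomial.smult \<alpha> Cp + Polynomial.smult \<beta> Sp) \<le> m - 1"
      using deg unfolding Sp_def Cp_def by (intro degree_add_le order_trans[OF degree_smult_le]) auto
    then show "degree (Polynomial.smult \<alpha> Cp + Polynomial.smult \<beta> Sp) < m" using m by linarith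
    fix z :: real assume z: "z \<in> {-1..1}"
    have "\<kappa> (\<theta> - \<rho> * z) - poly (Polynomial.smult \<alpha> Cp + Polynomial.smult \<beta> Sp) z = \<alpha> * (cos (\<rho> * z) - poly Cp z) + \<beta> * (sin (\<rho> * z) - poly Sp z)"
      unfolding k by (simp add: algebra_simps)
    also have "\<bar>\<dots>\<bar> \<le> \<bar>\<alpha>\<bar> * \<bar>cos (\<rho> * z) - poly Cp z\<bar> + \<bar>\<beta>\<bar> * \<bar>sin (\<rho> * z) - poly Sp z\<bar>"
      unfolding abs_mult[symmetric] by (rule abs_triangle_ineq)
    also have "\<dots> \<le> 1 * (\<rho> ^ m / fact m) + 1 * (\<rho> ^ m / fact m)"
      using ab S[OF z] C[OF z] by (intro add_mono mult_mono) auto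
    finally show "\<bar>\<kappa> (\<theta> - \<rho> * z) - poly (Polynomial.smult \<alpha> Cp + Polynomial.smult \<beta> Sp) z\<bar> \<le> 2 * (\<rho> ^ m / fact m)" by simp
  qed
qed

text \<open>\<open>bern_sum\<close> is a mere function; the exactness of the Gauss rule is about
  polynomials of bounded degree.\<close>

lemma bern_sum_affine_poly:
  "\<exists>P :: real poly. degree P \<le> m \<and> (\<forall>z. poly P z = bern_sum m c (\<alpha> + \<beta> * z))"
proof -
  define U where "U = [:\<alpha>, \<beta>:]"
  define V where "V = [:1 - \<alpha>, - \<beta>:]"
  define P where "P = (\<Sum>k\<le>m. Polynomial.smult (c k * real (m choose k)) (U ^ k * V ^ (m - k)))"
  have dU: "degree U \<le> 1" "degree V \<le> 1" unfolding U_def V_def by auto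
  have "degree (U ^ k * V ^ (m - k)) \<le> m" if "k \<le> m" for k
  proof -
    have "degree (U ^ k) \<le> 1 * k" "degree (V ^ (m - k)) \<le> 1 * (m - k)"
      using dU by (intro order_trans[OF degree_power_le] mult_right_mono; simp)+
    then show ?thesis using degree_mult_le[of "U ^ k" "V ^ (m - k)"] that by linarith
  qed
  then have "degree P \<le> m" unfolding P_def by (intro degree_sum_le) (auto intro: order_trans[OF degree_smult_le])
  moreover have "poly P z = bern_sum m c (\<alpha> + \<beta> * z)" for z
    unfolding P_def bern_sum_def Bernstein_def U_def V_def poly_sum
    by (intro sum.cong) (auto simp: poly_power algebra_simps)
  ultimately show ?thesis by blast
qed

lemma gamma_inv_affine: "gamma_inv a N h z = a / real N * z + (mesh_point a N (h - 1) + a / real N)"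
  unfolding gamma_inv_def by (simp add: algebra_simps add_divide_distrib)

lemma mesh_point_Suc: "mesh_point a N (Suc h) = mesh_point a N h + 2 * (a / real N)"
  unfolding mesh_point_def by (simp add: algebra_simps add_divide_distrib)

lemma gamma_inv_mem:
  assumes "a > 0" "h \<in> {1..N}" "z \<in> {-1..1}"
  shows "gamma_inv a N h z \<in> {-a..a}"
proof -
  \<comment> \<open>\<open>gamma_inv\<close> uses h - 1 on natural numbers; h \<ge> 1 makes it the
    index of the left end of the subinterval.\<close>
  obtain k where k: "h = Suc k" using assms(2) by (cases h) auto
  have N: "real N > 0" using assms(2) by simp
  define e where "e = a / real N"
  have e: "e > 0" "N * e = a" unfolding e_def using assms(1) N by auto
  have kN: "(real k + 1) * e \<le> N * e" using assms(2) k e by (intro mult_right_mono) auto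
  have z: "e * z \<le> e * 1" "e * (- 1) \<le> e * z" using assms(3) e by (intro mult_left_mono; simp)+
  have g: "gamma_inv a N h z = e * z + (- a + 2 * (real k * e) + e)"
    unfolding gamma_inv_affine k mesh_point_def e_def by (simp add: algebra_simps)
  have "real k * e \<ge> 0" using e by simp
  moreover have "real k * e + e \<le> a" using kN e by (simp add: distrib_right)
  moreover have "e * z \<le> e" "- e \<le> e * z" using z by simp_all
  ultimately show ?thesis unfolding g atLeastAtMost_iff using e by linarith
qed

lemma integral_split_mesh:
  fixes g :: "real \<Rightarrow> real"
  assumes a: "a > 0" and N: "N \<ge> 1" and g: "continuous_on {-a..a} g"
  shows "integral {-a..a} g = a / real N * (\<Sum>h = 1..N. integral {-1..1} (\<lambda>z. g (gamma_inv a N h z)))"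
proof -
  define e where "e = a / real N"
  have e: "e > 0" "N * e = a" unfolding e_def using a N by auto
  have mp: "mesh_point a N h = - a + 2 * (real h * e)" for h
    unfolding mesh_point_def e_def by (simp add: algebra_simps)
  have mpN: "mesh_point a N N = a" unfolding mp using e by simp
  have mple: "mesh_point a N h \<le> a" "- a \<le> mesh_point a N h" if "h \<le> N" for h
  proof -
    have "real h * e \<le> N * e" using that e by (intro mult_right_mono) auto
    moreover have "real h * e \<ge> 0" using e by simp
    ultimately show "mesh_point a N h \<le> a" "- a \<le> mesh_point a N h" unfolding mp using e by linarith+
  qed
  have int: "g integrable_on {u..v}" if "- a \<le> u" "v \<le> a" for u v
    by (rule integrable_continuous_real[OF continuous_on_subset[OF g]]) (use that in auto)
  have piece: "integral {mesh_point a N k..mesh_point a N (Suc k)} g = e * integral {-1..1} (\<lambda>z. g (gamma_inv a N (Suc k) z))"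
    if k: "Suc k \<le> N" for k
  proof -
    define c where "c = mesh_point a N k + e"
    define I where "I = integral {mesh_point a N k..mesh_point a N (Suc k)} g"
    have "(g has_integral I) (cbox (mesh_point a N k) (mesh_point a N (Suc k)))"
      unfolding I_def cbox_interval by (intro integrable_integral int mple) (use k in auto)
    from has_integral_affinity'[OF this e(1), of c]
    have "((\<lambda>x. g (e * x + c)) has_integral (I / e)) (cbox ((mesh_point a N k - c) / e) ((mesh_point a N (Suc k) - c) / e))"
      by (simp add: divide_inverse mult.commute)
    moreover have "(mesh_point a N k - c) / e = - 1" "(mesh_point a N (Suc k) - c) / e = 1"
      unfolding c_def mesh_point_Suc e_def[symmetric] using e by auto
    moreover have "(\<lambda>x. g (e * x + c)) = (\<lambda>z. g (gamma_inv a N (Suc k) z))"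
      unfolding gamma_inv_affine c_def e_def by simp
    ultimately have "((\<lambda>z. g (gamma_inv a N (Suc k) z)) has_integral (I / e)) {-1..1}" by simp
    then have "integral {-1..1} (\<lambda>z. g (gamma_inv a N (Suc k) z)) = I / e" by (rule integral_unique)
    then show ?thesis using e unfolding I_def by simp
  qed
  have "integral {-a..mesh_point a N k} g = e * (\<Sum>h = 1..k. integral {-1..1} (\<lambda>z. g (gamma_inv a N h z)))" if "k \<le> N" for k
    using that
  proof (induction k)
    case 0
    then show ?case by (simp add: mesh_point_def)
  next
    case (Suc k)
    have "integral {-a..mesh_point a N (Suc k)} g = integral {-a..mesh_point a N k} g + integral {mesh_point a N k..mesh_point a N (Suc k)} g"
      using mple[of k] mple[of "Suc k"] Suc.prems e
      by (intro Henstock_Kurzweil_Integration.integral_combine[symmetric] int) (auto simp: mesh_point_Suc e_def[symmetric])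
    then show ?case using Suc piece[of k] by (simp add: algebra_simps)
  qed
  from this[of N] show ?thesis unfolding mpN e_def by simp
qed

lemma power_div_fact_le_exp:
  assumes "(x::real) \<ge> 0" shows "x ^ m / fact m \<le> exp x"
proof -
  have s: "(\<lambda>n. x ^ n / fact n) sums exp x"
    using exp_converges[of x] by (simp add: divide_inverse mult.commute)
  have "(\<Sum>n\<in>{m}. x ^ n / fact n) \<le> (\<Sum>n. x ^ n / fact n)"
    by (rule sum_le_suminf) (use s assms in \<open>auto simp: sums_iff\<close>)
  then show ?thesis using s by (simp add: sums_iff)
qed

text \<open>On a subinterval the integrand is close to T Q, where T of degree below m replaces the
  kernel and Q of degree at most m is P itself. The deviation is at most 2BD, the Gauss rule
  multiplies it by 4, and N subintervals with the factor a/N give 8 a B D.\<close>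

lemma quadrature_part_error:
  fixes c :: "nat \<Rightarrow> real"
  assumes a: "a > 0" and \<omega>: "\<omega> > 0" and \<kappa>: "\<kappa> = sin \<or> \<kappa> = cos" and N: "N \<ge> 1" and m: "m \<ge> 1"
    and P: "\<And>x. P x = bern_sum m c ((a + x) / (2 * a))"
    and B: "\<And>x. x \<in> {-a..a} \<Longrightarrow> \<bar>P x\<bar> \<le> B"
  shows "\<bar>integral {-a..a} (\<lambda>x. \<kappa> (\<omega> * (y - x)) * P x)
      - a / real N * (\<Sum>h = 1..N. \<Sum>z\<in>legendre_zeros m. gauss_weight m z * (\<kappa> (\<omega> * (y - gamma_inv a N h z)) * P (gamma_inv a N h z)))\<bar>
    \<le> 8 * a * B * (exp (2 * \<omega>) * (a / (2 * real N)) ^ m)"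
proof -
  define \<rho> where "\<rho> = \<omega> * (a / real N)"
  have \<rho>: "\<rho> \<ge> 0" unfolding \<rho>_def using a \<omega> by simp
  define D where "D = \<rho> ^ m / fact m"
  have Pc: "continuous_on S P" for S
    unfolding P bern_sum_def Bernstein_def using a by (intro continuous_intros) auto
  have \<kappa>c: "continuous_on S (\<lambda>x. \<kappa> (g x))" if "continuous_on S g" for S and g :: "real \<Rightarrow> real"
    using \<kappa> that by (auto intro!: continuous_intros)
  have B0: "B \<ge> 0" using B[of 0] a by force
  define g where "g x = \<kappa> (\<omega> * (y - x)) * P x" for x
  have gc: "continuous_on S g" for S unfolding g_def by (intro continuous_intros \<kappa>c Pc)
  have piece: "\<bar>integral {-1..1} (\<lambda>z. g (gamma_inv a N h z)) - (\<Sum>z\<in>legendre_zeros m. gauss_weight m z * g (gamma_inv a N h z))\<bar> \<le> 4 * (B * (2 * D))"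
    if h: "h \<in> {1..N}" for h
  proof -
    define x0 where "x0 = mesh_point a N (h - 1) + a / real N"
    have ga: "gamma_inv a N h z = a / real N * z + x0" for z unfolding gamma_inv_affine x0_def ..
    obtain T where T: "degree T < m" "\<And>z. z \<in> {-1..1} \<Longrightarrow> \<bar>\<kappa> (\<omega> * (y - x0) - \<rho> * z) - poly T z\<bar> \<le> 2 * D"
      using trig_taylor_poly[OF \<kappa> m \<rho>, of "\<omega> * (y - x0)"] unfolding D_def by blast
    obtain Q :: "real poly" where Q: "degree Q \<le> m" "\<And>z. poly Q z = bern_sum m c ((a + x0) / (2 * a) + 1 / (2 * real N) * z)"
      using bern_sum_affine_poly by blast
    have PQ: "P (gamma_inv a N h z) = poly Q z" for z
    proof -
      have "(a + gamma_inv a N h z) / (2 * a) = (a + x0) / (2 * a) + 1 / (2 * real N) * z"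
        unfolding ga using a N by (simp add: field_simps)
      then show ?thesis unfolding P Q(2) by simp
    qed
    have gz: "g (gamma_inv a N h z) = \<kappa> (\<omega> * (y - x0) - \<rho> * z) * poly Q z" for z
      unfolding g_def PQ unfolding ga \<rho>_def by (simp add: algebra_simps)
    show ?thesis
    proof (rule gauss_quadrature_error[OF m, where p = "T * Q"])
      show "degree (T * Q) < 2 * m" using degree_mult_le[of T Q] T(1) Q(1) by linarith
      show "continuous_on {-1..1} (\<lambda>z. g (gamma_inv a N h z))"
        unfolding ga by (rule continuous_on_compose2[OF gc[of UNIV]]) (use N in \<open>auto intro!: continuous_intros\<close>)
      fix z :: real assume z: "z \<in> {-1..1}"
      have "\<bar>poly Q z\<bar> \<le> B" using B[OF gamma_inv_mem[OF a h z]] unfolding PQ .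
      then have "\<bar>poly Q z\<bar> * \<bar>\<kappa> (\<omega> * (y - x0) - \<rho> * z) - poly T z\<bar> \<le> B * (2 * D)"
        using T(2)[OF z] B0 by (intro mult_mono) auto
      moreover have "g (gamma_inv a N h z) - poly (T * Q) z = poly Q z * (\<kappa> (\<omega> * (y - x0) - \<rho> * z) - poly T z)"
        unfolding gz by (simp add: algebra_simps)
      ultimately show "\<bar>g (gamma_inv a N h z) - poly (T * Q) z\<bar> \<le> B * (2 * D)" by (simp add: abs_mult)
    qed
  qed
  have "integral {-a..a} g - a / real N * (\<Sum>h = 1..N. \<Sum>z\<in>legendre_zeros m. gauss_weight m z * g (gamma_inv a N h z))
     = a / real N * (\<Sum>h = 1..N. integral {-1..1} (\<lambda>z. g (gamma_inv a N h z)) - (\<Sum>z\<in>legendre_zeros m. gauss_weight m z * g (gamma_inv a N h z)))"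
    unfolding integral_split_mesh[OF a N gc] sum_subtractf by (simp add: right_diff_distrib)
  also have "\<bar>\<dots>\<bar> \<le> a / real N * (\<Sum>h = 1..N. 4 * (B * (2 * D)))"
    unfolding abs_mult using a piece by (intro mult_mono order_trans[OF sum_abs] sum_mono) (auto intro!: sum_nonneg)
  also have "\<dots> = 8 * a * B * D" using N by simp
  also have "\<dots> \<le> 8 * a * B * (exp (2 * \<omega>) * (a / (2 * real N)) ^ m)"
  proof -
    \<comment> \<open>Moving 2^m into the first factor leaves the base a/(2N), which the base in the
      final bound dominates.\<close>
    have "D = (2 * \<omega>) ^ m / fact m * (a / (2 * real N)) ^ m"
      unfolding D_def \<rho>_def using N by (simp add: power_mult_distrib power_divide)
    also have "\<dots> \<le> exp (2 * \<omega>) * (a / (2 * real N)) ^ m"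
      using power_div_fact_le_exp[of "2 * \<omega>" m] \<omega> a by (intro mult_right_mono) auto
    finally show ?thesis using a B0 by (intro mult_left_mono) auto
  qed
  finally show ?thesis unfolding g_def .
qed

text \<open>Exchanging the sums exhibits the rule as the composite Gauss rule for \<kappa> P, where
  P is the Bernstein sum with the coefficients that C produces from the node values of f.\<close>

lemma osc_quad_eq:
  assumes a: "a > 0" and m: "m \<ge> 1"
    and P: "\<And>x. P x = bern_sum m (\<lambda>i. \<Sum>j\<le>m. C_mat a m l $$ (i, j) * f (equi_node a m j)) ((a + x) / (2 * a))"
  shows "osc_quad \<kappa> \<omega> a N m l f y = a / real N * (\<Sum>h = 1..N. \<Sum>z\<in>legendre_zeros m.
     gauss_weight m z * (\<kappa> (\<omega> * (y - gamma_inv a N h z)) * P (gamma_inv a N h z)))"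
proof -
  define Q where "Q i h z = gauss_weight m z * bern a m i (gamma_inv a N h z) * \<kappa> (\<omega> * (y - gamma_inv a N h z))" for i h z
  define c where "c i = (\<Sum>j\<le>m. C_mat a m l $$ (i, j) * f (equi_node a m j))" for i
  have "(\<Sum>j\<le>m. f (equi_node a m j) * (\<Sum>i\<le>m. C_mat a m l $$ (i, j) * (\<Sum>h=1..N. \<Sum>z\<in>legendre_zeros m. Q i h z)))
     = (\<Sum>j\<le>m. \<Sum>i\<le>m. C_mat a m l $$ (i, j) * f (equi_node a m j) * (\<Sum>h=1..N. \<Sum>z\<in>legendre_zeros m. Q i h z))"
    by (simp add: sum_distrib_left mult_ac)
  also have "\<dots> = (\<Sum>i\<le>m. c i * (\<Sum>h=1..N. \<Sum>z\<in>legendre_zeros m. Q i h z))"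
    unfolding c_def sum_distrib_right by (rule sum.swap)
  also have "\<dots> = (\<Sum>h=1..N. \<Sum>i\<le>m. c i * (\<Sum>z\<in>legendre_zeros m. Q i h z))"
    unfolding sum_distrib_left[of _ _ "{1..N}"] by (rule sum.swap)
  also have "\<dots> = (\<Sum>h=1..N. \<Sum>z\<in>legendre_zeros m. \<Sum>i\<le>m. c i * Q i h z)"
    unfolding sum_distrib_left by (intro sum.cong refl sum.swap)
  also have "\<dots> = (\<Sum>h=1..N. \<Sum>z\<in>legendre_zeros m. gauss_weight m z * (\<kappa> (\<omega> * (y - gamma_inv a N h z)) * P (gamma_inv a N h z)))"
  proof (intro sum.cong refl)
    fix h z
    show "(\<Sum>i\<le>m. c i * Q i h z) = gauss_weight m z * (\<kappa> (\<omega> * (y - gamma_inv a N h z)) * P (gamma_inv a N h z))"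
      unfolding P c_def[symmetric] bern_sum_def Q_def bern_eq_Bernstein[OF a] sum_distrib_left
      by (intro sum.cong refl) (simp add: mult_ac)
  qed
  finally show ?thesis unfolding osc_quad_def Q_def by simp
qed

theorem mainTheorem3:
  fixes a \<omega> :: real and \<kappa> :: "real \<Rightarrow> real" and N l r :: nat
  assumes "a > 0" and "\<omega> > 0"
    and "\<kappa> = sin \<or> \<kappa> = cos"
    and "N = nat \<lfloor>\<omega> * a / pi\<rfloor> + 1"
    and "l \<ge> 1" and "1 \<le> r" and "r \<le> 2 * l"
  shows "\<exists>(m0 :: nat) (C :: real). C > 0 \<and>
    (\<forall>f\<in>sobolev_W a r. \<forall>y\<in>{-a..a}. \<forall>m>m0.
       \<bar>osc_integral \<kappa> \<omega> a f y - osc_quad \<kappa> \<omega> a N m l f y\<bar>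
       \<le> C * sobolev_norm a r f *
          (a ^ (r + 1) / sqrt (real m) ^ r +
           real m powr (3 / 2) * mat_inf_norm (C_mat a m l) *
             (a / real N * ((real m + \<omega>) / (2 * real m - 1))) ^ m))"
proof -
  note a = assms(1) and \<omega> = assms(2) and \<kappa> = assms(3) and l = assms(5) and r = assms(6,7)
  have N: "N \<ge> 1" using assms(4) by simp
  obtain C0 n0 where C0: "C0 \<ge> 0" and approx: "\<And>n f u. n \<ge> n0 \<Longrightarrow> f \<in> sobolev_W a r \<Longrightarrow> u \<in> {0..1} \<Longrightarrow>
     \<bar>(bern_err n ^^ l) (\<lambda>u. f (a * (2 * u - 1))) u\<bar> \<le> C0 * sobolev_norm a r f / sqrt n ^ r"
    using sobolev_bern_err_bound[OF a r] by blast
  \<comment> \<open>8a and exp(2\<omega>) are those of \<open>quadrature_part_error\<close>; 2^l + 1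
    bounds P relative to the norm of f.\<close>
  define Q where "Q = 8 * a * (2 ^ l + 1) * exp (2 * \<omega>)"
  \<comment> \<open>2a is the length of the interval; dividing by a^(r+1) fits the approximation
    error to the form of the first term.\<close>
  define C where "C = 2 * a * C0 / a ^ (r + 1) + Q"
  have Q: "Q > 0" unfolding Q_def using a by (intro mult_pos_pos add_pos_pos) auto
  have C: "C > 0" unfolding C_def using Q a C0 by (intro add_nonneg_pos) auto
  show ?thesis
  proof (intro exI[of _ n0] exI[of _ C] conjI C ballI allI impI)
    fix f y m assume f: "f \<in> sobolev_W a r" and y: "y \<in> {-a..a}" and mn: "m > n0"
    \<comment> \<open>The strict inequality m > n0 excludes m = 0, where j/m would be the default
      value 0.\<close>
    have m: "m \<ge> 1" using mn by simp
    define Nf where "Nf = sobolev_norm a r f"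
    have fc: "continuous_on {-a..a} f" using f unfolding sobolev_W_def by blast
    have E: "real_of_ereal (weighted_esssup a r f) \<ge> 0" using f by (intro weighted_esssup_AE(1)[OF a]) (auto simp: sobolev_W_def)
    have fN: "\<bar>f x\<bar> \<le> Nf" if "x \<in> {-a..a}" for x
      using abs_le_sup_norm[OF fc that] E unfolding Nf_def sobolev_norm_def by linarith
    have Nf: "Nf \<ge> 0" using fN[of 0] a by force
    define F where "F u = f (a * (2 * u - 1))" for u
    define P where "P x = bern_sum m (\<lambda>i. \<Sum>j\<le>m. C_mat a m l $$ (i, j) * f (equi_node a m j)) ((a + x) / (2 * a))" for x
    have u01: "(a + x) / (2 * a) \<in> {0..1}" if "x \<in> {-a..a}" for x using that a by (auto simp: divide_simps)
    have I01: "a * (2 * t - 1) \<in> {-a..a}" if "t \<in> {0..1}" for t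
    proof -
      have "a * (2 * t - 1) \<le> a * 1" "a * (- 1) \<le> a * (2 * t - 1)" using that a by (intro mult_left_mono; simp)+
      then show ?thesis by simp
    qed
    have Px: "P x = f x - (bern_err m ^^ l) F ((a + x) / (2 * a))" for x
    proof -
      have "P x = bern_sum m (\<lambda>i. \<Sum>j\<le>m. C_mat a m l $$ (i, j) * F (real j / real m)) ((a + x) / (2 * a))"
        unfolding P_def F_def equi_node_scaled(2)[OF a] ..
      also have "\<dots> = F ((a + x) / (2 * a)) - (bern_err m ^^ l) F ((a + x) / (2 * a))"
        by (rule C_mat_bern_sum[OF a m])
      also have "F ((a + x) / (2 * a)) = f x" unfolding F_def using a by (simp add: field_simps)
      finally show ?thesis .
    qed
    have Pb: "\<bar>P x\<bar> \<le> (2 ^ l + 1) * Nf" if x: "x \<in> {-a..a}" for x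
    proof -
      have "\<bar>(bern_err m ^^ l) F ((a + x) / (2 * a))\<bar> \<le> 2 ^ l * Nf"
        by (rule bern_err_funpow_bound[OF m _ u01[OF x]]) (use fN I01 in \<open>auto simp: F_def\<close>)
      then show ?thesis using fN[OF x] unfolding Px by (simp add: algebra_simps)
    qed
    have fP: "\<bar>f x - P x\<bar> \<le> C0 * Nf / sqrt m ^ r" if x: "x \<in> {-a..a}" for x
      using approx[of m f, OF _ f u01[OF x]] mn unfolding Px F_def Nf_def by simp
    have Pc: "continuous_on {-a..a} P"
      unfolding P_def bern_sum_def Bernstein_def using a by (intro continuous_intros) auto
    have \<kappa>c: "continuous_on {-a..a} (\<lambda>x. \<kappa> (\<omega> * (y - x)))" using \<kappa> by (auto intro!: continuous_intros)
    have \<kappa>1: "\<bar>\<kappa> t\<bar> \<le> 1" for t using \<kappa> by auto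
    have 1: "\<bar>osc_integral \<kappa> \<omega> a f y - integral {-a..a} (\<lambda>x. \<kappa> (\<omega> * (y - x)) * P x)\<bar> \<le> 2 * a * (C0 * Nf / sqrt m ^ r)"
    proof -
      have "osc_integral \<kappa> \<omega> a f y - integral {-a..a} (\<lambda>x. \<kappa> (\<omega> * (y - x)) * P x)
         = integral {-a..a} (\<lambda>x. \<kappa> (\<omega> * (y - x)) * f x - \<kappa> (\<omega> * (y - x)) * P x)"
        unfolding osc_integral_def
        by (intro integral_diff[symmetric] integrable_continuous_real continuous_intros \<kappa>c fc Pc)
      also have "norm \<dots> \<le> integral {-a..a} (\<lambda>x. C0 * Nf / sqrt m ^ r)"
      proof (rule integral_norm_bound_integral)
        show "(\<lambda>x. \<kappa> (\<omega> * (y - x)) * f x - \<kappa> (\<omega> * (y - x)) * P x) integrable_on {-a..a}"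
          by (intro integrable_continuous_real continuous_intros \<kappa>c fc Pc)
        fix x assume x: "x \<in> {-a..a}"
        have "\<bar>\<kappa> (\<omega> * (y - x))\<bar> * \<bar>f x - P x\<bar> \<le> 1 * (C0 * Nf / sqrt m ^ r)"
          by (intro mult_mono \<kappa>1 fP x) auto
        then show "norm (\<kappa> (\<omega> * (y - x)) * f x - \<kappa> (\<omega> * (y - x)) * P x) \<le> C0 * Nf / sqrt m ^ r"
          unfolding right_diff_distrib[symmetric] by (simp add: abs_mult)
      qed auto
      finally show ?thesis using a by (simp add: mult_ac)
    qed
    have 2: "\<bar>integral {-a..a} (\<lambda>x. \<kappa> (\<omega> * (y - x)) * P x) - osc_quad \<kappa> \<omega> a N m l f y\<bar>
        \<le> 8 * a * ((2 ^ l + 1) * Nf) * (exp (2 * \<omega>) * (a / (2 * real N)) ^ m)"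
      unfolding osc_quad_eq[OF a m P_def]
      by (rule quadrature_part_error[OF a \<omega> \<kappa> N m P_def Pb])
    define R where "R = (a / real N * ((real m + \<omega>) / (2 * real m - 1))) ^ m"
    define M where "M = real m powr (3 / 2) * mat_inf_norm (C_mat a m l)"
    have R: "(a / (2 * real N)) ^ m \<le> R"
    proof -
      \<comment> \<open>Since 2m + 2\<omega> \<ge> 2m - 1, the base in the final bound is at least
        a/(2N).\<close>
      have "1 / 2 \<le> (real m + \<omega>) / (2 * real m - 1)" using m \<omega> by (subst le_divide_eq) auto
      then have "a / real N * (1 / 2) \<le> a / real N * ((real m + \<omega>) / (2 * real m - 1))"
        using a by (intro mult_left_mono) auto
      then show ?thesis unfolding R_def using a by (intro power_mono) auto
    qed
    have R0: "R \<ge> 0" by (rule order_trans[OF _ R]) (use a in simp)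
    \<comment> \<open>Both factors are at least 1, so the quadrature error, of size (a/(2N))^m, is
      covered by M R.\<close>
    have M: "M \<ge> 1"
    proof -
      have "1 * 1 \<le> real m powr (3 / 2) * mat_inf_norm (C_mat a m l)"
        using m by (intro mult_mono mat_inf_norm_C_mat_ge_1[OF a m l] ge_one_powr_ge_zero) auto
      then show ?thesis unfolding M_def by simp
    qed
    have RM: "(a / (2 * real N)) ^ m \<le> M * R" using R mult_right_mono[OF M R0] by simp
    have MR0: "M * R \<ge> 0" using M R0 by simp
    have "\<bar>osc_integral \<kappa> \<omega> a f y - osc_quad \<kappa> \<omega> a N m l f y\<bar>
       \<le> 2 * a * (C0 * Nf / sqrt m ^ r) + 8 * a * ((2 ^ l + 1) * Nf) * (exp (2 * \<omega>) * (a / (2 * real N)) ^ m)"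
      using 1 2 by linarith
    also have "\<dots> = 2 * a * C0 / a ^ (r + 1) * Nf * (a ^ (r + 1) / sqrt m ^ r) + Q * Nf * (a / (2 * real N)) ^ m"
      unfolding Q_def using a by (simp add: field_simps)
    also have "\<dots> \<le> C * Nf * (a ^ (r + 1) / sqrt m ^ r) + C * Nf * (M * R)"
    proof (intro add_mono mult_mono RM order_refl)
      show "2 * a * C0 / a ^ (r + 1) \<le> C" unfolding C_def using Q by simp
      show "Q \<le> C" unfolding C_def using a C0 by simp
    qed (use a Nf C Q MR0 in auto)
    also have "\<dots> = C * Nf * (a ^ (r + 1) / sqrt m ^ r + M * R)" by (simp add: distrib_left)
    finally show "\<bar>osc_integral \<kappa> \<omega> a f y - osc_quad \<kappa> \<omega> a N m l f y\<bar>
       \<le> C * sobolev_norm a r f * (a ^ (r + 1) / sqrt (real m) ^ r +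
           real m powr (3 / 2) * mat_inf_norm (C_mat a m l) * (a / real N * ((real m + \<omega>) / (2 * real m - 1))) ^ m)"
      unfolding M_def R_def Nf_def .
  qed
qed

end
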